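(* Let $n=p+q\ge 3$ and $\delta\in\mathbb{R}$. The commutant $\mathfrak{so}(p+1,q+1)^!$ in $\mathrm{End}_{\mathrm{diff}}(\mathbb{C}[x^1,\ldots,x^n,\xi_1,\ldots,\xi_n]_\delta)$ is the commutative associative algebra generated by $\mathrm{E}$ and $\mathrm{R}_0$.
   Context: Let $g=(g_{ij})$ be the constant flat metric of signature $(p,q)$ on $\mathbb{R}^n$, used to raise and lower indices; repeated indices are summed; $\partial_i=\partial/\partial x^i$. $\mathbb{C}[x^1,\ldots,x^n,\xi_1,\ldots,\xi_n]_\delta$ is the space of polynomials on $T^*\mathbb{R}^n$ with the action of a polynomial vector field $X=X^i\xi_i$ by $L^\delta_X=\partial_{\xi_i}X\,\partial_i-\partial_iX\,\partial_{\xi_i}+\delta\,\partial_iX^i$. $\mathrm{End}_{\mathrm{diff}}$ denotes the algebra of polynomial differential operators $\mathbb{C}[x^i,\xi_i,\partial/\partial x^i,\partial/\partial\xi_i]$ acting on this space. For a Lie algebra $\mathfrak{g}$ of polynomial vector fields, the commutant $\mathfrak{g}^!$ is the set of elements of $\mathrm{End}_{\mathrm{diff}}$ commuting with $L^\delta_X$ for all $X\in\mathfrak{g}$. $\mathfrak{so}(p+1,q+1)$ is the Lie algebra spanned by $X_i=\partial_i$, $X_{ij}=x_i\partial_j-x_j\partial_i$, $X_0=x^i\partial_i$, $\bar X_i=x_jx^j\partial_i-2x_ix^j\partial_j$. The operators are $\mathrm{E}=\xi_i\frac{\partial}{\partial\xi_i}+\frac n2$ and $\mathrm{R}_0=\mathrm{R}\,\mathrm{T}$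 with $\mathrm{R}=\xi^i\xi_i$, $\mathrm{T}=\frac{\partial}{\partial\xi^i}\frac{\partial}{\partial\xi_i}$. *)

theory Defs
  imports "HOL-Analysis.Analysis" "HOL-Library.Poly_Mapping"
begin

(* C[x^1,...,x^n,xi_1,...,xi_n] as the monoid algebra of exponent vectors; the coordinates
   are indexed by the finite type 'n, Inl i standing for x^i and Inr i for xi_i. *)
type_synonym 'n phase_poly = "(('n + 'n) \<Rightarrow>\<^sub>0 nat) \<Rightarrow>\<^sub>0 complex"
type_synonym 'n operator = "'n phase_poly \<Rightarrow> 'n phase_poly"

(* The components X^i of a vector field; they are meant to be free of the xi-variables. *)
type_synonym 'n vfield = "('n phase_poly)^'n"

definition const :: "complex \<Rightarrow> 'n phase_poly" where
  "const c = Poly_Mapping.single 0 c"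

definition var :: "'n + 'n \<Rightarrow> 'n phase_poly" where
  "var v = Poly_Mapping.single (Poly_Mapping.single v 1) 1"

abbreviation xup :: "'n \<Rightarrow> 'n phase_poly" where "xup i \<equiv> var (Inl i)"
abbreviation xi :: "'n \<Rightarrow> 'n phase_poly" where "xi i \<equiv> var (Inr i)"

definition pd :: "'n + 'n \<Rightarrow> 'n operator" where
  "pd v f = (\<Sum>m\<in>Poly_Mapping.keys f.
     Poly_Mapping.single (m - Poly_Mapping.single v 1)
       (of_nat (Poly_Mapping.lookup m v) * Poly_Mapping.lookup f m))"

abbreviation dx :: "'n \<Rightarrow> 'n operator" where "dx i \<equiv> pd (Inl i)"
abbreviation dxi :: "'n \<Rightarrow> 'n operator" where "dxi i \<equiv> pd (Inr i)"

lemma lookup_pd: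
  "Poly_Mapping.lookup (pd v f) m =
     of_nat (Suc (Poly_Mapping.lookup m v)) * Poly_Mapping.lookup f (m + Poly_Mapping.single v 1)"
proof -
  let ?s = "Poly_Mapping.single v (1::nat)"
  have eq: "(of_nat (Poly_Mapping.lookup k v) * Poly_Mapping.lookup f k when k - ?s = m)
      = (of_nat (Suc (Poly_Mapping.lookup m v)) * Poly_Mapping.lookup f (m + ?s)
          when k = m + ?s)" for k
  proof (cases "Poly_Mapping.lookup k v = 0")
    case True
    then have "k \<noteq> m + ?s"
      by (auto simp: lookup_add)
    with True show ?thesis by (simp add: when_def)
  next
    case False
    then have "k - ?s + ?s = k"
      by (intro poly_mapping_eqI) (auto simp: lookup_add lookup_minus lookup_single when_def)
    then have "k - ?s = m \<longleftrightarrow> k = m + ?s"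
      by (metis add_diff_cancel_right')
    then show ?thesis by (auto simp: when_def lookup_add)
  qed
  have "Poly_Mapping.lookup (pd v f) m = (\<Sum>k\<in>Poly_Mapping.keys f.
      (of_nat (Poly_Mapping.lookup k v) * Poly_Mapping.lookup f k when k - ?s = m))"
    by (simp add: pd_def lookup_sum lookup_single)
  also have "\<dots> = (\<Sum>k\<in>Poly_Mapping.keys f.
      (of_nat (Suc (Poly_Mapping.lookup m v)) * Poly_Mapping.lookup f (m + ?s) when k = m + ?s))"
    by (simp only: eq)
  also have "\<dots> = of_nat (Suc (Poly_Mapping.lookup m v)) * Poly_Mapping.lookup f (m + ?s)"
    by (simp add: when_def in_keys_iff)
  finally show ?thesis .
qed

(* Unital subalgebras over C of the algebra of operators; the product is composition. *)
definition op_subalgebra :: "'n operator set \<Rightarrow> bool" where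
  "op_subalgebra S \<longleftrightarrow>
     id \<in> S \<and>
     (\<forall>A\<in>S. \<forall>B\<in>S. (\<lambda>f. A f + B f) \<in> S) \<and>
     (\<forall>c. \<forall>A\<in>S. (\<lambda>f. const c * A f) \<in> S) \<and>
     (\<forall>A\<in>S. \<forall>B\<in>S. A \<circ> B \<in> S)"

definition End_diff :: "'n operator set" where
  "End_diff = op_subalgebra hull (range (\<lambda>v f. var v * f) \<union> range pd)"

definition Lie_op :: "real \<Rightarrow> 'n::finite vfield \<Rightarrow> 'n operator" where
  "Lie_op \<delta> X f =
     (let S = (\<Sum>j\<in>UNIV. X $ j * xi j) in
      (\<Sum>i\<in>UNIV. dxi i S * dx i f - dx i S * dxi i f + const (of_real \<delta>) * dx i (X $ i) * f))"

definition commutant :: "real \<Rightarrow> 'n::finite vfield set \<Rightarrow> 'n operator set" where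
  "commutant \<delta> \<g> = {A \<in> End_diff. \<forall>X\<in>\<g>. A \<circ> Lie_op \<delta> X = Lie_op \<delta> X \<circ> A}"

(* Sylvester normal form: in some basis (the columns of P) the form g is diagonal with
   p entries 1 and q entries -1. *)
definition has_signature :: "real^'n^'n \<Rightarrow> nat \<Rightarrow> nat \<Rightarrow> bool" where
  "has_signature g p q \<longleftrightarrow> transpose g = g \<and>
     (\<exists>(P :: real^'n^'n) \<epsilon>. invertible P \<and> (\<forall>i. \<epsilon> i = 1 \<or> \<epsilon> i = -1) \<and>
        card {i. \<epsilon> i = 1} = p \<and> card {i. \<epsilon> i = -1} = q \<and>
        transpose P ** g ** P = (\<chi> i j. if i = j then \<epsilon> i else 0))"

definition xlow :: "real^'n^'n \<Rightarrow> 'n::finite \<Rightarrow> 'n phase_poly" where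
  "xlow g i = (\<Sum>j\<in>UNIV. const (of_real (g $ i $ j)) * xup j)"

definition xi_up :: "real^'n^'n \<Rightarrow> 'n::finite \<Rightarrow> 'n phase_poly" where
  "xi_up g i = (\<Sum>j\<in>UNIV. const (of_real (matrix_inv g $ i $ j)) * xi j)"

(* The derivative with respect to xi^i; since xi_j = g_ij xi^i, the index is lowered by g. *)
definition dxi_low :: "real^'n^'n \<Rightarrow> 'n::finite \<Rightarrow> 'n operator" where
  "dxi_low g i f = (\<Sum>j\<in>UNIV. const (of_real (g $ i $ j)) * dxi j f)"

definition coord_field :: "'n::finite \<Rightarrow> 'n vfield" where
  "coord_field i = (\<chi> k. if k = i then 1 else 0)"

definition rot_field :: "real^'n^'n \<Rightarrow> 'n::finite \<Rightarrow> 'n \<Rightarrow> 'n vfield" where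
  "rot_field g i j = xlow g i *s coord_field j - xlow g j *s coord_field i"

definition euler_field :: "'n::finite vfield" where
  "euler_field = (\<Sum>i\<in>UNIV. xup i *s coord_field i)"

definition inv_field :: "real^'n^'n \<Rightarrow> 'n::finite \<Rightarrow> 'n vfield" where
  "inv_field g i =
     (\<Sum>j\<in>UNIV. xlow g j * xup j) *s coord_field i
     - (\<Sum>j\<in>UNIV. (const 2 * xlow g i * xup j) *s coord_field j)"

global_interpretation vf: module "\<lambda>(r::real) (X::'n::finite vfield). const (of_real r) *s X"
proof -
  have const_simps: "const (a + b) = (const a + const b :: 'n phase_poly)"
    "const (a * b) = (const a * const b :: 'n phase_poly)"
    "const 1 = (1 :: 'n phase_poly)" for a b
    by (simp_all add: const_def single_add mult_single)
  show "module (\<lambda>(r::real) (X::'n vfield). const (of_real r) *s X)"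
    by unfold_locales (simp_all add: const_simps vec_eq_iff distrib_left distrib_right mult.assoc)
qed

definition so_conf :: "real^'n^'n \<Rightarrow> 'n::finite vfield set" where
  "so_conf g = vf.span
     (range coord_field \<union> {rot_field g i j | i j. True} \<union> {euler_field} \<union> range (inv_field g))"

definition E_op :: "'n::finite operator" where
  "E_op f = (\<Sum>i\<in>UNIV. xi i * dxi i f) + const (of_nat CARD('n) / 2) * f"

definition R_op :: "real^'n^'n \<Rightarrow> 'n::finite operator" where
  "R_op g f = (\<Sum>i\<in>UNIV. xi_up g i * xi i) * f"

definition T_op :: "real^'n^'n \<Rightarrow> 'n::finite operator" where
  "T_op g f = (\<Sum>i\<in>UNIV. dxi_low g i (dxi i f))"

definition R0_op :: "real^'n^'n \<Rightarrow> 'n::finite operator" where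
  "R0_op g = R_op g \<circ> T_op g"

end

theory Submission
  imports Defs
begin

text \<open>Pass to full symbols, polynomials in \<open>x\<close>, \<open>\<xi>\<close> and the symbols \<open>p\<close> of \<open>\<partial>/\<partial>x\<close> and \<open>\<eta>\<close> of \<open>\<partial>/\<partial>\<xi>\<close>.
  Commuting with translations makes the symbol \<open>a\<close> of \<open>A\<close> independent of \<open>x\<close>. The part of top degree in
  \<open>\<eta>\<close> of the commutator with an inversion gives, for the leading part \<open>v\<close> of \<open>\<partial>a/\<partial>p\<close>, the linear system
  \<open>g(v,\<eta>) \<xi> - \<langle>v,\<xi>\<rangle> g\<eta> - \<langle>\<xi>,\<eta>\<rangle> gv = 0\<close>, which is nondegenerate at generic points; so \<open>a\<close> is
  independent of \<open>p\<close>. Commuting with dilations makes \<open>a\<close> a sum of parts of bidegree \<open>(d, d)\<close> in \<open>(\<xi>, \<eta>)\<close>.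
  In a complex orthonormal frame with real coordinates \<open>u\<close> of \<open>\<xi>\<close> and \<open>v\<close> of \<open>\<eta>\<close>, such a part is invariant
  under rotations, and since \<open>n \<ge> 3\<close> a rotation brings \<open>(u, v)\<close> to \<open>(s e\<^sub>1, t e\<^sub>1 \<plusminus> r e\<^sub>2)\<close> with either sign.
  Hence it is a combination of the \<open>(st)\<^bsup>d-2c\<^esup> (sr)\<^bsup>2c\<^esup>\<close>, where \<open>st = u \<bullet> v\<close> and
  \<open>(sr)\<^sup>2 = (u \<bullet> u) (v \<bullet> v) - (u \<bullet> v)\<^sup>2\<close>. So \<open>a\<close> is a polynomial in \<open>\<xi>\<^sub>i\<eta>\<^sup>i\<close> and \<open>\<xi>\<^sup>i\<xi>\<^sub>i \<eta>\<^sub>j\<eta>\<^sup>j\<close>, and the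
  normally ordered products of these are polynomials in \<open>E\<close> and \<open>R\<^sub>0\<close> because \<open>[T, R] = 4 E\<close>.\<close>

section \<open>Polynomials and evaluation\<close>

text \<open>The metric may be indefinite, so isotropic vectors and noncompact orbits would get in
  the way over the reals. Points with real coordinates in the complex frame form a totally real
  subspace on which the metric is Euclidean, whatever the signature. There norms, the Cauchy-Schwarz
  inequality and compact rotations are available, and a polynomial vanishing on a nonempty
  relatively open part of it is zero. Only a Lie algebra acts, so the invariance obtained is under
  connected rotations, and the reflection r -> -r has to come from such a rotation. For n = 2 this
  fails: u_1 v_2 - u_2 v_1 is a further invariant of bidegree (1, 1). An inversion is quadratic in
  x, so its commutator with the operator contains first and second derivatives of the symbol in p.
  The terms of the inversion with \<partial>/\<partial>\<xi> raise the degree in \<eta> by one.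
  Taking the top degree isolates them and discards the other terms, among them the one with
  \<delta>; this is why the commutant is the same for all \<delta>.\<close>

lemma const_simps:
  "const 0 = (0 :: 'n phase_poly)" "const 1 = (1 :: 'n phase_poly)"
  "const (a + b) = (const a + const b :: 'n phase_poly)"
  "const (a * b) = (const a * const b :: 'n phase_poly)"
  "const (- a) = (- const a :: 'n phase_poly)"
  "const (a - b) = (const a - const b :: 'n phase_poly)"
  by (simp_all add: const_def single_add mult_single single_uminus single_diff)

lemma const_sum: "const (sum h I) = (\<Sum>i\<in>I. const (h i))"
  by (induction I rule: infinite_finite_induct) (simp_all add: const_simps)

lemma const_of_nat: "const (of_nat k) = of_nat k"
  by (induction k) (simp_all add: const_simps)

lemma lookup_const_mult: "Poly_Mapping.lookup (const c * f) m = c * Poly_Mapping.lookup f m"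
  by (simp add: const_def Poly_Mapping.map.rep_eq when_def flip: mult_map_scale_conv_mult)

lemma var_mult_single:
  "var v * Poly_Mapping.single m c = Poly_Mapping.single (Poly_Mapping.single v 1 + m) c"
  by (simp add: var_def mult_single)

lemma const_mult_single: "const c * Poly_Mapping.single m d = Poly_Mapping.single m (c * d)"
  by (simp add: const_def mult_single)

lemma single_induct [case_names single add]:
  assumes "\<And>m c. P (Poly_Mapping.single m c)" and "\<And>f g. P f \<Longrightarrow> P g \<Longrightarrow> P (f + g)"
  shows "P (f :: 'a \<Rightarrow>\<^sub>0 'b::comm_monoid_add)"
proof (induction f rule: update_induct)
  case const
  then show ?case using assms(1)[of undefined 0] by simp
next
  case (update f a b)
  have "Poly_Mapping.update a b f = f + Poly_Mapping.single a b"
    using update by (intro poly_mapping_eqI) (auto simp: lookup_update lookup_add lookup_single in_keys_iff when_def)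
  with update assms show ?case by simp
qed

lemma exponent_induct [case_names zero var]:
  fixes m :: "'v \<Rightarrow>\<^sub>0 nat"
  assumes "P 0" and "\<And>m v. P m \<Longrightarrow> P (Poly_Mapping.single v 1 + m)"
  shows "P m"
proof (induction m rule: update_induct)
  case const
  then show ?case by (simp add: assms)
next
  case (update f a b)
  have *: "P (Poly_Mapping.single a k + f)" for k
  proof (induction k)
    case 0
    then show ?case using update by simp
  next
    case (Suc k)
    have "Poly_Mapping.single a (Suc k) = Poly_Mapping.single a 1 + Poly_Mapping.single a k"
      by (simp flip: single_add)
    then show ?case using assms(2)[OF Suc, of a] by (simp add: add.assoc)
  qed
  have "Poly_Mapping.update a b f = Poly_Mapping.single a b + f"
    using update by (intro poly_mapping_eqI) (auto simp: lookup_update lookup_add lookup_single in_keys_iff when_def)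
  with * show ?case by simp
qed

lemma phase_poly_induct [case_names const add var]:
  assumes "\<And>c. P (const c)" and "\<And>f g. P f \<Longrightarrow> P g \<Longrightarrow> P (f + g)"
    and "\<And>v f. P f \<Longrightarrow> P (var v * f)"
  shows "P f"
proof (induction f rule: single_induct)
  case (single m c)
  show ?case
    by (induction m rule: exponent_induct)
      (use assms(1)[of c] assms(3) in \<open>auto simp: const_def simp flip: var_mult_single simp del: One_nat_def\<close>)
qed (use assms(2) in auto)

section \<open>Partial derivatives as commuting derivations\<close>

lemma pd_add: "pd v (f + g) = pd v f + pd v g"
  by (intro poly_mapping_eqI) (simp add: lookup_pd lookup_add algebra_simps)

lemma pd_const_mult: "pd v (const c * f) = const c * pd v f"
  by (intro poly_mapping_eqI) (simp add: lookup_pd lookup_const_mult)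

lemma pd_const [simp]: "pd v (const c) = 0"
  by (intro poly_mapping_eqI) (auto simp: lookup_pd const_def lookup_single when_def lookup_add
      dest: arg_cong[where f = "\<lambda>m. Poly_Mapping.lookup m v"])

lemma pd_0 [simp]: "pd v 0 = 0" and pd_1 [simp]: "pd v 1 = 0"
  using pd_const[of v 0] pd_const[of v 1] by (simp_all add: const_simps)

lemma pd_sum: "pd v (sum h I) = (\<Sum>i\<in>I. pd v (h i))"
  by (induction I rule: infinite_finite_induct) (simp_all add: pd_add)

lemma pd_uminus: "pd v (- f) = - pd v f"
  using pd_add[of v f "- f"] by (simp add: eq_neg_iff_add_eq_0 add.commute)

lemma pd_diff: "pd v (f - g) = pd v f - pd v g"
  using pd_add[of v f "- g"] by (simp add: pd_uminus)

lemma pd_commute: "pd v (pd u f) = pd u (pd v f)"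
  by (intro poly_mapping_eqI)
    (cases "u = v", auto simp: lookup_pd lookup_add lookup_single when_def add_ac mult_ac)

lemma pd_single: "pd v (Poly_Mapping.single m c) =
    Poly_Mapping.single (m - Poly_Mapping.single v 1) (of_nat (Poly_Mapping.lookup m v) * c)"
  by (cases "c = 0") (simp_all add: pd_def)

lemma pd_var_mult: "pd v (var u * f) = (if u = v then f else 0) + var u * pd v f"
proof (induction f rule: single_induct)
  case (single m c)
  have eq: "Poly_Mapping.single u 1 + m - Poly_Mapping.single v 1 =
      (if u = v then m else Poly_Mapping.single u 1 + (m - Poly_Mapping.single v 1))"
    by (intro poly_mapping_eqI)
      (auto simp: lookup_add lookup_minus lookup_single when_def)
  have eq2: "Poly_Mapping.single v 1 + (m - Poly_Mapping.single v 1) = m"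
    if "Poly_Mapping.lookup m v \<noteq> 0"
    using that by (intro poly_mapping_eqI) (auto simp: lookup_add lookup_minus lookup_single when_def)
  show ?case
  proof (cases "u = v \<and> Poly_Mapping.lookup m v \<noteq> 0")
    case True
    then show ?thesis
      using eq2 by (simp add: var_mult_single pd_single eq lookup_add algebra_simps flip: single_add)
  next
    case False
    then show ?thesis
      by (auto simp: var_mult_single pd_single eq lookup_add lookup_single when_def simp del: One_nat_def)
  qed
next
  case (add f g)
  then show ?case by (simp add: pd_add algebra_simps)
qed

lemma pd_var: "pd v (var u) = (if u = v then 1 else 0)"
  using pd_var_mult[of v u 1] by simp

lemma pd_mult: "pd v (f * g) = pd v f * g + f * pd v g"
proof (induction f rule: phase_poly_induct)
  case (const c)
  then show ?case by (simp add: pd_const_mult)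
next
  case (add f g)
  then show ?case by (simp add: pd_add algebra_simps)
next
  case (var u f)
  then show ?case by (simp add: pd_var_mult mult.assoc) (simp add: algebra_simps)
qed

text \<open>Differentiation multiplies a coefficient by its exponent, which is invertible in
  characteristic zero, and distinct monomials containing \<open>v\<close> have distinct derivatives.
  So nothing can cancel.\<close>

lemma pd_eq_0_keys:
  assumes "pd v f = 0" and "m \<in> Poly_Mapping.keys f"
  shows "Poly_Mapping.lookup m v = 0"
proof (rule ccontr)
  assume nz: "Poly_Mapping.lookup m v \<noteq> 0"
  let ?m = "m - Poly_Mapping.single v 1"
  have "?m + Poly_Mapping.single v 1 = m"
    using nz by (intro poly_mapping_eqI) (auto simp: lookup_add lookup_minus lookup_single when_def)
  then have "Poly_Mapping.lookup f m = 0"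
    using lookup_pd[of v f ?m] assms(1) by (simp del: of_nat_Suc)
  then show False using assms(2) by (simp add: in_keys_iff)
qed

lemma all_pd_eq_0:
  assumes "\<And>v. pd v f = 0"
  shows "f = const (Poly_Mapping.lookup f 0)"
proof (rule poly_mapping_eqI)
  fix m
  show "Poly_Mapping.lookup f m = Poly_Mapping.lookup (const (Poly_Mapping.lookup f 0)) m"
  proof (cases "m = 0")
    case False
    then obtain v where "Poly_Mapping.lookup m v \<noteq> 0"
      by (metis lookup_zero poly_mapping_eqI)
    then have "m \<notin> Poly_Mapping.keys f" using pd_eq_0_keys[OF assms, of m] by auto
    with False show ?thesis by (simp add: in_keys_iff const_def lookup_single when_def)
  qed (simp add: const_def)
qed

section \<open>Evaluation at complex points and the identity principle\<close>

definition poly_eval :: "('n::finite + 'n \<Rightarrow> complex) \<Rightarrow> 'n phase_poly \<Rightarrow> complex" where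
  "poly_eval z f = (\<Sum>m\<in>Poly_Mapping.keys f. Poly_Mapping.lookup f m * (\<Prod>v\<in>UNIV. z v ^ Poly_Mapping.lookup m v))"

lemma poly_eval_superset:
  assumes "finite M" and "Poly_Mapping.keys f \<subseteq> M"
  shows "poly_eval z f = (\<Sum>m\<in>M. Poly_Mapping.lookup f m * (\<Prod>v\<in>UNIV. z v ^ Poly_Mapping.lookup m v))"
  unfolding poly_eval_def using assms by (intro sum.mono_neutral_left) (auto simp: in_keys_iff)

lemma poly_eval_add [simp]: "poly_eval z (f + g) = poly_eval z f + poly_eval z g"
proof -
  let ?M = "Poly_Mapping.keys f \<union> Poly_Mapping.keys g"
  show ?thesis
    using keys_add[of f g]
    by (simp add: poly_eval_superset[of ?M] lookup_add algebra_simps sum.distrib)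
qed

lemma poly_eval_const [simp]: "poly_eval z (const c) = c"
  by (simp add: poly_eval_def const_def)

lemma poly_eval_single:
  "poly_eval z (Poly_Mapping.single m c) = c * (\<Prod>v\<in>UNIV. z v ^ Poly_Mapping.lookup m v)"
  by (simp add: poly_eval_def)

lemma poly_eval_0 [simp]: "poly_eval z 0 = 0" and poly_eval_1 [simp]: "poly_eval z 1 = 1"
  using poly_eval_const[of z 0] poly_eval_const[of z 1] by (simp_all add: const_simps)

lemma poly_eval_var_mult: "poly_eval z (var v * f) = z v * poly_eval z f"
proof (induction f rule: single_induct)
  case (single m c)
  have "(\<Prod>u\<in>UNIV. z u ^ Poly_Mapping.lookup (Poly_Mapping.single v 1 + m) u) =
     (\<Prod>u\<in>UNIV. (if u = v then z u else 1) * z u ^ Poly_Mapping.lookup m u)"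
    by (intro prod.cong) (auto simp: lookup_add lookup_single when_def)
  also have "\<dots> = z v * (\<Prod>u\<in>UNIV. z u ^ Poly_Mapping.lookup m u)"
    by (simp add: prod.distrib)
  finally show ?case by (simp add: var_mult_single poly_eval_single)
qed (simp add: algebra_simps)

lemma poly_eval_var [simp]: "poly_eval z (var v) = z v"
  using poly_eval_var_mult[of z v 1] by simp

lemma poly_eval_const_mult: "poly_eval z (const c * f) = c * poly_eval z f"
  by (induction f rule: single_induct) (simp_all add: const_mult_single poly_eval_single algebra_simps)

lemma poly_eval_mult [simp]: "poly_eval z (f * g) = poly_eval z f * poly_eval z g"
  by (induction f rule: phase_poly_induct)
    (simp_all add: poly_eval_const_mult poly_eval_var_mult distrib_right mult.assoc)

lemma poly_eval_uminus [simp]: "poly_eval z (- f) = - poly_eval z f"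
  using poly_eval_add[of z f "- f"] by (simp add: eq_neg_iff_add_eq_0 add.commute)

lemma poly_eval_diff [simp]: "poly_eval z (f - g) = poly_eval z f - poly_eval z g"
  using poly_eval_add[of z f "- g"] by simp

lemma poly_eval_sum [simp]: "poly_eval z (sum h I) = (\<Sum>i\<in>I. poly_eval z (h i))"
  by (induction I rule: infinite_finite_induct) simp_all

lemma poly_eval_power [simp]: "poly_eval z (f ^ k) = poly_eval z f ^ k"
  by (induction k) simp_all

lemma poly_eval_cong:
  assumes "\<And>m v. m \<in> Poly_Mapping.keys f \<Longrightarrow> Poly_Mapping.lookup m v \<noteq> 0 \<Longrightarrow> z v = z' v"
  shows "poly_eval z f = poly_eval z' f"
  unfolding poly_eval_def
proof (intro sum.cong refl arg_cong2[where f = "(*)"] prod.cong)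
  fix m v
  assume "m \<in> Poly_Mapping.keys f"
  then show "z v ^ Poly_Mapping.lookup m v = z' v ^ Poly_Mapping.lookup m v"
    using assms[of m v] by (cases "Poly_Mapping.lookup m v = 0") auto
qed

text \<open>The chain rule along a curve with real parameter in complex space. It serves twice: for
  directional derivatives in the identity principle, and for following a symbol along a
  one-parameter group of rotations.\<close>

lemma poly_eval_has_vector_derivative:
  assumes "\<And>v. ((\<lambda>t. z t v) has_vector_derivative z' v) (at t)"
  shows "((\<lambda>t. poly_eval (z t) f) has_vector_derivative (\<Sum>v\<in>UNIV. poly_eval (z t) (pd v f) * z' v)) (at t)"
proof (induction f rule: phase_poly_induct)
  case (const c)
  then show ?case by simp
next
  case (add f g)
  then show ?case
    using has_vector_derivative_add[OF add] by (simp add: pd_add algebra_simps sum.distrib)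
next
  case (var u f)
  let ?S = "\<Sum>v\<in>UNIV. poly_eval (z t) (pd v f) * z' v"
  have "(\<Sum>v\<in>UNIV. poly_eval (z t) (pd v (var u * f)) * z' v) =
      (\<Sum>v\<in>UNIV. (if u = v then poly_eval (z t) f * z' v else 0) + z t u * (poly_eval (z t) (pd v f) * z' v))"
    by (rule sum.cong) (simp_all add: pd_var_mult poly_eval_var_mult distrib_right mult.assoc)
  then have eq: "z t u * ?S + z' u * poly_eval (z t) f =
      (\<Sum>v\<in>UNIV. poly_eval (z t) (pd v (var u * f)) * z' v)"
    by (simp add: sum.distrib sum_distrib_left mult.commute)
  have "((\<lambda>t. z t u * poly_eval (z t) f) has_vector_derivative
      z t u * ?S + z' u * poly_eval (z t) f) (at t)"
    by (rule has_vector_derivative_mult[OF assms[of u] var])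
  then show ?case unfolding eq poly_eval_var_mult .
qed

lemma pd_degree_less:
  assumes "\<And>m. m \<in> Poly_Mapping.keys f \<Longrightarrow> (\<Sum>u\<in>UNIV. Poly_Mapping.lookup m u) \<le> Suc k"
    and "m \<in> Poly_Mapping.keys (pd (v :: 'n::finite + 'n) f)"
  shows "(\<Sum>u\<in>UNIV. Poly_Mapping.lookup m u) \<le> k"
proof -
  have "m + Poly_Mapping.single v 1 \<in> Poly_Mapping.keys f"
    using assms(2) by (simp add: in_keys_iff lookup_pd del: of_nat_Suc One_nat_def)
  from assms(1)[OF this] show ?thesis
    by (simp add: lookup_add sum.distrib lookup_single when_def)
qed

text \<open>First derivatives have smaller degree, so the property may be assumed for all of them at
  once. This suits claims of vanishing, because a polynomial with zero gradient is constant.\<close>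

lemma degree_induct [case_names const pd]:
  fixes f :: "'n::finite phase_poly"
  assumes "\<And>c. P (const c)" and "\<And>f. (\<And>v. P (pd v f)) \<Longrightarrow> P f"
  shows "P f"
proof -
  have "P f" if "\<And>m. m \<in> Poly_Mapping.keys f \<Longrightarrow> (\<Sum>u\<in>UNIV. Poly_Mapping.lookup m u) \<le> k" for k f
    using that
  proof (induction k arbitrary: f)
    case 0
    have "pd v f = 0" for v
    proof (intro poly_mapping_eqI)
      fix m
      have "m + Poly_Mapping.single v 1 \<notin> Poly_Mapping.keys f"
      proof
        assume "m + Poly_Mapping.single v 1 \<in> Poly_Mapping.keys f"
        from 0[OF this] show False by (simp add: lookup_add sum.distrib lookup_single when_def)
      qed
      then show "Poly_Mapping.lookup (pd v f) m = Poly_Mapping.lookup 0 m"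
        by (simp add: lookup_pd in_keys_iff)
    qed
    then have "f = const (Poly_Mapping.lookup f 0)" by (rule all_pd_eq_0)
    then show ?case by (rule ssubst) (rule assms(1))
  next
    case (Suc k)
    show ?case
    proof (rule assms(2))
      show "P (pd v f)" for v
        by (rule Suc.IH) (rule pd_degree_less[OF Suc.prems])
    qed
  qed
  moreover have "\<exists>k. \<forall>m\<in>Poly_Mapping.keys f. (\<Sum>u\<in>UNIV. Poly_Mapping.lookup m u) \<le> k"
    using finite_nat_set_iff_bounded_le[of "(\<lambda>m. \<Sum>u\<in>UNIV. Poly_Mapping.lookup m u) ` Poly_Mapping.keys f"]
    by auto
  ultimately show ?thesis by blast
qed

text \<open>An identity principle for sets \<open>U\<close> that need not be open in complex space:
  only small real steps in the directions \<open>b k\<close> have to stay in \<open>U\<close>. The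
  matrix \<open>c\<close> witnesses that these directions span. So the derivatives along the
  \<open>b k\<close> vanish on \<open>U\<close>, hence all partial derivatives do, and induction on
  the degree applies to them.\<close>

lemma poly_eval_eq_0_imp_eq_0:
  fixes f :: "'n::finite phase_poly" and b :: "'k::finite \<Rightarrow> 'n + 'n \<Rightarrow> complex"
  assumes "U \<noteq> {}"
    and U: "\<And>z k. z \<in> U \<Longrightarrow> \<forall>\<^sub>F t in at (0::real). (\<lambda>v. z v + of_real t * b k v) \<in> U"
    and c: "\<And>u v. (\<Sum>k\<in>UNIV. c u k * b k v) = (if u = v then 1 else 0)"
    and "\<And>z. z \<in> U \<Longrightarrow> poly_eval z f = 0"
  shows "f = 0"
  using assms(4)
proof (induction f rule: degree_induct)
  case (const a)
  with \<open>U \<noteq> {}\<close> show ?case by (auto simp: const_simps)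
next
  case (pd f)
  have dir: "(\<Sum>v\<in>UNIV. poly_eval z (pd v f) * b k v) = 0" if "z \<in> U" for z k
  proof -
    let ?h = "\<lambda>t::real. poly_eval (\<lambda>v. z v + of_real t * b k v) f"
    have "((\<lambda>t::real. z v + of_real t * b k v) has_vector_derivative b k v) (at 0)" for v
    proof -
      have "((\<lambda>t::real. of_real t * b k v) has_vector_derivative b k v) (at 0)"
        unfolding scaleR_conv_of_real[symmetric] by (auto intro!: derivative_eq_intros)
      from has_vector_derivative_add[OF has_vector_derivative_const this] show ?thesis by simp
    qed
    from poly_eval_has_vector_derivative[of "\<lambda>t v. z v + of_real t * b k v", OF this, of f]
    have "(?h has_vector_derivative (\<Sum>v\<in>UNIV. poly_eval z (pd v f) * b k v)) (at 0)"
      by simp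
    moreover have "(?h has_vector_derivative 0) (at 0)"
    proof (subst has_vector_derivative_cong_ev)
      show "\<forall>\<^sub>F t in nhds 0. t \<in> UNIV \<longrightarrow> ?h t = 0"
        using U[OF that, of k] pd.prems that unfolding eventually_at_filter
        by (auto elim!: eventually_mono)
      show "?h 0 = 0" using pd.prems[OF that] by simp
    qed (auto intro: derivative_intros)
    ultimately show ?thesis by (rule vector_derivative_unique_at)
  qed
  have "pd u f = 0" for u
  proof (rule pd.IH)
    fix z assume "z \<in> U"
    have "poly_eval z (pd u f) = (\<Sum>v\<in>UNIV. poly_eval z (pd v f) * (if u = v then 1 else 0))"
      by (simp add: if_distrib cong: if_cong)
    also have "\<dots> = (\<Sum>v\<in>UNIV. \<Sum>k\<in>UNIV. c u k * (poly_eval z (pd v f) * b k v))"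
      by (simp add: sum_distrib_left mult_ac flip: c)
    also have "\<dots> = (\<Sum>k\<in>UNIV. c u k * (\<Sum>v\<in>UNIV. poly_eval z (pd v f) * b k v))"
      by (subst sum.swap) (simp add: sum_distrib_left)
    also have "\<dots> = 0" using dir[OF \<open>z \<in> U\<close>] by simp
    finally show "poly_eval z (pd u f) = 0" .
  qed
  then have f: "f = const (Poly_Mapping.lookup f 0)" by (rule all_pd_eq_0)
  from \<open>U \<noteq> {}\<close> obtain z where "z \<in> U" by blast
  with pd.prems have "poly_eval z f = 0" by blast
  then have "Poly_Mapping.lookup f 0 = 0" by (subst (asm) f) simp
  with f show ?case by (simp add: const_simps)
qed

lemma poly_eval_inject:
  fixes f g :: "'n::finite phase_poly"
  assumes "\<And>z. poly_eval z f = poly_eval z g"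
  shows "f = g"
proof -
  have "f - g = 0"
    by (rule poly_eval_eq_0_imp_eq_0[of UNIV "\<lambda>k v. if k = v then 1 else 0" "\<lambda>k v. if k = v then 1 else 0"])
      (use assms in \<open>auto simp: if_distrib[of "\<lambda>x. x * _"] cong: if_cong\<close>)
  then show ?thesis by simp
qed

section \<open>Homogeneous components\<close>

text \<open>With weights 0 and 1 this is the degree in a chosen group of variables, and
  \<open>hcomp\<close> extracts the part homogeneous in that group.\<close>

definition wt :: "('v::finite \<Rightarrow> nat) \<Rightarrow> ('v \<Rightarrow>\<^sub>0 nat) \<Rightarrow> nat" where
  "wt w m = (\<Sum>v\<in>UNIV. w v * Poly_Mapping.lookup m v)"

definition hcomp :: "('n::finite + 'n \<Rightarrow> nat) \<Rightarrow> nat \<Rightarrow> 'n phase_poly \<Rightarrow> 'n phase_poly" where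
  "hcomp w k f = (\<Sum>m\<in>{m\<in>Poly_Mapping.keys f. wt w m = k}. Poly_Mapping.single m (Poly_Mapping.lookup f m))"

lemma lookup_hcomp: "Poly_Mapping.lookup (hcomp w k f) m = (Poly_Mapping.lookup f m when wt w m = k)"
proof -
  have "Poly_Mapping.lookup (hcomp w k f) m =
      (\<Sum>m'\<in>{m'\<in>Poly_Mapping.keys f. wt w m' = k}. if m' = m then Poly_Mapping.lookup f m else 0)"
    unfolding hcomp_def lookup_sum by (intro sum.cong) (auto simp: lookup_single when_def)
  also have "\<dots> = (Poly_Mapping.lookup f m when wt w m = k)"
    by (auto simp: in_keys_iff when_def)
  finally show ?thesis .
qed

lemma wt_add_single: "wt w (m + Poly_Mapping.single v 1) = wt w m + w v"
  by (simp add: wt_def lookup_add distrib_left sum.distrib lookup_single when_def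
      if_distrib[of "\<lambda>x. _ * x"] cong: if_cong)

lemma hcomp_add: "hcomp w k (f + g) = hcomp w k f + hcomp w k g"
  by (intro poly_mapping_eqI) (simp add: lookup_hcomp lookup_add when_add_distrib)

lemma hcomp_const_mult: "hcomp w k (const c * f) = const c * hcomp w k f"
  by (intro poly_mapping_eqI) (simp add: lookup_hcomp lookup_const_mult when_def)

lemma hcomp_0 [simp]: "hcomp w k 0 = 0"
  by (simp add: hcomp_def)

lemma hcomp_sum: "hcomp w k (sum h I) = (\<Sum>i\<in>I. hcomp w k (h i))"
  by (induction I rule: infinite_finite_induct) (simp_all add: hcomp_add)

lemma hcomp_uminus: "hcomp w k (- f) = - hcomp w k f"
  using hcomp_add[of w k f "- f"] by (simp add: eq_neg_iff_add_eq_0 add.commute)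

lemma hcomp_diff: "hcomp w k (f - g) = hcomp w k f - hcomp w k g"
  using hcomp_add[of w k f "- g"] by (simp add: hcomp_uminus)

lemma hcomp_pd: "hcomp w k (pd v f) = pd v (hcomp w (k + w v) f)"
  by (intro poly_mapping_eqI) (simp add: lookup_hcomp lookup_pd wt_add_single when_def del: One_nat_def)

lemma hcomp_var_mult: "hcomp w (k + w v) (var v * f) = var v * hcomp w k f"
proof (induction f rule: single_induct)
  case (single m c)
  have *: "hcomp w k (Poly_Mapping.single m c) = (Poly_Mapping.single m c when wt w m = k)"
    for k :: nat and m and c :: complex
    by (intro poly_mapping_eqI) (auto simp: lookup_hcomp lookup_single when_def)
  show ?case
    using wt_add_single[of w m v] by (simp add: var_mult_single * add.commute when_def del: One_nat_def)
qed (simp add: hcomp_add algebra_simps)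

lemma keys_hcomp: "Poly_Mapping.keys (hcomp w k f) = {m \<in> Poly_Mapping.keys f. wt w m = k}"
  by (auto simp: in_keys_iff lookup_hcomp)

lemma sum_hcomp:
  assumes "\<And>m. m \<in> Poly_Mapping.keys f \<Longrightarrow> wt w m \<le> K"
  shows "(\<Sum>k\<le>K. hcomp w k f) = f"
proof (intro poly_mapping_eqI)
  fix m
  show "Poly_Mapping.lookup (\<Sum>k\<le>K. hcomp w k f) m = Poly_Mapping.lookup f m"
    using assms[of m] by (cases "m \<in> Poly_Mapping.keys f")
      (auto simp: lookup_sum lookup_hcomp in_keys_iff when_def)
qed

lemma hcomp_eq_0:
  assumes "\<And>m. m \<in> Poly_Mapping.keys f \<Longrightarrow> wt w m \<noteq> k"
  shows "hcomp w k f = 0"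
  using keys_hcomp[of w k f] assms by (metis (mono_tags, lifting) empty_Collect_eq keys_eq_empty)

lemma wt_bounded: "\<exists>K. \<forall>m\<in>Poly_Mapping.keys f. wt w m \<le> K"
  using finite_nat_set_iff_bounded_le[of "wt w ` Poly_Mapping.keys f"] by auto

section \<open>Symbols of differential operators\<close>

text \<open>The symbol of an operator is a polynomial in twice as many variables, hence again a phase
  polynomial: \<open>xup v\<close> stands for multiplication by \<open>var v\<close> and \<open>xi v\<close> for \<open>pd v\<close>, all derivatives
  being moved to the right. So for an operator on \<open>\<complex>[x, \<xi>]\<close> the variables \<open>Inl (Inl i)\<close>, \<open>Inl (Inr i)\<close>,
  \<open>Inr (Inl i)\<close>, \<open>Inr (Inr i)\<close> are \<open>x\<^sup>i\<close>, \<open>\<xi>\<^sub>i\<close> and the symbols \<open>p\<^sub>i\<close> of \<open>\<partial>/\<partial>x\<^sup>i\<close> and \<open>\<eta>\<^sup>i\<close> of \<open>\<partial>/\<partial>\<xi>\<^sub>i\<close>.\<close>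

inductive has_symbol :: "('n + 'n) phase_poly \<Rightarrow> 'n operator \<Rightarrow> bool" where
  has_symbol_id: "has_symbol 1 (\<lambda>f. f)"
| has_symbol_add: "has_symbol a A \<Longrightarrow> has_symbol b B \<Longrightarrow> has_symbol (a + b) (\<lambda>f. A f + B f)"
| has_symbol_const: "has_symbol a A \<Longrightarrow> has_symbol (const c * a) (\<lambda>f. const c * A f)"
| has_symbol_var: "has_symbol a A \<Longrightarrow> has_symbol (xup v * a) (\<lambda>f. var v * A f)"
| has_symbol_pd: "has_symbol a A \<Longrightarrow> has_symbol (xi v * a) (\<lambda>f. A (pd v f))"

lemma has_symbol_eq:
  assumes "has_symbol a A" and "a = b" and "\<And>f. A f = B f"
  shows "has_symbol b B"
proof -
  have "A = B" using assms(3) by auto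
  with assms show ?thesis by simp
qed

lemma has_symbol_0: "has_symbol 0 (\<lambda>f. 0)"
  by (rule has_symbol_eq[OF has_symbol_const[OF has_symbol_id, of 0]]) (simp_all add: const_simps)

lemma has_symbol_sum:
  assumes "\<And>i. i \<in> I \<Longrightarrow> has_symbol (a i) (A i)"
  shows "has_symbol (\<Sum>i\<in>I. a i) (\<lambda>f. \<Sum>i\<in>I. A i f)"
  using assms
  by (induction I rule: infinite_finite_induct) (simp_all add: has_symbol_0 has_symbol_add)

lemma has_symbol_diff:
  assumes "has_symbol a A" and "has_symbol b B"
  shows "has_symbol (a - b) (\<lambda>f. A f - B f)"
  by (rule has_symbol_eq[OF has_symbol_add[OF assms(1) has_symbol_const[OF assms(2), of "-1"]]])
    (simp_all add: const_simps)

lemma has_symbol_op_add: "has_symbol a A \<Longrightarrow> A (f + g) = A f + A g"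
  by (induction arbitrary: f g rule: has_symbol.induct) (simp_all add: pd_add algebra_simps)

lemma has_symbol_op_const: "has_symbol a A \<Longrightarrow> A (const c * f) = const c * A f"
  by (induction arbitrary: f rule: has_symbol.induct) (simp_all add: pd_const_mult distrib_left mult.left_commute)

lemma has_symbol_op_0: "has_symbol a A \<Longrightarrow> A 0 = 0"
  using has_symbol_op_const[of a A 0 0] by (simp add: const_simps)

lemma has_symbol_op_uminus: "has_symbol a A \<Longrightarrow> A (- f) = - A f"
  using has_symbol_op_const[of a A "-1" f] by (simp add: const_simps)

lemma has_symbol_op_diff: "has_symbol a A \<Longrightarrow> A (f - g) = A f - A g"
  using has_symbol_op_add[of a A f "- g"] by (simp add: has_symbol_op_uminus)

lemma has_symbol_op_sum: "has_symbol a A \<Longrightarrow> A (sum h I) = (\<Sum>i\<in>I. A (h i))"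
  by (induction I rule: infinite_finite_induct) (simp_all add: has_symbol_op_add has_symbol_op_0)

text \<open>Moving the multiplication to the left past a derivative costs the commutator
  [\<partial>/\<partial>v, v] = 1. Summed over all derivatives in \<open>A\<close>, these
  commutators differentiate the symbol in the variable dual to \<open>v\<close>.\<close>

lemma has_symbol_comp_var:
  "has_symbol a A \<Longrightarrow> has_symbol (xup v * a + dxi v a) (\<lambda>f. A (var v * f))"
proof (induction rule: has_symbol.induct)
  case has_symbol_id
  show ?case by (rule has_symbol_eq[OF has_symbol_var[OF has_symbol.has_symbol_id]]) simp_all
next
  case (has_symbol_add a A b B)
  show ?case
    by (rule has_symbol_eq[OF has_symbol.has_symbol_add[OF has_symbol_add.IH]])
      (simp_all add: pd_add algebra_simps)
next
  case (has_symbol_const a A c)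
  show ?case
    by (rule has_symbol_eq[OF has_symbol.has_symbol_const[OF has_symbol_const.IH, of c]])
      (simp_all add: pd_const_mult distrib_left mult.left_commute)
next
  case (has_symbol_var a A u)
  show ?case
    by (rule has_symbol_eq[OF has_symbol.has_symbol_var[OF has_symbol_var.IH, of u]])
      (simp_all add: pd_var_mult distrib_left mult.left_commute)
next
  case (has_symbol_pd a A u)
  have "has_symbol (if u = v then a else 0) (\<lambda>f. if u = v then A f else 0)"
    using has_symbol_pd.hyps by (simp add: has_symbol_0)
  from has_symbol.has_symbol_add[OF this has_symbol.has_symbol_pd[OF has_symbol_pd.IH, of u]]
  show ?case
    by (rule has_symbol_eq)
      (auto simp: pd_var_mult distrib_left mult.left_commute has_symbol_op_add[OF has_symbol_pd.hyps] has_symbol_op_0[OF has_symbol_pd.hyps])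
qed

lemma has_symbol_pd_comp:
  "has_symbol a A \<Longrightarrow> has_symbol (xi v * a + dx v a) (\<lambda>f. pd v (A f))"
proof (induction rule: has_symbol.induct)
  case has_symbol_id
  show ?case by (rule has_symbol_eq[OF has_symbol_pd[OF has_symbol.has_symbol_id]]) simp_all
next
  case (has_symbol_add a A b B)
  show ?case
    by (rule has_symbol_eq[OF has_symbol.has_symbol_add[OF has_symbol_add.IH]])
      (simp_all add: pd_add algebra_simps)
next
  case (has_symbol_const a A c)
  show ?case
    by (rule has_symbol_eq[OF has_symbol.has_symbol_const[OF has_symbol_const.IH, of c]])
      (simp_all add: pd_const_mult distrib_left mult.left_commute)
next
  case (has_symbol_pd a A u)
  show ?case
    by (rule has_symbol_eq[OF has_symbol.has_symbol_pd[OF has_symbol_pd.IH, of u]])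
      (simp_all add: pd_var_mult pd_commute distrib_left mult.left_commute)
next
  case (has_symbol_var a A u)
  have "has_symbol (if u = v then a else 0) (\<lambda>f. if u = v then A f else 0)"
    using has_symbol_var.hyps by (simp add: has_symbol_0)
  from has_symbol.has_symbol_add[OF this has_symbol.has_symbol_var[OF has_symbol_var.IH, of u]]
  show ?case
    by (rule has_symbol_eq) (auto simp: pd_var_mult distrib_left mult.left_commute)
qed

text \<open>Every derivative kills 1, so only terms without covariables survive. This anchors both
  uniqueness arguments below.\<close>

lemma has_symbol_apply_1:
  "has_symbol a A \<Longrightarrow> poly_eval z (A 1) = poly_eval (case_sum z (\<lambda>_. 0)) a"
proof (induction rule: has_symbol.induct)
  case (has_symbol_pd a A v)
  then show ?case by (simp add: has_symbol_op_0)
qed simp_all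

text \<open>\<open>has_symbol\<close> is only a relation, so it has to be shown that a symbol
  determines its operator. Polynomials arise from constants by multiplication with variables, and
  \<open>A\<close> composed with such a multiplication again has symbol 0. Hence \<open>A\<close> is
  arbitrary in the induction, which ends at \<open>A 1\<close>.\<close>

lemma has_symbol_0_imp:
  fixes A :: "'n::finite operator"
  assumes "has_symbol 0 A"
  shows "A f = 0"
  using assms
proof (induction f arbitrary: A rule: phase_poly_induct)
  case (const c)
  have "A 1 = 0"
    by (rule poly_eval_inject) (simp add: has_symbol_apply_1[OF const])
  then show ?case using has_symbol_op_const[OF const, of c 1] by simp
next
  case (add f g)
  then show ?case by (simp add: has_symbol_op_add[OF add.prems] add.IH[OF add.prems])
next
  case (var v f)
  show ?case by (rule var.IH) (use has_symbol_comp_var[OF var.prems, of v] in simp)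
qed

lemma has_symbol_op_unique:
  fixes A B :: "'n::finite operator"
  assumes "has_symbol a A" and "has_symbol a B"
  shows "A = B"
  using has_symbol_0_imp[of "\<lambda>f. A f - B f"] has_symbol_diff[OF assms] by fastforce

text \<open>The zero operator commutes with every \<open>pd v\<close> and every
  \<open>var v\<close>, and the symbols of these commutators are all the partial derivatives of
  \<open>a\<close>. Induction on the degree leaves a constant, which is the value on 1.\<close>

lemma zero_has_symbol_imp:
  fixes a :: "('n::finite + 'n) phase_poly"
  assumes "has_symbol a (\<lambda>f. 0 :: 'n phase_poly)"
  shows "a = 0"
  using assms
proof (induction a rule: degree_induct)
  case (const c)
  from has_symbol_apply_1[OF const, of undefined] show ?case by (simp add: const_simps)
next
  case (pd a)
  have "pd w a = 0" for w
  proof (rule pd.IH)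
    show "has_symbol (pd w a) (\<lambda>f. 0 :: 'n phase_poly)"
    proof (cases w)
      case (Inl v)
      show ?thesis unfolding Inl
        by (rule has_symbol_eq[OF has_symbol_diff[OF has_symbol_pd_comp[OF pd.prems, of v] has_symbol_pd[OF pd.prems, of v]]])
          simp_all
    next
      case (Inr v)
      show ?thesis unfolding Inr
        by (rule has_symbol_eq[OF has_symbol_diff[OF has_symbol_comp_var[OF pd.prems, of v] has_symbol_var[OF pd.prems, of v]]])
          simp_all
    qed
  qed
  then have a: "a = const (Poly_Mapping.lookup a 0)" by (rule all_pd_eq_0)
  from has_symbol_apply_1[OF pd.prems] have "poly_eval (case_sum undefined (\<lambda>_. 0)) a = 0" by simp
  then have "Poly_Mapping.lookup a 0 = 0" by (subst (asm) a) simp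
  with a show ?case by (simp add: const_simps)
qed

lemma has_symbol_unique:
  fixes A :: "'n::finite operator"
  assumes "has_symbol a A" and "has_symbol b A"
  shows "a = b"
  using zero_has_symbol_imp[of "a - b"] has_symbol_diff[OF assms] by simp

lemma has_symbol_comp:
  assumes "has_symbol a A" and "has_symbol b B"
  shows "\<exists>c. has_symbol c (\<lambda>f. A (B f))"
  using assms
proof (induction arbitrary: b B rule: has_symbol.induct)
  case (has_symbol_add a A a' A')
  then obtain c c' where "has_symbol c (\<lambda>f. A (B f))" "has_symbol c' (\<lambda>f. A' (B f))" by blast
  then show ?case using has_symbol.has_symbol_add by blast
next
  case (has_symbol_const a A c)
  then show ?case using has_symbol.has_symbol_const by blast
next
  case (has_symbol_var a A v)
  then show ?case using has_symbol.has_symbol_var by blast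
next
  case (has_symbol_pd a A v)
  show ?case using has_symbol_pd.IH[OF has_symbol_pd_comp[OF has_symbol_pd.prems]] .
qed auto

lemma op_subalgebra_has_symbol: "op_subalgebra {A. \<exists>a. has_symbol a A}"
  unfolding op_subalgebra_def
proof (intro conjI ballI allI)
  fix A B :: "'a operator" and c
  show "id \<in> {A. \<exists>a. has_symbol a A}" using has_symbol_id by (auto simp: id_def)
  assume "A \<in> {A. \<exists>a. has_symbol a A}"
  then obtain a where a: "has_symbol a A" by blast
  show "(\<lambda>f. const c * A f) \<in> {A. \<exists>a. has_symbol a A}" using has_symbol_const[OF a] by blast
  assume "B \<in> {A. \<exists>a. has_symbol a A}"
  then obtain b where b: "has_symbol b B" by blast
  show "(\<lambda>f. A f + B f) \<in> {A. \<exists>a. has_symbol a A}" using has_symbol_add[OF a b] by blast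
  show "A \<circ> B \<in> {A. \<exists>a. has_symbol a A}" using has_symbol_comp[OF a b] by (auto simp: o_def)
qed

lemma End_diff_has_symbol:
  assumes "A \<in> End_diff"
  obtains a where "has_symbol a A"
proof -
  have "End_diff \<subseteq> {A :: 'a operator. \<exists>a. has_symbol a A}"
    unfolding End_diff_def
  proof (rule hull_minimal)
    show "range (\<lambda>v f. var v * f) \<union> range pd \<subseteq> {A :: 'a operator. \<exists>a. has_symbol a A}"
      using has_symbol_var[OF has_symbol_id] has_symbol_pd[OF has_symbol_id] by blast
  qed (rule op_subalgebra_has_symbol)
  with assms that show thesis by blast
qed

section \<open>Rotation invariant functions of two vectors\<close>

text \<open>For orthonormal \<open>e\<close> and \<open>w\<close> this is the rotation by \<theta>
  in their plane, from \<open>e\<close> towards \<open>w\<close>, and the identity on the orthogonal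
  complement.\<close>

definition plane_rot :: "'a::real_inner \<Rightarrow> 'a \<Rightarrow> real \<Rightarrow> 'a \<Rightarrow> 'a" where
  "plane_rot e w \<theta> y = y + ((cos \<theta> - 1) * (e \<bullet> y) - sin \<theta> * (w \<bullet> y)) *\<^sub>R e
     + (sin \<theta> * (e \<bullet> y) + (cos \<theta> - 1) * (w \<bullet> y)) *\<^sub>R w"

lemma plane_rot_inner_left:
  assumes "e \<bullet> e = 1" and "w \<bullet> w = 1" and "e \<bullet> w = 0"
  shows "e \<bullet> plane_rot e w \<theta> y = cos \<theta> * (e \<bullet> y) - sin \<theta> * (w \<bullet> y)"
    and "w \<bullet> plane_rot e w \<theta> y = sin \<theta> * (e \<bullet> y) + cos \<theta> * (w \<bullet> y)"
  using assms
  by (simp_all add: plane_rot_def inner_add_right inner_commute[of w e] algebra_simps)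

lemma plane_rot_inner:
  assumes "e \<bullet> e = 1" and "w \<bullet> w = 1" and "e \<bullet> w = 0"
  shows "plane_rot e w \<theta> x \<bullet> plane_rot e w \<theta> y = x \<bullet> y"
proof -
  define a b where "a = e \<bullet> x" and "b = w \<bullet> x"
  define a' b' where "a' = e \<bullet> y" and "b' = w \<bullet> y"
  have "plane_rot e w \<theta> x \<bullet> plane_rot e w \<theta> y = x \<bullet> plane_rot e w \<theta> y
     + ((cos \<theta> - 1) * a - sin \<theta> * b) * (e \<bullet> plane_rot e w \<theta> y)
     + (sin \<theta> * a + (cos \<theta> - 1) * b) * (w \<bullet> plane_rot e w \<theta> y)"
    unfolding plane_rot_def[of e w \<theta> x] a_def b_def by (simp add: inner_add_left)
  also have "x \<bullet> plane_rot e w \<theta> y = x \<bullet> y + ((cos \<theta> - 1) * a' - sin \<theta> * b') * a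
     + (sin \<theta> * a' + (cos \<theta> - 1) * b') * b"
    unfolding plane_rot_def a_def b_def a'_def b'_def
    by (simp add: inner_add_right inner_commute[of x])
  also have "e \<bullet> plane_rot e w \<theta> y = cos \<theta> * a' - sin \<theta> * b'"
    using plane_rot_inner_left(1)[OF assms] by (simp add: a'_def b'_def)
  also have "w \<bullet> plane_rot e w \<theta> y = sin \<theta> * a' + cos \<theta> * b'"
    using plane_rot_inner_left(2)[OF assms] by (simp add: a'_def b'_def)
  finally have eq: "plane_rot e w \<theta> x \<bullet> plane_rot e w \<theta> y = x \<bullet> y +
      ((cos \<theta> - 1) * a' - sin \<theta> * b') * a + (sin \<theta> * a' + (cos \<theta> - 1) * b') * b +
      ((cos \<theta> - 1) * a - sin \<theta> * b) * (cos \<theta> * a' - sin \<theta> * b') +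
      (sin \<theta> * a + (cos \<theta> - 1) * b) * (sin \<theta> * a' + cos \<theta> * b')" .
  \<comment> \<open>The defect is a multiple of sin^2 + cos^2 - 1.\<close>
  have "(sin \<theta>)\<^sup>2 + (cos \<theta>)\<^sup>2 = 1" by simp
  then have "((cos \<theta> - 1) * a' - sin \<theta> * b') * a + (sin \<theta> * a' + (cos \<theta> - 1) * b') * b +
      ((cos \<theta> - 1) * a - sin \<theta> * b) * (cos \<theta> * a' - sin \<theta> * b') +
      (sin \<theta> * a + (cos \<theta> - 1) * b) * (sin \<theta> * a' + cos \<theta> * b') = 0"
    by algebra
  with eq show ?thesis by simp
qed

lemma plane_rot_fix: "e \<bullet> y = 0 \<Longrightarrow> w \<bullet> y = 0 \<Longrightarrow> plane_rot e w \<theta> y = y"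
  by (simp add: plane_rot_def)

lemma plane_rot_add: "plane_rot e w \<theta> (x + y) = plane_rot e w \<theta> x + plane_rot e w \<theta> y"
  by (simp add: plane_rot_def inner_add_right algebra_simps)

lemma plane_rot_scaleR: "plane_rot e w \<theta> (c *\<^sub>R y) = c *\<^sub>R plane_rot e w \<theta> y"
  by (simp add: plane_rot_def algebra_simps)

lemma plane_rot_axis:
  assumes "e \<bullet> e = 1" and "e \<bullet> w = 0"
  shows "plane_rot e w \<theta> e = cos \<theta> *\<^sub>R e + sin \<theta> *\<^sub>R w"
  using assms by (simp add: plane_rot_def inner_commute[of w e] algebra_simps)

text \<open>The velocity is expressed at the rotated point: the orbit is an integral curve of the
  generator. A function that is infinitesimally invariant at every point is therefore constant along
  it.\<close>

lemma plane_rot_has_vector_derivative: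
  assumes "e \<bullet> e = 1" and "w \<bullet> w = 1" and "e \<bullet> w = 0"
  shows "((\<lambda>\<theta>. plane_rot e w \<theta> y) has_vector_derivative
    (e \<bullet> plane_rot e w \<theta> y) *\<^sub>R w - (w \<bullet> plane_rot e w \<theta> y) *\<^sub>R e) (at \<theta>)"
  unfolding plane_rot_inner_left[OF assms] unfolding plane_rot_def
  by (auto intro!: derivative_eq_intros simp: algebra_simps)

lemma ex_unit_orthogonal:
  fixes a b :: "'a::euclidean_space"
  assumes "3 \<le> DIM('a)"
  obtains f where "f \<bullet> f = 1" and "f \<bullet> a = 0" and "f \<bullet> b = 0"
proof -
  have "dim {a, b} \<le> card {a, b}" by (rule dim_le_card) (auto intro: span_base)
  also have "\<dots> \<le> 2" by (simp add: card_insert_if)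
  finally have "dim {a, b} < DIM('a)" using assms by simp
  then obtain x where "x \<noteq> 0" and x: "\<And>y. y \<in> span {a, b} \<Longrightarrow> orthogonal x y"
    using orthogonal_to_subspace_exists by blast
  have "sgn x \<bullet> sgn x = 1"
    using \<open>x \<noteq> 0\<close> by (simp add: norm_sgn flip: power2_norm_eq_inner)
  moreover have "sgn x \<bullet> a = 0" "sgn x \<bullet> b = 0"
    using x[of a] x[of b] by (simp_all add: sgn_div_norm orthogonal_def span_base)
  ultimately show thesis using that by blast
qed

text \<open>The third dimension is needed to rotate \<open>e\<close> to \<open>- e\<close> while fixing \<open>n\<close>.\<close>

lemma ex_plane_rot:
  fixes e e' n :: "'a::euclidean_space"
  assumes "3 \<le> DIM('a)" and "e \<bullet> e = 1" and "e' \<bullet> e' = 1" and "e \<bullet> n = 0" and "e' \<bullet> n = 0"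
  obtains w \<theta> where "w \<bullet> w = 1" and "e \<bullet> w = 0" and "w \<bullet> n = 0" and "plane_rot e w \<theta> e = e'"
proof (cases "e' - (e \<bullet> e') *\<^sub>R e = 0")
  case True
  define c where "c = e \<bullet> e'"
  have e': "e' = c *\<^sub>R e" using True by (simp add: c_def)
  with assms(2,3) have "c * c = 1" by simp
  then have c: "c = 1 \<or> c = -1" using power2_eq_1_iff[of c] by (simp add: power2_eq_square)
  obtain w where w: "w \<bullet> w = 1" "w \<bullet> e = 0" "w \<bullet> n = 0"
    using ex_unit_orthogonal[OF assms(1)] by blast
  have "plane_rot e w (if c = 1 then 0 else pi) e = e'"
    using c assms(2) w e' by (auto simp: plane_rot_axis inner_commute)
  with w that show thesis by (metis inner_commute)
next
  case False
  let ?y = "e' - (e \<bullet> e') *\<^sub>R e"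
  define w where "w = sgn ?y"
  have y: "?y = norm ?y *\<^sub>R w" using False by (simp add: w_def sgn_div_norm)
  have ww: "w \<bullet> w = 1"
    using False unfolding w_def by (simp add: norm_sgn flip: power2_norm_eq_inner)
  have ew: "e \<bullet> w = 0" using assms by (simp add: w_def sgn_div_norm inner_diff_right)
  have wn: "w \<bullet> n = 0" using assms by (simp add: w_def sgn_div_norm inner_diff_left)
  have e': "e' = (e \<bullet> e') *\<^sub>R e + norm ?y *\<^sub>R w" using y by simp
  have "e' \<bullet> e' = (e \<bullet> e')\<^sup>2 + (norm ?y)\<^sup>2"
    using assms(2) ww ew
    by (subst e', subst (3) e') (simp add: inner_add_left inner_add_right inner_commute power2_eq_square)
  with assms(3) have "(e \<bullet> e')\<^sup>2 + (norm ?y)\<^sup>2 = 1" by simp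
  then obtain \<theta> where "e \<bullet> e' = cos \<theta>" "norm ?y = sin \<theta>" using sincos_total_2pi by metis
  with e' have "plane_rot e w \<theta> e = e'"
    using assms(2) ew by (simp add: plane_rot_axis)
  with ww ew wn that show thesis by blast
qed

text \<open>One rotation takes the direction of \<open>u\<close> to \<open>e1\<close>; a second one
  fixes \<open>e1\<close> and takes the normalized rest of \<open>v\<close> to \<open>e2\<close>.
  Only the square of \<open>r\<close> is prescribed: the rest is divided by \<open>r\<close> and not
  by its norm, so that both signs are reached.\<close>

lemma rotation_invariant_canonical:
  fixes F :: "'a::euclidean_space \<Rightarrow> 'a \<Rightarrow> 'b"
  assumes dim: "3 \<le> DIM('a)"
    and inv: "\<And>e w \<theta> u v. e \<bullet> e = 1 \<Longrightarrow> w \<bullet> w = 1 \<Longrightarrow> e \<bullet> w = 0 \<Longrightarrow>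
      F (plane_rot e w \<theta> u) (plane_rot e w \<theta> v) = F u v"
    and e1: "e1 \<bullet> e1 = 1" and e2: "e2 \<bullet> e2 = 1" and e12: "e1 \<bullet> e2 = 0"
    and "u \<noteq> 0" and r: "r\<^sup>2 = v \<bullet> v - (u \<bullet> v)\<^sup>2 / (u \<bullet> u)"
  shows "F u v = F (norm u *\<^sub>R e1) (((u \<bullet> v) / norm u) *\<^sub>R e1 + r *\<^sub>R e2)"
proof -
  let ?e = "sgn u"
  have "?e \<bullet> ?e = 1" using \<open>u \<noteq> 0\<close> by (simp add: norm_sgn flip: power2_norm_eq_inner)
  then obtain w \<theta> where w: "w \<bullet> w = 1" "?e \<bullet> w = 0" and rot: "plane_rot ?e w \<theta> ?e = e1"
    using ex_plane_rot[OF dim _ e1, of ?e 0] by auto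
  note ortho = \<open>?e \<bullet> ?e = 1\<close> w
  define v1 where "v1 = plane_rot ?e w \<theta> v"
  have "u = norm u *\<^sub>R ?e" using \<open>u \<noteq> 0\<close> by (simp add: sgn_div_norm)
  then have u1: "plane_rot ?e w \<theta> u = norm u *\<^sub>R e1"
    using plane_rot_scaleR[of ?e w \<theta> "norm u" ?e] rot by simp
  have F1: "F u v = F (norm u *\<^sub>R e1) v1"
    using inv[OF ortho, of \<theta> u v] by (simp add: u1 v1_def)
  have "v1 \<bullet> v1 = v \<bullet> v" unfolding v1_def by (rule plane_rot_inner[OF ortho])
  have "norm u *\<^sub>R e1 \<bullet> v1 = u \<bullet> v" unfolding v1_def u1[symmetric] by (rule plane_rot_inner[OF ortho])
  then have t: "e1 \<bullet> v1 = (u \<bullet> v) / norm u" using \<open>u \<noteq> 0\<close> by (simp add: field_simps)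
  define y where "y = v1 - ((u \<bullet> v) / norm u) *\<^sub>R e1"
  have v1: "v1 = ((u \<bullet> v) / norm u) *\<^sub>R e1 + y" by (simp add: y_def)
  have ey: "e1 \<bullet> y = 0" using e1 t by (simp add: y_def inner_diff_right)
  have "v1 \<bullet> v1 = ((u \<bullet> v) / norm u)\<^sup>2 + y \<bullet> y"
    using e1 ey unfolding v1
    by (simp add: inner_add_left inner_add_right inner_commute[of y e1] power2_eq_square)
  then have yy: "y \<bullet> y = r\<^sup>2"
    using r \<open>v1 \<bullet> v1 = v \<bullet> v\<close> by (simp add: power_divide power2_norm_eq_inner)
  show ?thesis
  proof (cases "r = 0")
    case True
    with yy v1 F1 show ?thesis by simp
  next
    case False
    let ?f = "(1 / r) *\<^sub>R y"
    have "?f \<bullet> ?f = 1" using yy False by (simp add: power2_eq_square)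
    moreover have "?f \<bullet> e1 = 0" using ey by (simp add: inner_commute)
    ultimately obtain w' \<theta>' where w': "w' \<bullet> w' = 1" "?f \<bullet> w' = 0" "w' \<bullet> e1 = 0"
      and rot': "plane_rot ?f w' \<theta>' ?f = e2"
      using ex_plane_rot[OF dim _ e2, of ?f e1] e12 by (metis inner_commute)
    have "plane_rot ?f w' \<theta>' e1 = e1"
      using \<open>?f \<bullet> e1 = 0\<close> w' by (intro plane_rot_fix)
    moreover have "plane_rot ?f w' \<theta>' y = r *\<^sub>R e2"
      using plane_rot_scaleR[of ?f w' \<theta>' r ?f] rot' False by simp
    ultimately show ?thesis
      using F1 inv[OF \<open>?f \<bullet> ?f = 1\<close> w'(1,2), of \<theta>' "norm u *\<^sub>R e1" v1]
      by (simp add: v1 plane_rot_add plane_rot_scaleR)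
  qed
qed

section \<open>Conformal fields\<close>

lemma const_numeral: "const (numeral k) = (numeral k :: 'n phase_poly)"
  by (metis const_of_nat of_nat_numeral)

text \<open>The type of vector fields admits components depending on \<xi>. For fields on the base
  the Lie derivative splits into transport along \<open>X\<close>, the action of the Jacobian on
  \<xi>, and the divergence term.\<close>

lemma Lie_op_xi_free:
  assumes "\<And>k l. dxi l (X $ k) = 0"
  shows "Lie_op \<delta> X f = (\<Sum>i\<in>UNIV. X $ i * dx i f)
    - (\<Sum>i\<in>UNIV. \<Sum>j\<in>UNIV. dx i (X $ j) * (xi j * dxi i f))
    + (\<Sum>i\<in>UNIV. const (of_real \<delta>) * dx i (X $ i)) * f"
proof -
  have 1: "dxi i (\<Sum>j\<in>UNIV. X $ j * xi j) = X $ i" for i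
    by (simp add: pd_sum pd_mult assms pd_var if_distrib[of "\<lambda>x. _ * x"] cong: if_cong)
  have 2: "dx i (\<Sum>j\<in>UNIV. X $ j * xi j) = (\<Sum>j\<in>UNIV. dx i (X $ j) * xi j)" for i
    by (simp add: pd_sum pd_mult pd_var)
  show ?thesis
    unfolding Lie_op_def Let_def 1 2
    by (simp add: sum.distrib sum_subtractf sum_distrib_right mult.assoc)
qed

text \<open>An operator that is linear over polynomials in x and commutes with
  \<partial>/\<partial>x respects the transport and the divergence term. There remains the Jacobian,
  acting through the operators \<xi>_j \<partial>/\<partial>\<xi>_i.\<close>

lemma commute_Lie_op:
  fixes A :: "'n::finite operator"
  assumes add: "\<And>f h. A (f + h) = A f + A h"
    and mult: "\<And>m f. (\<And>l. dxi l m = 0) \<Longrightarrow> A (m * f) = m * A f"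
    and dx: "\<And>i f. A (dx i f) = dx i (A f)"
    and X: "\<And>k l. dxi l (X $ k) = 0"
    and comm: "\<And>f. (\<Sum>i\<in>UNIV. \<Sum>j\<in>UNIV. dx i (X $ j) * (A (xi j * dxi i f) - xi j * dxi i (A f))) = 0"
  shows "A (Lie_op \<delta> X f) = Lie_op \<delta> X (A f)"
proof -
  have [simp]: "A 0 = 0" using mult[of 0 0] by simp
  have sum: "A (sum h I) = (\<Sum>i\<in>I. A (h i))" for h :: "'n \<Rightarrow> 'n phase_poly" and I
    by (induction I rule: infinite_finite_induct) (simp_all add: add)
  have [simp]: "A (- f) = - A f" for f
    using add[of f "- f"] by (simp add: eq_neg_iff_add_eq_0 add.commute)
  have diff: "A (f - h) = A f - A h" for f h using add[of f "- h"] by simp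
  have X': "dxi l (dx i (X $ j)) = 0" for l i j by (subst pd_commute) (simp add: X)
  have "A ((\<Sum>i\<in>UNIV. const (of_real \<delta>) * dx i (X $ i)) * f) =
      (\<Sum>i\<in>UNIV. const (of_real \<delta>) * dx i (X $ i)) * A f"
    by (rule mult) (simp add: pd_sum pd_const_mult X')
  then show ?thesis
    using comm[of f]
    by (simp add: Lie_op_xi_free[OF X] add diff sum mult[OF X] mult[OF X'] dx right_diff_distrib sum_subtractf)
qed

text \<open>The conformal Killing equation L_X g = 2 \<phi> g.\<close>

definition conformal_field :: "real^'n^'n \<Rightarrow> 'n::finite vfield \<Rightarrow> bool" where
  "conformal_field g X \<longleftrightarrow> (\<forall>k l. dxi l (X $ k) = 0) \<and>
     (\<exists>\<phi>. \<forall>i k. (\<Sum>j\<in>UNIV. dx i (X $ j) * const (of_real (g $ j $ k)) + dx k (X $ j) * const (of_real (g $ j $ i)))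
        = const 2 * (\<phi> * const (of_real (g $ i $ k))))"

lemma conformal_field_subspace: "vf.subspace (Collect (conformal_field g))"
  unfolding vf.subspace_def
proof (intro conjI ballI allI)
  show "0 \<in> Collect (conformal_field g)"
    by (auto simp: conformal_field_def intro: exI[of _ 0])
next
  fix X Y assume "X \<in> Collect (conformal_field g)" "Y \<in> Collect (conformal_field g)"
  then obtain \<phi> \<psi> where free: "\<And>k l. dxi l (X $ k) = 0" "\<And>k l. dxi l (Y $ k) = 0"
    and eq: "\<And>i k. (\<Sum>j\<in>UNIV. dx i (X $ j) * const (of_real (g $ j $ k)) + dx k (X $ j) * const (of_real (g $ j $ i)))
        = const 2 * (\<phi> * const (of_real (g $ i $ k)))"
    and eq': "\<And>i k. (\<Sum>j\<in>UNIV. dx i (Y $ j) * const (of_real (g $ j $ k)) + dx k (Y $ j) * const (of_real (g $ j $ i)))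
        = const 2 * (\<psi> * const (of_real (g $ i $ k)))"
    unfolding conformal_field_def by blast
  have "(\<Sum>j\<in>UNIV. dx i ((X + Y) $ j) * const (of_real (g $ j $ k)) + dx k ((X + Y) $ j) * const (of_real (g $ j $ i)))
        = (\<Sum>j\<in>UNIV. dx i (X $ j) * const (of_real (g $ j $ k)) + dx k (X $ j) * const (of_real (g $ j $ i)))
        + (\<Sum>j\<in>UNIV. dx i (Y $ j) * const (of_real (g $ j $ k)) + dx k (Y $ j) * const (of_real (g $ j $ i)))" for i k
    by (simp add: pd_add distrib_right sum.distrib)
  then show "X + Y \<in> Collect (conformal_field g)"
    unfolding eq eq' by (auto simp: conformal_field_def pd_add free distrib_left distrib_right simp del: vector_add_component
      intro!: exI[of _ "\<phi> + \<psi>"]) (simp add: pd_add free)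
next
  fix X r assume "X \<in> Collect (conformal_field g)"
  then obtain \<phi> where X: "\<And>k l. dxi l (X $ k) = 0"
    and eq: "\<And>i k. (\<Sum>j\<in>UNIV. dx i (X $ j) * const (of_real (g $ j $ k)) + dx k (X $ j) * const (of_real (g $ j $ i)))
        = const 2 * (\<phi> * const (of_real (g $ i $ k)))"
    unfolding conformal_field_def by blast
  have "(\<Sum>j\<in>UNIV. const (of_real r) * dx i (X $ j) * const (of_real (g $ j $ k)) +
        const (of_real r) * dx k (X $ j) * const (of_real (g $ j $ i)))
      = const (of_real r) * (const 2 * (\<phi> * const (of_real (g $ i $ k))))" for i k
    unfolding eq[symmetric] by (simp add: sum_distrib_left algebra_simps)
  then show "const (of_real r) *s X \<in> Collect (conformal_field g)"
    by (auto simp: conformal_field_def X pd_const_mult mult_ac intro!: exI[of _ "const (of_real r) * \<phi>"])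
qed

text \<open>Over the complex numbers a nondegenerate metric of any signature has an orthonormal frame \<open>Q\<close>, that is
  \<open>Q\<^sup>T g Q = 1\<close>.\<close>

locale conf_frame =
  fixes g :: "real^'n::finite^'n" and Q :: "complex^'n^'n"
  assumes dim: "3 \<le> CARD('n)"
    and g_sym: "g $ i $ j = g $ j $ i"
    and frame_left: "(\<Sum>i\<in>UNIV. (\<Sum>j\<in>UNIV. of_real (g $ i $ j) * Q $ j $ k) * Q $ i $ l) = (if k = l then 1 else 0)"
    and frame_right: "(\<Sum>k\<in>UNIV. (\<Sum>j\<in>UNIV. of_real (g $ i $ j) * Q $ j $ k) * Q $ l $ k) = (if i = l then 1 else 0)"
    and matrix_inv_frame: "of_real (matrix_inv g $ i $ j) = (\<Sum>k\<in>UNIV. Q $ i $ k * Q $ j $ k)"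
begin

abbreviation "gc i j \<equiv> complex_of_real (g $ i $ j)"
abbreviation "hc i j \<equiv> complex_of_real (matrix_inv g $ i $ j)"

text \<open>The frame with its index lowered. Since \<open>Q\<close> is orthonormal this is the dual
  coframe, so that covectors such as \<xi> are expanded in \<open>GQ\<close> and vectors such as
  \<eta> in \<open>Q\<close>.\<close>

definition GQ :: "'n \<Rightarrow> 'n \<Rightarrow> complex" where
  "GQ i k = (\<Sum>j\<in>UNIV. gc i j * Q $ j $ k)"

lemma frame1: "(\<Sum>i\<in>UNIV. GQ i k * Q $ i $ l) = (if k = l then 1 else 0)"
  unfolding GQ_def by (rule frame_left)

lemma frame2: "(\<Sum>k\<in>UNIV. GQ i k * Q $ l $ k) = (if i = l then 1 else 0)"
  unfolding GQ_def by (rule frame_right)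

lemma gc_sym: "gc i j = gc j i"
  by (simp add: g_sym)

lemma hc_sym: "hc i j = hc j i"
  unfolding matrix_inv_frame by (simp add: mult.commute)

lemma gc_hc: "(\<Sum>k\<in>UNIV. gc i k * hc k j) = (if i = j then 1 else 0)"
proof -
  have "(\<Sum>k\<in>UNIV. gc i k * hc k j) = (\<Sum>k\<in>UNIV. \<Sum>l\<in>UNIV. gc i k * Q $ k $ l * Q $ j $ l)"
    by (simp add: matrix_inv_frame sum_distrib_left mult.assoc)
  also have "\<dots> = (\<Sum>l\<in>UNIV. GQ i l * Q $ j $ l)"
    by (subst sum.swap) (simp add: GQ_def sum_distrib_right)
  finally show ?thesis by (simp add: frame2)
qed

lemma gc_xi_up: "(\<Sum>k\<in>UNIV. const (gc j k) * xi_up g k) = xi j"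
proof -
  have "(\<Sum>k\<in>UNIV. const (gc j k) * xi_up g k) =
      (\<Sum>k\<in>UNIV. \<Sum>l\<in>UNIV. const (gc j k * hc k l) * xi l)"
    by (simp add: xi_up_def sum_distrib_left const_simps mult.assoc)
  also have "\<dots> = (\<Sum>l\<in>UNIV. const (\<Sum>k\<in>UNIV. gc j k * hc k l) * xi l)"
    by (subst sum.swap) (simp add: const_sum sum_distrib_right)
  also have "\<dots> = xi j"
    by (simp add: gc_hc if_distrib[of "\<lambda>x. const x * _"] const_simps cong: if_cong)
  finally show ?thesis .
qed

section \<open>The sl2 relations of R, T and E, and their conformal invariance\<close>

definition RR :: "'n phase_poly" where "RR = (\<Sum>i\<in>UNIV. xi_up g i * xi i)"

lemma R_op_RR: "R_op g f = RR * f"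
  by (simp add: R_op_def RR_def)

lemma dxi_xi_up: "dxi i (xi_up g j) = const (hc i j)"
  by (simp add: xi_up_def pd_sum pd_const_mult pd_var hc_sym[of j] if_distrib[of "\<lambda>x. _ * x"] cong: if_cong)

lemma dxi_RR: "dxi i RR = const 2 * xi_up g i"
proof -
  have "dxi i RR = (\<Sum>j\<in>UNIV. const (hc i j) * xi j) + xi_up g i"
    by (simp add: RR_def pd_sum pd_mult dxi_xi_up pd_var sum.distrib if_distrib[of "\<lambda>x. _ * x"] cong: if_cong)
  also have "(\<Sum>j\<in>UNIV. const (hc i j) * xi j) = xi_up g i"
    by (simp add: xi_up_def)
  finally show ?thesis by (simp add: const_numeral algebra_simps)
qed

lemma T_op_expand: "T_op g f = (\<Sum>i\<in>UNIV. \<Sum>j\<in>UNIV. const (gc i j) * dxi j (dxi i f))"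
  by (simp add: T_op_def dxi_low_def)

lemma T_op_add: "T_op g (f + h) = T_op g f + T_op g h"
  by (simp add: T_op_expand pd_add algebra_simps sum.distrib)

lemma T_op_diff: "T_op g (f - h) = T_op g f - T_op g h"
  by (simp add: T_op_expand pd_diff algebra_simps sum_subtractf)

lemma T_op_mult:
  "T_op g (f * h) = T_op g f * h + const 2 * (\<Sum>i\<in>UNIV. \<Sum>j\<in>UNIV. const (gc i j) * (dxi j f * dxi i h)) + f * T_op g h"
proof -
  have "T_op g (f * h) = (\<Sum>i\<in>UNIV. \<Sum>j\<in>UNIV. const (gc i j) * dxi j (dxi i f) * h
      + const (gc i j) * (dxi i f * dxi j h) + const (gc i j) * (dxi j f * dxi i h)
      + f * (const (gc i j) * dxi j (dxi i h)))"
    unfolding T_op_expand by (intro sum.cong refl) (simp add: pd_mult pd_add algebra_simps)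
  also have "\<dots> = T_op g f * h + (\<Sum>i\<in>UNIV. \<Sum>j\<in>UNIV. const (gc i j) * (dxi i f * dxi j h))
     + (\<Sum>i\<in>UNIV. \<Sum>j\<in>UNIV. const (gc i j) * (dxi j f * dxi i h)) + f * T_op g h"
    by (simp add: T_op_expand sum.distrib sum_distrib_left sum_distrib_right)
  also have "(\<Sum>i\<in>UNIV. \<Sum>j\<in>UNIV. const (gc i j) * (dxi i f * dxi j h)) =
      (\<Sum>i\<in>UNIV. \<Sum>j\<in>UNIV. const (gc i j) * (dxi j f * dxi i h))"
    by (subst sum.swap) (simp add: gc_sym)
  finally show ?thesis by (simp add: const_numeral algebra_simps)
qed

lemma T_op_xi_free: "(\<And>l. dxi l m = 0) \<Longrightarrow> T_op g (m * f) = m * T_op g f"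
  by (simp add: T_op_mult) (simp add: T_op_expand)

lemma T_op_xi_mult: "T_op g (xi j * h) = const 2 * (\<Sum>i\<in>UNIV. const (gc i j) * dxi i h) + xi j * T_op g h"
  by (simp add: T_op_mult)
    (simp add: T_op_expand pd_var if_distrib[of "pd _"] if_distrib[of "\<lambda>x. x * _"] if_distrib[of "\<lambda>x. _ * x"] cong: if_cong)

lemma T_op_pd: "T_op g (pd v f) = pd v (T_op g f)"
  unfolding T_op_expand pd_sum pd_const_mult
  by (intro sum.cong refl arg_cong2[where f = "(*)"]) (metis pd_commute)

text \<open>The relation [T, R] = 4 E. The constant \<open>T_op g RR\<close> equals 2 n and accounts
  for the shift n / 2 in \<open>E_op\<close>.\<close>

lemma T_op_RR_mult: "T_op g (RR * f) = RR * T_op g f + const 4 * E_op f"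
proof -
  have "(\<Sum>i\<in>UNIV. \<Sum>j\<in>UNIV. const (gc i j) * (dxi j RR * dxi i f)) =
      const 2 * (\<Sum>i\<in>UNIV. (\<Sum>j\<in>UNIV. const (gc i j) * xi_up g j) * dxi i f)"
    by (simp add: dxi_RR sum_distrib_left sum_distrib_right mult_ac)
  then have 1: "(\<Sum>i\<in>UNIV. \<Sum>j\<in>UNIV. const (gc i j) * (dxi j RR * dxi i f)) =
      const 2 * (\<Sum>i\<in>UNIV. xi i * dxi i f)" by (simp add: gc_xi_up)
  have "T_op g RR = const 2 * (\<Sum>i\<in>UNIV. \<Sum>j\<in>UNIV. const (gc i j * hc j i))"
    by (simp add: T_op_expand dxi_RR pd_const_mult dxi_xi_up sum_distrib_left const_simps mult.left_commute)
  also have "\<dots> = const 2 * const (\<Sum>i\<in>UNIV. \<Sum>j\<in>UNIV. gc i j * hc j i)"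
    by (simp only: const_sum)
  finally have 2: "T_op g RR = const (2 * of_nat CARD('n))"
    by (simp add: gc_hc const_simps)
  show ?thesis
    unfolding T_op_mult 1 2 E_op_def
    by (simp add: algebra_simps flip: const_simps)
      (simp add: const_simps const_numeral algebra_simps)
qed

lemma E_op_add: "E_op (f + h :: 'n phase_poly) = E_op f + E_op h"
  by (simp add: E_op_def pd_add algebra_simps sum.distrib)

lemma E_op_mult: "E_op (f * h :: 'n phase_poly) = (\<Sum>i\<in>UNIV. xi i * dxi i f) * h + f * E_op h"
  by (simp add: E_op_def pd_mult algebra_simps sum.distrib sum_distrib_right sum_distrib_left)

lemma E_op_RR_mult: "E_op (RR * f) = RR * (E_op f + const 2 * f)"
proof -
  have "(\<Sum>i\<in>UNIV. xi i * dxi i RR) = const 2 * RR"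
    unfolding dxi_RR by (simp add: RR_def sum_distrib_left mult_ac)
  then show ?thesis unfolding E_op_mult[of RR f] by (simp add: algebra_simps)
qed

lemma E_op_dxi: "dxi i (E_op f :: 'n phase_poly) = E_op (dxi i f) + dxi i f"
proof -
  have "dxi i (E_op f) = (\<Sum>j\<in>UNIV. xi j * dxi i (dxi j f)) + dxi i f + const (of_nat CARD('n) / 2) * dxi i f"
    by (simp add: E_op_def pd_add pd_sum pd_mult pd_var pd_const_mult sum.distrib if_distrib[of "\<lambda>x. x * _"] cong: if_cong)
  then show ?thesis by (simp add: E_op_def pd_commute[of "Inr i"])
qed

text \<open>T lowers the degree in \<xi> by two, whereas R raises it by two in
  \<open>E_op_RR_mult\<close>. In \<open>E_op_R0_op\<close> the two shifts cancel.\<close>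

lemma E_op_T_op: "E_op (T_op g f) = T_op g (E_op f - const 2 * f)"
proof -
  have E_const: "E_op (const c * f) = const c * E_op f" for c and f :: "'n phase_poly"
    by (simp add: E_op_mult)
  have E_sum: "E_op (sum h I) = (\<Sum>i\<in>I. E_op (h i))" for h :: "'n \<Rightarrow> 'n phase_poly" and I
    by (induction I rule: infinite_finite_induct) (simp_all add: E_op_add, simp_all add: E_op_def)
  have *: "dxi j (dxi i (E_op f)) = E_op (dxi j (dxi i f)) + const 2 * dxi j (dxi i f)" for i j and f :: "'n phase_poly"
    by (simp add: E_op_dxi pd_add const_numeral algebra_simps)
  have "T_op g (E_op f) = E_op (T_op g f) + const 2 * T_op g f"
    by (simp add: T_op_expand * E_sum E_const sum_distrib_left distrib_left sum.distrib mult_ac)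
  moreover have "T_op g (E_op f - const 2 * f) = T_op g (E_op f) - const 2 * T_op g f"
    by (simp add: T_op_diff T_op_xi_free)
  ultimately show ?thesis by simp
qed

lemma E_op_R0_op: "E_op (R0_op g f) = R0_op g (E_op f)"
proof -
  have "R0_op g (E_op f) = RR * T_op g ((E_op f - const 2 * f) + const 2 * f)"
    by (simp add: R0_op_def R_op_RR)
  also have "\<dots> = RR * (E_op (T_op g f) + const 2 * T_op g f)"
    by (simp only: T_op_add E_op_T_op T_op_xi_free[OF pd_const])
  finally show ?thesis by (simp add: R0_op_def R_op_RR E_op_RR_mult)
qed

text \<open>The Jacobian of a conformal field, with its index lowered, is \<phi> g plus an
  antisymmetric part, and the latter vanishes in the contraction with a symmetric \<open>Y\<close>.
  The sum is added to its own transpose and then halved.\<close>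

lemma conformal_contract:
  fixes Y :: "'n \<Rightarrow> 'n \<Rightarrow> 'n phase_poly"
  assumes X: "\<And>i k. (\<Sum>j\<in>UNIV. dx i (X $ j) * const (gc j k) + dx k (X $ j) * const (gc j i))
        = const 2 * (\<phi> * const (gc i k))"
    and Y: "\<And>i k. Y i k = Y k i"
  shows "(\<Sum>i\<in>UNIV. \<Sum>j\<in>UNIV. dx i (X $ j) * (\<Sum>k\<in>UNIV. const (gc j k) * Y k i))
     = \<phi> * (\<Sum>i\<in>UNIV. \<Sum>k\<in>UNIV. const (gc i k) * Y i k)"
proof -
  let ?S = "\<Sum>i\<in>UNIV. \<Sum>j\<in>UNIV. dx i (X $ j) * (\<Sum>k\<in>UNIV. const (gc j k) * Y k i)"
  have 1: "?S = (\<Sum>i\<in>UNIV. \<Sum>k\<in>UNIV. (\<Sum>j\<in>UNIV. dx i (X $ j) * const (gc j k)) * Y i k)"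
  proof (rule sum.cong[OF refl])
    fix i
    have "(\<Sum>j\<in>UNIV. dx i (X $ j) * (\<Sum>k\<in>UNIV. const (gc j k) * Y k i)) =
        (\<Sum>j\<in>UNIV. \<Sum>k\<in>UNIV. dx i (X $ j) * const (gc j k) * Y i k)"
      by (simp add: sum_distrib_left mult.assoc Y[of i])
    then show "(\<Sum>j\<in>UNIV. dx i (X $ j) * (\<Sum>k\<in>UNIV. const (gc j k) * Y k i)) =
        (\<Sum>k\<in>UNIV. (\<Sum>j\<in>UNIV. dx i (X $ j) * const (gc j k)) * Y i k)"
      by (subst (asm) sum.swap) (simp add: sum_distrib_right)
  qed
  then have 2: "?S = (\<Sum>i\<in>UNIV. \<Sum>k\<in>UNIV. (\<Sum>j\<in>UNIV. dx k (X $ j) * const (gc j i)) * Y i k)"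
    by (subst (asm) sum.swap) (simp add: Y[of _ i for i])
  have "?S + ?S = (\<Sum>i\<in>UNIV. \<Sum>k\<in>UNIV. const 2 * (\<phi> * const (gc i k)) * Y i k)"
    unfolding X[symmetric] by (subst 1, subst 2) (simp add: sum.distrib distrib_right)
  also have "\<dots> = const 2 * (\<phi> * (\<Sum>i\<in>UNIV. \<Sum>k\<in>UNIV. const (gc i k) * Y i k))"
    by (simp add: sum_distrib_left mult_ac)
  finally have "const (1/2) * const 2 * ?S = const (1/2) * const 2 * (\<phi> * (\<Sum>i\<in>UNIV. \<Sum>k\<in>UNIV. const (gc i k) * Y i k))"
    by (simp add: const_numeral mult.assoc flip: mult_2)
  then show ?thesis by (simp add: const_simps flip: const_simps(4))
qed

text \<open>The commutator of R T with \<xi>_j \<partial>/\<partial>\<xi>_i involves two symmetric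
  tensors, the second derivatives in \<xi> and the products of the \<xi>^k. Contracted with the
  Jacobian, both give the same multiple of \<phi> R T, with opposite signs: the conformal rescalings
  of R and T are inverse to each other.\<close>

lemma R0_op_commute_Lie_op:
  assumes "conformal_field g X"
  shows "R0_op g (Lie_op \<delta> X f) = Lie_op \<delta> X (R0_op g f)"
proof -
  from assms obtain \<phi> where free: "\<And>k l. dxi l (X $ k) = 0"
    and X: "\<And>i k. (\<Sum>j\<in>UNIV. dx i (X $ j) * const (gc j k) + dx k (X $ j) * const (gc j i))
        = const 2 * (\<phi> * const (gc i k))"
    unfolding conformal_field_def by blast
  show ?thesis
  proof (rule commute_Lie_op[OF _ _ _ free])
    show "R0_op g (f + h) = R0_op g f + R0_op g h" for f h
      by (simp add: R0_op_def R_op_RR T_op_add algebra_simps)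
    show "R0_op g (m * f) = m * R0_op g f" if "\<And>l. dxi l m = 0" for m f
      by (simp add: R0_op_def R_op_RR T_op_xi_free that mult.left_commute)
    show "R0_op g (dx i f) = dx i (R0_op g f)" for i f
      by (simp add: R0_op_def R_op_RR T_op_pd pd_mult RR_def xi_up_def pd_sum pd_const_mult pd_var)
    fix f
    have *: "R0_op g (xi j * dxi i f) - xi j * dxi i (R0_op g f) =
        const 2 * (RR * (\<Sum>k\<in>UNIV. const (gc j k) * dxi k (dxi i f))
          - (\<Sum>k\<in>UNIV. const (gc j k) * (xi_up g k * xi_up g i)) * T_op g f)" for i j
    proof -
      have "(\<Sum>k\<in>UNIV. const (gc j k) * (xi_up g k * xi_up g i)) = xi j * xi_up g i"
        by (simp add: sum_distrib_right flip: mult.assoc gc_xi_up)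
      then show ?thesis
        by (simp add: R0_op_def R_op_RR T_op_xi_mult T_op_pd pd_mult dxi_RR gc_sym[of j] algebra_simps)
    qed
    have "(\<Sum>i\<in>UNIV. \<Sum>j\<in>UNIV. dx i (X $ j) * (R0_op g (xi j * dxi i f) - xi j * dxi i (R0_op g f))) =
       const 2 * (RR * (\<Sum>i\<in>UNIV. \<Sum>j\<in>UNIV. dx i (X $ j) * (\<Sum>k\<in>UNIV. const (gc j k) * dxi k (dxi i f)))
        - (\<Sum>i\<in>UNIV. \<Sum>j\<in>UNIV. dx i (X $ j) * (\<Sum>k\<in>UNIV. const (gc j k) * (xi_up g k * xi_up g i))) * T_op g f)"
      unfolding * by (simp only: sum_distrib_left sum_distrib_right sum_subtractf right_diff_distrib left_diff_distrib mult_ac)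
    also have "\<dots> = const 2 * (RR * (\<phi> * (\<Sum>i\<in>UNIV. \<Sum>k\<in>UNIV. const (gc i k) * dxi i (dxi k f)))
        - (\<phi> * (\<Sum>i\<in>UNIV. \<Sum>k\<in>UNIV. const (gc i k) * (xi_up g i * xi_up g k))) * T_op g f)"
      by (subst (1 2) conformal_contract[OF X]) (simp_all add: pd_commute mult.commute)
    also have "(\<Sum>i\<in>UNIV. \<Sum>k\<in>UNIV. const (gc i k) * dxi i (dxi k f)) = T_op g f"
      unfolding T_op_expand by (intro sum.cong refl) (metis pd_commute)
    also have "(\<Sum>i\<in>UNIV. \<Sum>k\<in>UNIV. const (gc i k) * (xi_up g i * xi_up g k)) = RR"
    proof -
      have "(\<Sum>i\<in>UNIV. \<Sum>k\<in>UNIV. const (gc i k) * (xi_up g i * xi_up g k)) =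
          (\<Sum>i\<in>UNIV. xi_up g i * (\<Sum>k\<in>UNIV. const (gc i k) * xi_up g k))"
        by (simp add: sum_distrib_left mult_ac)
      then show ?thesis by (simp add: gc_xi_up RR_def)
    qed
    finally show "(\<Sum>i\<in>UNIV. \<Sum>j\<in>UNIV. dx i (X $ j) * (R0_op g (xi j * dxi i f) - xi j * dxi i (R0_op g f))) = 0"
      by (simp add: mult_ac)
  qed
qed

text \<open>Every single \<xi>_j \<partial>/\<partial>\<xi>_i preserves the degree in \<xi>, so it
  commutes with \<open>E_op\<close> before any contraction with the Jacobian.\<close>

lemma E_op_commute_Lie_op:
  assumes "\<And>k l. dxi l (X $ k :: 'n phase_poly) = 0"
  shows "E_op (Lie_op \<delta> X f) = Lie_op \<delta> X (E_op f)"
proof (rule commute_Lie_op[OF E_op_add _ _ assms])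
  show "E_op (m * f) = m * E_op f" if "\<And>l. dxi l m = 0" for m f :: "'n phase_poly"
    by (simp add: E_op_mult that)
  show "E_op (dx i f) = dx i (E_op f)" for i and f :: "'n phase_poly"
    by (simp add: E_op_def pd_add pd_sum pd_mult pd_var pd_const_mult pd_commute[of "Inl i"])
  fix f :: "'n phase_poly"
  have "E_op (xi j * dxi i f) - xi j * dxi i (E_op f) = 0" for i j
    by (simp add: E_op_mult E_op_dxi pd_var algebra_simps if_distrib[of "\<lambda>x. _ * x"] cong: if_cong)
  then show "(\<Sum>i\<in>UNIV. \<Sum>j\<in>UNIV. dx i (X $ j) * (E_op (xi j * dxi i f) - xi j * dxi i (E_op f))) = 0"
    by simp
qed

end

section \<open>Subalgebras and generators\<close>

lemma op_subalgebra_hull: "op_subalgebra (op_subalgebra hull S)"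
  by (rule hull_in) (auto simp: op_subalgebra_def)

lemma op_subalgebra_0: "op_subalgebra S \<Longrightarrow> (\<lambda>f. 0) \<in> S"
proof -
  assume "op_subalgebra S"
  then have "(\<lambda>f. const 0 * id f) \<in> S" unfolding op_subalgebra_def by blast
  then show ?thesis by (simp add: const_simps)
qed

lemma op_subalgebra_add: "op_subalgebra S \<Longrightarrow> A \<in> S \<Longrightarrow> B \<in> S \<Longrightarrow> (\<lambda>f. A f + B f) \<in> S"
  by (simp add: op_subalgebra_def)

lemma op_subalgebra_sum:
  assumes "op_subalgebra S" and "\<And>i. i \<in> I \<Longrightarrow> A i \<in> S"
  shows "(\<lambda>f. \<Sum>i\<in>I. A i f) \<in> S"
  using assms(2)
proof (induction I rule: infinite_finite_induct)
  case (insert i I)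
  then have "(\<lambda>f. A i f + (\<Sum>i\<in>I. A i f)) \<in> S"
    by (intro op_subalgebra_add[OF assms(1)]) simp_all
  with insert.hyps show ?case by simp
qed (use op_subalgebra_0[OF assms(1)] in simp_all)

lemma op_subalgebra_comp: "op_subalgebra S \<Longrightarrow> A \<in> S \<Longrightarrow> B \<in> S \<Longrightarrow> (\<lambda>f. A (B f)) \<in> S"
  unfolding op_subalgebra_def by (auto simp: o_def)

lemma op_subalgebra_const: "op_subalgebra S \<Longrightarrow> A \<in> S \<Longrightarrow> (\<lambda>f. const c * A f) \<in> S"
  by (simp add: op_subalgebra_def)

lemma op_subalgebra_id: "op_subalgebra S \<Longrightarrow> (\<lambda>f. f) \<in> S"
  unfolding op_subalgebra_def by (simp add: id_def)

lemma op_subalgebra_diff: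
  assumes "op_subalgebra S" and "A \<in> S" and "B \<in> S"
  shows "(\<lambda>f. A f - B f) \<in> S"
  using op_subalgebra_add[OF assms(1,2) op_subalgebra_const[OF assms(1,3), of "-1"]]
  by (simp add: const_simps)

lemma op_subalgebra_End_diff: "op_subalgebra End_diff"
  unfolding End_diff_def by (rule op_subalgebra_hull)

lemma var_in_End_diff: "A \<in> End_diff \<Longrightarrow> (\<lambda>f. var v * A f) \<in> End_diff"
  by (rule op_subalgebra_comp[OF op_subalgebra_End_diff])
    (auto simp: End_diff_def intro: hull_inc)

lemma pd_in_End_diff: "A \<in> End_diff \<Longrightarrow> (\<lambda>f. pd v (A f)) \<in> End_diff"
  by (rule op_subalgebra_comp[OF op_subalgebra_End_diff])
    (auto simp: End_diff_def intro: hull_inc)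

lemmas End_diff_intros =
  var_in_End_diff pd_in_End_diff op_subalgebra_sum[OF op_subalgebra_End_diff]
  op_subalgebra_const[OF op_subalgebra_End_diff] op_subalgebra_add[OF op_subalgebra_End_diff]
  op_subalgebra_id[OF op_subalgebra_End_diff]

lemma E_op_in_End_diff: "E_op \<in> End_diff"
  unfolding E_op_def by (intro End_diff_intros)

lemma R0_op_in_End_diff: "R0_op g \<in> End_diff"
proof -
  have "R0_op g f = (\<Sum>i\<in>UNIV. \<Sum>j\<in>UNIV. const (of_real (matrix_inv g $ i $ j)) * (xi j * (xi i *
      (\<Sum>k\<in>UNIV. \<Sum>l\<in>UNIV. const (of_real (g $ k $ l)) * dxi l (dxi k f)))))" for f
    by (simp add: R0_op_def R_op_def T_op_def dxi_low_def xi_up_def sum_distrib_right mult.assoc)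
  then have "R0_op g = (\<lambda>f. \<Sum>i\<in>UNIV. \<Sum>j\<in>UNIV. const (of_real (matrix_inv g $ i $ j)) * (xi j * (xi i *
      (\<Sum>k\<in>UNIV. \<Sum>l\<in>UNIV. const (of_real (g $ k $ l)) * dxi l (dxi k f)))))" by blast
  moreover have "\<dots> \<in> End_diff" by (intro End_diff_intros)
  ultimately show ?thesis by simp
qed

lemma Lie_op_add: "Lie_op \<delta> X (f + h) = Lie_op \<delta> X f + Lie_op \<delta> X h"
  by (simp add: Lie_op_def Let_def pd_add algebra_simps sum.distrib sum_subtractf)

lemma Lie_op_const: "Lie_op \<delta> X (const c * f) = const c * Lie_op \<delta> X f"
  by (simp add: Lie_op_def Let_def pd_const_mult sum_distrib_left distrib_left right_diff_distrib mult.left_commute)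

lemma op_subalgebra_commutant:
  fixes S :: "'n::finite vfield set"
  shows "op_subalgebra (commutant \<delta> S)"
proof -
  have "op_subalgebra (End_diff :: 'n operator set)" by (rule op_subalgebra_End_diff)
  note sub = this[unfolded op_subalgebra_def]
  have mem: "A \<in> commutant \<delta> S \<longleftrightarrow>
      A \<in> End_diff \<and> (\<forall>X\<in>S. \<forall>f. A (Lie_op \<delta> X f) = Lie_op \<delta> X (A f))" for A
    unfolding commutant_def by (simp add: fun_eq_iff)
  show ?thesis
    unfolding op_subalgebra_def
  proof (intro conjI ballI allI)
    show "id \<in> commutant \<delta> S" using sub by (simp add: mem)
  next
    fix A B assume "A \<in> commutant \<delta> S" "B \<in> commutant \<delta> S"
    then show "(\<lambda>f. A f + B f) \<in> commutant \<delta> S" "A \<circ> B \<in> commutant \<delta> S"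
      using sub by (simp_all add: mem Lie_op_add)
  next
    fix c A assume "A \<in> commutant \<delta> S"
    then show "(\<lambda>f. const c * A f) \<in> commutant \<delta> S"
      using sub by (simp add: mem Lie_op_const)
  qed
qed

lemma coord_field_nth: "coord_field i $ k = (if k = i then 1 else 0)"
  by (simp add: coord_field_def)

lemma rot_field_nth:
  "rot_field g i j $ k = (if k = j then xlow g i else 0) - (if k = i then xlow g j else 0)"
  by (simp add: rot_field_def coord_field_nth)

lemma euler_field_nth: "euler_field $ k = xup k"
  by (simp add: euler_field_def sum_component coord_field_nth if_distrib[of "\<lambda>x. _ * x"] cong: if_cong)

lemma inv_field_nth:
  "inv_field g i $ k = (if k = i then \<Sum>j\<in>UNIV. xlow g j * xup j else 0) - const 2 * xlow g i * xup k"
  by (simp add: inv_field_def sum_component coord_field_nth if_distrib[of "\<lambda>x. _ * x"] cong: if_cong)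

lemma dx_xlow: "dx a (xlow g i) = const (of_real (g $ i $ a))"
  by (simp add: xlow_def pd_sum pd_const_mult pd_var if_distrib[of "\<lambda>x. _ * x"] cong: if_cong)

lemma dxi_xlow: "dxi a (xlow g i) = 0"
  by (simp add: xlow_def pd_sum pd_const_mult pd_var)

section \<open>The generators of the conformal algebra are conformal fields\<close>

context conf_frame
begin

lemma dx_square: "dx a (\<Sum>j\<in>UNIV. xlow g j * xup j) = const 2 * xlow g a"
proof -
  have "dx a (\<Sum>j\<in>UNIV. xlow g j * xup j) = (\<Sum>j\<in>UNIV. const (gc a j) * xup j) + xlow g a"
    by (simp add: pd_sum pd_mult pd_var dx_xlow gc_sym sum.distrib if_distrib[of "\<lambda>x. _ * x"] cong: if_cong)
  then show ?thesis by (simp add: const_numeral flip: xlow_def)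
qed

lemma dx_inv_field: "dx a (inv_field g i $ k) = (if k = i then const 2 * xlow g a else 0)
    - const (2 * gc i a) * xup k - (if k = a then const 2 * xlow g i else 0)"
  by (simp add: inv_field_nth pd_diff pd_mult pd_var dx_square dx_xlow const_simps
      if_distrib[of "pd _"] if_distrib[of "\<lambda>x. _ * x"] cong: if_cong)

lemma so_conf_xi_free:
  "dxi l (coord_field i $ k) = 0" "dxi l (rot_field g i j $ k) = 0" "dxi l (euler_field $ k) = 0"
  "dxi l (inv_field g i $ k) = 0"
  by (simp_all add: coord_field_nth rot_field_nth euler_field_nth inv_field_nth pd_diff pd_mult pd_sum
      dxi_xlow pd_var)

lemma conformal_coord_field: "conformal_field g (coord_field i)"
  by (auto simp: conformal_field_def so_conf_xi_free coord_field_nth if_distrib[of "pd _"] cong: if_cong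
      intro: exI[of _ 0])

lemma conformal_rot_field: "conformal_field g (rot_field g i j)"
  by (auto simp: conformal_field_def so_conf_xi_free dxi_xlow rot_field_nth pd_diff dx_xlow left_diff_distrib
      sum.distrib sum_subtractf gc_sym if_distrib[of "pd _"] if_distrib[of "\<lambda>x. x * _"]
      cong: if_cong intro!: exI[of _ 0])

lemma conformal_euler_field: "conformal_field g euler_field"
proof -
  have "(\<Sum>j\<in>UNIV. dx i (euler_field $ j) * const (gc j k) + dx k (euler_field $ j) * const (gc j i))
      = const 2 * (1 * const (gc i k))" for i k
    by (simp add: euler_field_nth pd_var sum.distrib gc_sym const_numeral if_distrib[of "\<lambda>x. x * _"] cong: if_cong)
  then show ?thesis unfolding conformal_field_def using so_conf_xi_free(3) by blast
qed

text \<open>In \<open>eq\<close> the first two terms are antisymmetric in \<open>a\<close> and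
  \<open>b\<close>. Symmetrization leaves the last one, with conformal factor - 2 x_i.\<close>

lemma conformal_inv_field: "conformal_field g (inv_field g i)"
proof -
  have xlow: "(\<Sum>k\<in>UNIV. const (gc k a) * xup k) = xlow g a" for a
    by (simp add: xlow_def gc_sym)
  have eq: "(\<Sum>k\<in>UNIV. dx a (inv_field g i $ k) * const (gc k b)) =
      const 2 * (xlow g a * const (gc i b) - xlow g b * const (gc i a) - xlow g i * const (gc a b))" for a b
  proof -
    have "(\<Sum>k\<in>UNIV. dx a (inv_field g i $ k) * const (gc k b)) =
       const 2 * xlow g a * const (gc i b) - (\<Sum>k\<in>UNIV. const (2 * gc i a) * xup k * const (gc k b))
       - const 2 * xlow g i * const (gc a b)"
      unfolding dx_inv_field by (simp add: left_diff_distrib sum_subtractf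
        if_distrib[of "\<lambda>x. x * _"] if_distrib[of "\<lambda>x. _ * x"] cong: if_cong)
    also have "(\<Sum>k\<in>UNIV. const (2 * gc i a) * xup k * const (gc k b)) =
        const (2 * gc i a) * (\<Sum>k\<in>UNIV. const (gc k b) * xup k)"
      by (simp add: sum_distrib_left mult_ac)
    finally have "(\<Sum>k\<in>UNIV. dx a (inv_field g i $ k) * const (gc k b)) =
       const 2 * xlow g a * const (gc i b) - const (2 * gc i a) * (\<Sum>k\<in>UNIV. const (gc k b) * xup k)
       - const 2 * xlow g i * const (gc a b)" .
    then show ?thesis unfolding xlow by (simp add: const_simps algebra_simps)
  qed
  have "(\<Sum>k\<in>UNIV. dx a (inv_field g i $ k) * const (gc k b) + dx b (inv_field g i $ k) * const (gc k a)) =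
      const 2 * (- (const 2 * xlow g i) * const (gc a b))" for a b
    unfolding sum.distrib eq by (simp add: gc_sym const_numeral algebra_simps)
  then show ?thesis unfolding conformal_field_def using so_conf_xi_free(4) by blast
qed

lemma so_conf_conformal:
  assumes "X \<in> so_conf g"
  shows "conformal_field g X"
  using assms unfolding so_conf_def
  by (rule vf.span_induct[OF _ conformal_field_subspace])
    (auto intro: conformal_coord_field conformal_rot_field conformal_euler_field conformal_inv_field)

lemma hull_subset_commutant: "op_subalgebra hull {E_op, R0_op g} \<subseteq> commutant \<delta> (so_conf g)"
proof (rule hull_minimal)
  show "op_subalgebra (commutant \<delta> (so_conf g))" by (rule op_subalgebra_commutant)
  have "E_op \<in> commutant \<delta> (so_conf g)"
    using so_conf_conformal E_op_commute_Lie_op E_op_in_End_diff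
    unfolding commutant_def conformal_field_def by fastforce
  moreover have "R0_op g \<in> commutant \<delta> (so_conf g)"
    using so_conf_conformal R0_op_commute_Lie_op R0_op_in_End_diff
    unfolding commutant_def by fastforce
  ultimately show "{E_op, R0_op g} \<subseteq> commutant \<delta> (so_conf g)" by simp
qed

section \<open>Explicit Lie derivatives along the generators\<close>

lemma Lie_op_euler_field: "Lie_op \<delta> euler_field f = (\<Sum>k\<in>UNIV. xup k * dx k f)
    - (\<Sum>k\<in>UNIV. xi k * dxi k f) + const (of_nat CARD('n) * of_real \<delta>) * (f :: 'n phase_poly)"
  by (subst Lie_op_xi_free[OF so_conf_xi_free(3)])
    (simp add: euler_field_nth pd_var if_distrib[of "\<lambda>x. _ * x"] if_distrib[of "\<lambda>x. x * _"] const_simps const_of_nat cong: if_cong)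

lemma Lie_op_rot_field: "Lie_op \<delta> (rot_field g i j) f =
    (\<Sum>s\<in>UNIV. const (gc i s) * (xup s * dx j f)) - (\<Sum>s\<in>UNIV. const (gc j s) * (xup s * dx i f))
    - (\<Sum>a\<in>UNIV. const (gc i a) * (xi j * dxi a f)) + (\<Sum>a\<in>UNIV. const (gc j a) * (xi i * dxi a f))"
proof -
  have 1: "(\<Sum>k\<in>UNIV. rot_field g i j $ k * dx k f) =
      (\<Sum>s\<in>UNIV. const (gc i s) * (xup s * dx j f)) - (\<Sum>s\<in>UNIV. const (gc j s) * (xup s * dx i f))"
    by (simp add: rot_field_nth left_diff_distrib sum_subtractf if_distrib[of "\<lambda>x. x * _"] cong: if_cong)
      (simp add: xlow_def sum_distrib_right mult.assoc)
  have dx: "dx a (rot_field g i j $ k) = (if k = j then const (gc i a) else 0) - (if k = i then const (gc j a) else 0)" for a k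
    by (simp add: rot_field_nth pd_diff dx_xlow if_distrib[of "pd _"] cong: if_cong)
  show ?thesis
    by (subst Lie_op_xi_free[OF so_conf_xi_free(2)], unfold 1 dx)
      (simp add: left_diff_distrib right_diff_distrib sum_subtractf gc_sym
        if_distrib[of "\<lambda>x. x * _"] if_distrib[of "\<lambda>x. _ * x"] cong: if_cong)
qed

text \<open>Every term is a constant times a word in multiplications and derivatives, so that the
  rules for \<open>has_symbol\<close> apply term by term after composition with an operator on
  either side.\<close>

lemma Lie_op_inv_field: "Lie_op \<delta> (inv_field g i) f =
    (\<Sum>s\<in>UNIV. \<Sum>t\<in>UNIV. const (gc s t) * (xup s * (xup t * dx i f)))
    - (\<Sum>s\<in>UNIV. \<Sum>t\<in>UNIV. const (2 * gc i s) * (xup s * (xup t * dx t f)))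
    - (\<Sum>a\<in>UNIV. \<Sum>s\<in>UNIV. const (2 * gc a s) * (xup s * (xi i * dxi a f)))
    + (\<Sum>a\<in>UNIV. \<Sum>k\<in>UNIV. const (2 * gc i a) * (xup k * (xi k * dxi a f)))
    + (\<Sum>s\<in>UNIV. \<Sum>a\<in>UNIV. const (2 * gc i s) * (xup s * (xi a * dxi a f)))
    - (\<Sum>s\<in>UNIV. const (2 * of_nat CARD('n) * of_real \<delta> * gc i s) * (xup s * f))"
proof -
  have 1: "(\<Sum>k\<in>UNIV. inv_field g i $ k * dx k f) =
      (\<Sum>s\<in>UNIV. \<Sum>t\<in>UNIV. const (gc s t) * (xup s * (xup t * dx i f)))
    - (\<Sum>s\<in>UNIV. \<Sum>t\<in>UNIV. const (2 * gc i s) * (xup s * (xup t * dx t f)))"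
  proof -
    have "(\<Sum>k\<in>UNIV. inv_field g i $ k * dx k f) = (\<Sum>j\<in>UNIV. xlow g j * xup j) * dx i f
        - (\<Sum>t\<in>UNIV. const 2 * xlow g i * xup t * dx t f)"
      by (simp add: inv_field_nth left_diff_distrib sum_subtractf if_distrib[of "\<lambda>x. x * _"] cong: if_cong)
    also have "(\<Sum>j\<in>UNIV. xlow g j * xup j) * dx i f =
        (\<Sum>s\<in>UNIV. \<Sum>t\<in>UNIV. const (gc s t) * (xup s * (xup t * dx i f)))"
      by (simp add: xlow_def sum_distrib_right sum_distrib_left mult_ac)
    also have "(\<Sum>t\<in>UNIV. const 2 * xlow g i * xup t * dx t f) =
        (\<Sum>s\<in>UNIV. \<Sum>t\<in>UNIV. const (2 * gc i s) * (xup s * (xup t * dx t f)))"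
      by (subst sum.swap) (simp add: xlow_def sum_distrib_right sum_distrib_left const_simps mult_ac)
    finally show ?thesis .
  qed
  have 2: "(\<Sum>a\<in>UNIV. \<Sum>k\<in>UNIV. dx a (inv_field g i $ k) * (xi k * dxi a f)) =
     (\<Sum>a\<in>UNIV. \<Sum>s\<in>UNIV. const (2 * gc a s) * (xup s * (xi i * dxi a f)))
    - (\<Sum>a\<in>UNIV. \<Sum>k\<in>UNIV. const (2 * gc i a) * (xup k * (xi k * dxi a f)))
    - (\<Sum>s\<in>UNIV. \<Sum>a\<in>UNIV. const (2 * gc i s) * (xup s * (xi a * dxi a f)))"
  proof -
    have "(\<Sum>a\<in>UNIV. \<Sum>k\<in>UNIV. dx a (inv_field g i $ k) * (xi k * dxi a f)) =
      (\<Sum>a\<in>UNIV. const 2 * xlow g a * (xi i * dxi a f))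
      - (\<Sum>a\<in>UNIV. \<Sum>k\<in>UNIV. const (2 * gc i a) * xup k * (xi k * dxi a f))
      - (\<Sum>a\<in>UNIV. const 2 * xlow g i * (xi a * dxi a f))"
      unfolding dx_inv_field
      by (simp add: left_diff_distrib sum_subtractf if_distrib[of "\<lambda>x. x * _"] cong: if_cong)
    also have "(\<Sum>a\<in>UNIV. const 2 * xlow g a * (xi i * dxi a f)) =
        (\<Sum>a\<in>UNIV. \<Sum>s\<in>UNIV. const (2 * gc a s) * (xup s * (xi i * dxi a f)))"
      by (simp add: xlow_def sum_distrib_right sum_distrib_left const_simps mult_ac)
    also have "(\<Sum>a\<in>UNIV. const 2 * xlow g i * (xi a * dxi a f)) =
        (\<Sum>s\<in>UNIV. \<Sum>a\<in>UNIV. const (2 * gc i s) * (xup s * (xi a * dxi a f)))"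
      by (subst sum.swap) (simp add: xlow_def sum_distrib_right sum_distrib_left const_simps mult_ac)
    finally show ?thesis by (simp add: mult.assoc)
  qed
  have "(\<Sum>a\<in>UNIV. dx a (inv_field g i $ a)) = - (const (2 * of_nat CARD('n)) * xlow g i)"
  proof -
    have "(\<Sum>a\<in>UNIV. const (2 * gc i a) * xup a) = const 2 * xlow g i"
      by (simp add: xlow_def sum_distrib_left const_simps mult_ac)
    then show ?thesis
      unfolding dx_inv_field by (simp add: sum_subtractf const_simps const_of_nat mult_ac)
  qed
  then have 3: "(\<Sum>a\<in>UNIV. const (of_real \<delta>) * dx a (inv_field g i $ a)) * f =
      - (\<Sum>s\<in>UNIV. const (2 * of_nat CARD('n) * of_real \<delta> * gc i s) * (xup s * f))"
    by (simp flip: sum_distrib_left) (simp add: xlow_def sum_distrib_left sum_distrib_right const_simps mult_ac)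
  show ?thesis
    by (subst Lie_op_xi_free[OF so_conf_xi_free(4)], unfold 1 2 3) simp
qed

end

section \<open>Symbols commuting with the conformal algebra\<close>

text \<open>The commutator of \<open>pd v\<close> with \<open>A\<close> has symbol
  \<open>dx v a\<close>, and uniqueness of symbols turns commutation of operators into an equation
  between polynomials. The other generators are treated in the same way.\<close>

lemma symbol_dx_eq_0:
  fixes A :: "'n::finite operator"
  assumes "has_symbol a A" and "\<And>f. A (pd v f) = pd v (A f)"
  shows "dx v a = 0"
proof -
  have "xi v * a = xi v * a + dx v a"
    by (rule has_symbol_unique[OF has_symbol_eq[OF has_symbol_pd[OF assms(1)] refl assms(2)]
          has_symbol_pd_comp[OF assms(1)]])
  then show ?thesis by simp
qed

lemma hcomp_var_mult_0: "w v = 0 \<Longrightarrow> hcomp w k (var v * f) = var v * hcomp w k f"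
  using hcomp_var_mult[of w k v f] by simp

lemma hcomp_var_mult_1: "w v = 1 \<Longrightarrow> hcomp w (Suc k) (var v * f) = var v * hcomp w k f"
  using hcomp_var_mult[of w k v f] by simp

lemma hcomp_pd_0: "w v = 0 \<Longrightarrow> hcomp w k (pd v f) = pd v (hcomp w k f)"
  using hcomp_pd[of w k v f] by simp

lemma hcomp_pd_1: "w v = 1 \<Longrightarrow> hcomp w k (pd v f) = pd v (hcomp w (Suc k) f)"
  using hcomp_pd[of w k v f] by simp

text \<open>Exchanging a variable for one of equal weight keeps the degree. The shift rules for
  \<open>hcomp\<close> cover the degrees \<open>k\<close> that are at least this weight; below it
  both sides vanish.\<close>

lemma hcomp_euler:
  assumes "w u = w v"
  shows "hcomp w k (var v * pd u f) = var v * pd u (hcomp w k f)"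
proof (cases "w v \<le> k")
  case True
  then obtain k' where "k = k' + w v" by (metis add.commute le_Suc_ex)
  then show ?thesis using assms by (simp add: hcomp_var_mult hcomp_pd)
next
  case False
  have "hcomp w k (var v * h) = 0" for h
  proof (induction h rule: single_induct)
    case (single m c)
    have "wt w (Poly_Mapping.single v 1 + m) \<noteq> k"
      using False wt_add_single[of w m v] by (simp add: add.commute)
    then show ?case
      unfolding var_mult_single by (intro hcomp_eq_0) (auto split: if_splits)
  qed (simp add: distrib_left hcomp_add)
  moreover have "pd u (hcomp w k f) = 0"
    using False assms
    by (intro poly_mapping_eqI) (simp add: lookup_pd lookup_hcomp wt_add_single when_def del: One_nat_def)
  ultimately show ?thesis by simp
qed

definition eta_wt :: "('n + 'n) + ('n + 'n) \<Rightarrow> nat" where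
  "eta_wt v = (case v of Inr (Inr i) \<Rightarrow> 1 | _ \<Rightarrow> 0)"

definition xi_wt :: "('n + 'n) + ('n + 'n) \<Rightarrow> nat" where
  "xi_wt v = (case v of Inl (Inr i) \<Rightarrow> 1 | _ \<Rightarrow> 0)"

lemma eta_wt_simps [simp]: "eta_wt (Inl v) = 0" "eta_wt (Inr (Inl i)) = 0" "eta_wt (Inr (Inr i)) = 1"
  by (simp_all add: eta_wt_def)

lemma lookup_var_pd: "Poly_Mapping.lookup (var v * pd v f) m = of_nat (Poly_Mapping.lookup m v) * Poly_Mapping.lookup f m"
proof (induction f rule: single_induct)
  case (single k c)
  have "Poly_Mapping.single v 1 + (k - Poly_Mapping.single v 1) = k" if "Poly_Mapping.lookup k v \<noteq> 0"
    using that by (intro poly_mapping_eqI) (auto simp: lookup_add lookup_minus lookup_single when_def)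
  then show ?case
    by (cases "Poly_Mapping.lookup k v = 0") (auto simp: pd_single var_mult_single lookup_single when_def)
qed (simp add: pd_add distrib_left lookup_add)

section \<open>Real frame coordinates; independence of p, equal bidegrees and rotation invariance of
  the symbol\<close>

context conf_frame
begin

text \<open>The real coordinates of \<xi> in the coframe and of \<eta> in the frame make the
  invariants Euclidean: the pairing of \<xi> with \<eta> becomes \<open>u \<bullet> v\<close>, and
  their squares become \<open>u \<bullet> u\<close> and \<open>v \<bullet> v\<close>.\<close>

definition frame_point :: "('n \<Rightarrow> complex) \<Rightarrow> ('n \<Rightarrow> complex) \<Rightarrow> real^'n \<Rightarrow> real^'n \<Rightarrow>
    ('n + 'n) + ('n + 'n) \<Rightarrow> complex" where
  "frame_point x p u v = case_sum (case_sum x (\<lambda>i. \<Sum>k\<in>UNIV. GQ i k * of_real (u $ k)))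
     (case_sum p (\<lambda>i. \<Sum>k\<in>UNIV. Q $ i $ k * of_real (v $ k)))"

lemma frame_point_simps [simp]:
  "frame_point x p u v (Inl (Inl i)) = x i"
  "frame_point x p u v (Inl (Inr i)) = (\<Sum>k\<in>UNIV. GQ i k * of_real (u $ k))"
  "frame_point x p u v (Inr (Inl i)) = p i"
  "frame_point x p u v (Inr (Inr i)) = (\<Sum>k\<in>UNIV. Q $ i $ k * of_real (v $ k))"
  by (simp_all add: frame_point_def)

lemma frame_contract_Q: "(\<Sum>i\<in>UNIV. (\<Sum>k\<in>UNIV. GQ i k * y k) * Q $ i $ l) = y l"
proof -
  have "(\<Sum>i\<in>UNIV. (\<Sum>k\<in>UNIV. GQ i k * y k) * Q $ i $ l) = (\<Sum>i\<in>UNIV. \<Sum>k\<in>UNIV. y k * (GQ i k * Q $ i $ l))"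
    by (simp add: sum_distrib_left sum_distrib_right mult_ac)
  also have "\<dots> = (\<Sum>k\<in>UNIV. y k * (\<Sum>i\<in>UNIV. GQ i k * Q $ i $ l))"
    by (subst sum.swap) (simp add: sum_distrib_left)
  also have "\<dots> = y l" by (simp add: frame1 if_distrib[of "\<lambda>x. _ * x"] cong: if_cong)
  finally show ?thesis .
qed

lemma lower_frame: "(\<Sum>a\<in>UNIV. gc i a * (\<Sum>k\<in>UNIV. Q $ a $ k * y k)) = (\<Sum>k\<in>UNIV. GQ i k * y k)"
proof -
  have "(\<Sum>a\<in>UNIV. gc i a * (\<Sum>k\<in>UNIV. Q $ a $ k * y k)) = (\<Sum>a\<in>UNIV. \<Sum>k\<in>UNIV. gc i a * Q $ a $ k * y k)"
    by (simp add: sum_distrib_left mult.assoc)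
  also have "\<dots> = (\<Sum>k\<in>UNIV. GQ i k * y k)"
    by (subst sum.swap) (simp add: GQ_def sum_distrib_right)
  finally show ?thesis .
qed

lemma frame_complete: "(\<Sum>l\<in>UNIV. Q $ s $ l * (\<Sum>r\<in>UNIV. GQ r l * y r)) = y s"
proof -
  have "(\<Sum>l\<in>UNIV. Q $ s $ l * (\<Sum>r\<in>UNIV. GQ r l * y r)) = (\<Sum>l\<in>UNIV. \<Sum>r\<in>UNIV. y r * (GQ r l * Q $ s $ l))"
    by (simp add: sum_distrib_left mult_ac)
  also have "\<dots> = (\<Sum>r\<in>UNIV. y r * (\<Sum>l\<in>UNIV. GQ r l * Q $ s $ l))"
    by (subst sum.swap) (simp add: sum_distrib_left)
  also have "\<dots> = y s" by (simp add: frame2 if_distrib[of "\<lambda>x. _ * x"] cong: if_cong)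
  finally show ?thesis .
qed

text \<open>The condition on \<open>u \<bullet> v\<close> is open, so the identity principle
  applies. It provides the nonzero divisors in the arguments at generic points.\<close>

lemma eq_0_on_frame_points:
  assumes "\<And>x p u v. u \<bullet> v \<noteq> 0 \<Longrightarrow> poly_eval (frame_point x p u v) f = 0"
  shows "f = 0"
proof -
  define U where "U = {frame_point x p u v | x p u v. u \<bullet> v \<noteq> 0}"
  have U_I: "frame_point x p u v \<in> U" if "u \<bullet> v \<noteq> 0" for x p u v
    using that unfolding U_def by blast
  \<comment> \<open>\<open>b k\<close> is the direction in which the point moves with the k-th
    coordinate, and \<open>c\<close> is the inverse matrix, in which \<open>Q\<close> and
    \<open>GQ\<close> trade places.\<close>
  define b :: "('n + 'n) + ('n + 'n) \<Rightarrow> ('n + 'n) + ('n + 'n) \<Rightarrow> complex" where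
    "b = case_sum (case_sum (\<lambda>k v. if v = Inl (Inl k) then 1 else 0)
        (\<lambda>k. case_sum (case_sum (\<lambda>_. 0) (\<lambda>i. GQ i k)) (\<lambda>_. 0)))
      (case_sum (\<lambda>k v. if v = Inr (Inl k) then 1 else 0)
        (\<lambda>k. case_sum (\<lambda>_. 0) (case_sum (\<lambda>_. 0) (\<lambda>i. Q $ i $ k))))"
  define c :: "('n + 'n) + ('n + 'n) \<Rightarrow> ('n + 'n) + ('n + 'n) \<Rightarrow> complex" where
    "c = case_sum (case_sum (\<lambda>k v. if v = Inl (Inl k) then 1 else 0)
        (\<lambda>i. case_sum (case_sum (\<lambda>_. 0) (\<lambda>k. Q $ i $ k)) (\<lambda>_. 0)))
      (case_sum (\<lambda>k v. if v = Inr (Inl k) then 1 else 0)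
        (\<lambda>i. case_sum (\<lambda>_. 0) (case_sum (\<lambda>_. 0) (\<lambda>k. GQ i k))))"
  have split: "(\<Sum>k\<in>UNIV. h k) = (\<Sum>i\<in>UNIV. h (Inl (Inl i))) + (\<Sum>i\<in>UNIV. h (Inl (Inr i)))
      + (\<Sum>i\<in>UNIV. h (Inr (Inl i))) + (\<Sum>i\<in>UNIV. h (Inr (Inr i)))"
    for h :: "('n + 'n) + ('n + 'n) \<Rightarrow> complex"
    by (simp add: sum.Plus UNIV_Plus_UNIV[symmetric] del: UNIV_Plus_UNIV)
  show ?thesis
  proof (rule poly_eval_eq_0_imp_eq_0[of U b c])
    have "frame_point (\<lambda>_. 0) (\<lambda>_. 0) (axis undefined 1) (axis undefined 1) \<in> U"
      unfolding U_def by (auto simp: inner_axis_axis intro!: exI)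
    then show "U \<noteq> {}" by blast
  next
    fix z and k :: "('n + 'n) + ('n + 'n)" assume "z \<in> U"
    then obtain x p u v where z: "z = frame_point x p u v" and uv: "u \<bullet> v \<noteq> 0"
      unfolding U_def by blast
    have cont: "\<forall>\<^sub>F t in at (0::real). u \<bullet> v + t * r \<noteq> 0" for r
    proof -
      have "((\<lambda>t. u \<bullet> v + t * r) \<longlongrightarrow> u \<bullet> v + 0 * r) (at (0::real))"
        by (intro tendsto_intros)
      then show ?thesis using uv by (simp add: tendsto_imp_eventually_ne)
    qed
    consider (x) i where "k = Inl (Inl i)" | (xi) i where "k = Inl (Inr i)"
      | (p) i where "k = Inr (Inl i)" | (eta) i where "k = Inr (Inr i)"
      by (metis obj_sumE)
    then show "\<forall>\<^sub>F t in at (0::real). (\<lambda>w. z w + of_real t * b k w) \<in> U"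
    proof cases
      case x
      have "(\<lambda>w. z w + of_real t * b k w) = frame_point (\<lambda>j. x j + (if j = i then of_real t else 0)) p u v" for t :: real
        by (auto simp: fun_eq_iff z x b_def frame_point_def split: sum.splits)
      then show ?thesis using uv by (intro always_eventually) (auto simp: U_def)
    next
      case p
      have "(\<lambda>w. z w + of_real t * b k w) = frame_point x (\<lambda>j. p j + (if j = i then of_real t else 0)) u v" for t :: real
        by (auto simp: fun_eq_iff z p b_def frame_point_def split: sum.splits)
      then show ?thesis using uv by (intro always_eventually) (auto simp: U_def)
    next
      case xi
      have eq: "(\<lambda>w. z w + of_real t * b k w) = frame_point x p (u + t *\<^sub>R axis i 1) v" for t :: real
        by (auto simp: fun_eq_iff z xi b_def frame_point_def axis_def distrib_left sum.distrib mult_ac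
            if_distrib[of of_real] if_distrib[of "\<lambda>x. _ * x"] cong: if_cong split: sum.splits)
      show ?thesis
        unfolding eq using cont[of "axis i 1 \<bullet> v"] by eventually_elim (simp add: U_I inner_add_left del: inner_axis')
    next
      case eta
      have eq: "(\<lambda>w. z w + of_real t * b k w) = frame_point x p u (v + t *\<^sub>R axis i 1)" for t :: real
        by (auto simp: fun_eq_iff z eta b_def frame_point_def axis_def distrib_left sum.distrib mult_ac
            if_distrib[of of_real] if_distrib[of "\<lambda>x. _ * x"] cong: if_cong split: sum.splits)
      show ?thesis
        unfolding eq using cont[of "u \<bullet> axis i 1"] by eventually_elim (simp add: U_I inner_add_right del: inner_axis)
    qed
  next
    fix u v
    have frame1': "(\<Sum>k\<in>UNIV. Q $ l $ k * GQ i k) = (if l = i then 1 else 0)" for i l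
      using frame2[of i l] by (simp add: mult.commute eq_commute[of i])
    show "(\<Sum>k\<in>UNIV. c u k * b k v) = (if u = v then 1 else 0)"
      unfolding split
      by (cases u; cases v; rename_tac u' v', case_tac u'; case_tac v')
        (auto simp: b_def c_def frame1' frame2 if_distrib[of "\<lambda>x. _ * x"] if_distrib[of "\<lambda>x. x * _"] cong: if_cong)
  qed (use assms in \<open>auto simp: U_def\<close>)
qed

text \<open>The part of top degree in \<open>\<eta>\<close> of the commutator with an inversion, at the origin.\<close>

lemma inv_field_leading_equation:
  fixes A :: "'n operator"
  assumes a: "has_symbol a A" and comm: "\<And>f. A (Lie_op \<delta> (inv_field g i) f) = Lie_op \<delta> (inv_field g i) (A f)"
    and top: "\<And>s k. k > N \<Longrightarrow> hcomp eta_wt k (dxi (Inl s) a) = 0"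
    and z: "\<And>j. z (Inl (Inl j)) = 0"
  defines "V \<equiv> (\<lambda>s. poly_eval z (hcomp eta_wt N (dxi (Inl s) a)))"
    and "Xi \<equiv> (\<lambda>s. z (Inl (Inr s)))" and "Et \<equiv> (\<lambda>s. z (Inr (Inr s)))"
  shows "(\<Sum>b\<in>UNIV. \<Sum>s\<in>UNIV. gc i b * (Et b * Xi s * V s)) + (\<Sum>s\<in>UNIV. \<Sum>b\<in>UNIV. gc i s * (Et b * Xi b * V s))
    = (\<Sum>b\<in>UNIV. \<Sum>s\<in>UNIV. gc b s * (Et b * Xi i * V s))"
proof -
  \<comment> \<open>The value at \<open>z\<close> of the part of degree N + 1 in \<eta> of the
    symbol. It is linear in the operator, so both sides of the commutation can be evaluated term by
    term, and by uniqueness of symbols the results agree.\<close>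
  define val :: "'n operator \<Rightarrow> complex \<Rightarrow> bool" where
    "val B c \<longleftrightarrow> (\<exists>b. has_symbol b B \<and> poly_eval z (hcomp eta_wt (Suc N) b) = c)" for B c
  have val_const: "val (\<lambda>f. const d * B f) (d * c)" if "val B c" for d B c
    using that has_symbol_const unfolding val_def by (fastforce simp: hcomp_const_mult)
  have val_add: "val (\<lambda>f. B f + C f) (c + d)" if "val B c" "val C d" for B C c d
    using that has_symbol_add unfolding val_def by (fastforce simp: hcomp_add)
  have val_diff: "val (\<lambda>f. B f - C f) (c - d)" if "val B c" "val C d" for B C c d
    using that has_symbol_diff unfolding val_def by (fastforce simp: hcomp_diff)
  have val_sum: "val (\<lambda>f. \<Sum>j\<in>UNIV. B j f) (\<Sum>j\<in>UNIV. c j)" if val: "\<And>j. val (B j) (c j)"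
    for B :: "'n \<Rightarrow> 'n operator" and c
  proof -
    from val obtain b where "\<And>j. has_symbol (b j) (B j)"
      and "\<And>j. poly_eval z (hcomp eta_wt (Suc N) (b j)) = c j" unfolding val_def by metis
    then show ?thesis
      unfolding val_def by (intro exI[of _ "\<Sum>j\<in>UNIV. b j"]) (auto simp: hcomp_sum intro: has_symbol_sum)
  qed
  note val_intros = val_const val_add val_diff val_sum
  let ?a1 = "\<lambda>s. xup (Inl s) * a + dxi (Inl s) a"
  have a1: "has_symbol (?a1 s) (\<lambda>f. A (xup s * f))" for s by (rule has_symbol_comp_var[OF a])
  have top': "hcomp eta_wt (Suc N) (dxi (Inl s) a) = 0" for s by (rule top) simp
  \<comment> \<open>At x = 0 the terms with a factor x vanish. There remains a second derivative in
    p, which by \<open>top\<close> has no part of degree N + 1.\<close>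
  have val1: "val (\<lambda>f. A (xup s * (xup t * dx u f))) 0" for s t u
    unfolding val_def
    by (rule exI, rule conjI, rule has_symbol_pd[OF has_symbol_comp_var[OF a1]])
      (simp add: hcomp_var_mult_0 hcomp_add hcomp_pd_0 pd_add pd_var_mult top' z)
  \<comment> \<open>Here \<partial>/\<partial>\<xi> supplies one factor \<eta>, so that the part of
    degree N of \<partial>a/\<partial>p enters in degree N + 1.\<close>
  have val2: "val (\<lambda>f. A (xup s * (xi t * dxi u f))) (Et u * Xi t * V s)" for s t u
    unfolding val_def
    by (rule exI, rule conjI, rule has_symbol_pd[OF has_symbol_comp_var[OF a1]])
      (simp add: hcomp_var_mult_0 hcomp_var_mult_1 hcomp_add hcomp_pd_1 pd_add pd_var_mult top' z
        V_def Xi_def Et_def)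
  have val3: "val (\<lambda>f. A (xup s * f)) 0" for s
    unfolding val_def
    by (rule exI, rule conjI, rule a1) (simp add: hcomp_var_mult_0 hcomp_add top' z)
  \<comment> \<open>Every term of the Lie derivative begins with multiplication by some x, so
    applied after \<open>A\<close> it contributes nothing at the origin.\<close>
  have val4: "val (\<lambda>f. xup s * B f) 0" if "has_symbol b B" for s b B
    unfolding val_def
    by (rule exI, rule conjI, rule has_symbol_var[OF that]) (simp add: hcomp_var_mult_0 z)
  have "val (\<lambda>f. A (Lie_op \<delta> (inv_field g i) f))
    ((\<Sum>s\<in>(UNIV::'n set). \<Sum>t\<in>(UNIV::'n set). gc s t * 0) - (\<Sum>s\<in>(UNIV::'n set). \<Sum>t\<in>(UNIV::'n set). (2 * gc i s) * 0)
    - (\<Sum>b\<in>(UNIV::'n set). \<Sum>s\<in>(UNIV::'n set). (2 * gc b s) * (Et b * Xi i * V s))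
    + (\<Sum>b\<in>(UNIV::'n set). \<Sum>k\<in>(UNIV::'n set). (2 * gc i b) * (Et b * Xi k * V k))
    + (\<Sum>s\<in>(UNIV::'n set). \<Sum>b\<in>(UNIV::'n set). (2 * gc i s) * (Et b * Xi b * V s))
    - (\<Sum>s\<in>(UNIV::'n set). (2 * of_nat CARD('n) * of_real \<delta> * gc i s) * 0))"
    unfolding Lie_op_inv_field has_symbol_op_add[OF a] has_symbol_op_diff[OF a] has_symbol_op_sum[OF a]
      has_symbol_op_const[OF a]
    by (intro val_intros val1 val2 val3)
  moreover have "val (\<lambda>f. Lie_op \<delta> (inv_field g i) (A f))
    ((\<Sum>s\<in>(UNIV::'n set). \<Sum>t\<in>(UNIV::'n set). gc s t * 0) - (\<Sum>s\<in>(UNIV::'n set). \<Sum>t\<in>(UNIV::'n set). (2 * gc i s) * 0)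
    - (\<Sum>b\<in>(UNIV::'n set). \<Sum>s\<in>(UNIV::'n set). (2 * gc b s) * 0)
    + (\<Sum>b\<in>(UNIV::'n set). \<Sum>k\<in>(UNIV::'n set). (2 * gc i b) * 0)
    + (\<Sum>s\<in>(UNIV::'n set). \<Sum>b\<in>(UNIV::'n set). (2 * gc i s) * 0)
    - (\<Sum>s\<in>(UNIV::'n set). (2 * of_nat CARD('n) * of_real \<delta> * gc i s) * 0))"
    unfolding Lie_op_inv_field
    by (rule val_diff val_add val_sum val_const val4 has_symbol_var has_symbol_pd_comp a)+
  moreover have "c = d" if "val B c" "val B d" for B c d
    using that has_symbol_unique unfolding val_def by blast
  ultimately have "- (\<Sum>b\<in>UNIV. \<Sum>s\<in>UNIV. (2 * gc b s) * (Et b * Xi i * V s))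
    + (\<Sum>b\<in>UNIV. \<Sum>k\<in>UNIV. (2 * gc i b) * (Et b * Xi k * V k))
    + (\<Sum>s\<in>UNIV. \<Sum>b\<in>UNIV. (2 * gc i s) * (Et b * Xi b * V s)) = 0"
    unfolding comm by fastforce
  then have "2 * ((\<Sum>b\<in>UNIV. \<Sum>s\<in>UNIV. gc i b * (Et b * Xi s * V s)) + (\<Sum>s\<in>UNIV. \<Sum>b\<in>UNIV. gc i s * (Et b * Xi b * V s)))
    = 2 * (\<Sum>b\<in>UNIV. \<Sum>s\<in>UNIV. gc b s * (Et b * Xi i * V s))"
    by (simp add: sum_distrib_left algebra_simps)
  then show ?thesis by (subst (asm) mult_cancel_left) simp
qed

lemma frame_pairing:
  "(\<Sum>i\<in>UNIV. (\<Sum>k\<in>UNIV. GQ i k * x k) * (\<Sum>k\<in>UNIV. Q $ i $ k * y k)) = (\<Sum>k\<in>UNIV. x k * y k)"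
proof -
  have "(\<Sum>i\<in>UNIV. (\<Sum>k\<in>UNIV. GQ i k * x k) * (\<Sum>l\<in>UNIV. Q $ i $ l * y l)) =
      (\<Sum>i\<in>UNIV. \<Sum>l\<in>UNIV. (\<Sum>k\<in>UNIV. GQ i k * x k) * Q $ i $ l * y l)"
    by (simp add: sum_distrib_left mult.assoc)
  also have "\<dots> = (\<Sum>l\<in>UNIV. (\<Sum>i\<in>UNIV. (\<Sum>k\<in>UNIV. GQ i k * x k) * Q $ i $ l) * y l)"
    by (subst sum.swap) (simp add: sum_distrib_right)
  finally show ?thesis by (simp add: frame_contract_Q)
qed

lemma of_real_inner: "of_real (u \<bullet> v) = (\<Sum>k\<in>UNIV. complex_of_real (u $ k) * of_real (v $ k))"
  by (simp add: inner_vec_def)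

lemma contract_lowered: "(\<Sum>i\<in>UNIV. (\<Sum>b\<in>UNIV. gc i b * y b) * Q $ i $ l) = (\<Sum>b\<in>UNIV. y b * GQ b l)"
proof -
  have "(\<Sum>i\<in>UNIV. (\<Sum>b\<in>UNIV. gc i b * y b) * Q $ i $ l) = (\<Sum>i\<in>UNIV. \<Sum>b\<in>UNIV. y b * (gc b i * Q $ i $ l))"
    by (simp add: sum_distrib_left sum_distrib_right gc_sym mult_ac)
  also have "\<dots> = (\<Sum>b\<in>UNIV. y b * GQ b l)"
    by (subst sum.swap) (simp add: GQ_def sum_distrib_left)
  finally show ?thesis .
qed

text \<open>In frame coordinates the system reads \<beta> v + c W = \<alpha> u with c = u \<bullet>
  v, \<alpha> = v \<bullet> W and \<beta> = u \<bullet> W. Pairing with \<open>v\<close> leaves (v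
  \<bullet> v) \<beta> = 0, then pairing with \<open>u\<close> leaves (u \<bullet> u) \<alpha> = 0,
  and so c W = 0.\<close>

lemma leading_equation_trivial:
  fixes u v :: "real^'n" and V :: "'n \<Rightarrow> complex"
  assumes uv: "u \<bullet> v \<noteq> 0"
    and Xi: "\<And>i. Xi i = (\<Sum>k\<in>UNIV. GQ i k * of_real (u $ k))"
    and Et: "\<And>i. Et i = (\<Sum>k\<in>UNIV. Q $ i $ k * of_real (v $ k))"
    and eq: "\<And>i. (\<Sum>b\<in>UNIV. \<Sum>s\<in>UNIV. gc i b * (Et b * Xi s * V s)) + (\<Sum>s\<in>UNIV. \<Sum>b\<in>UNIV. gc i s * (Et b * Xi b * V s))
      = (\<Sum>b\<in>UNIV. \<Sum>s\<in>UNIV. gc b s * (Et b * Xi i * V s))"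
  shows "V s = 0"
proof -
  define c where "c = complex_of_real (u \<bullet> v)"
  define \<alpha> where "\<alpha> = (\<Sum>b\<in>UNIV. \<Sum>s\<in>UNIV. gc b s * (Et b * V s))"
  define \<beta> where "\<beta> = (\<Sum>s\<in>UNIV. Xi s * V s)"
  define W where "W l = (\<Sum>r\<in>UNIV. V r * GQ r l)" for l
  have c: "(\<Sum>b\<in>UNIV. Et b * Xi b) = c"
    using frame_pairing[of "\<lambda>k. of_real (u $ k)" "\<lambda>k. of_real (v $ k)"]
    by (simp add: Xi Et c_def of_real_inner mult.commute)
  have low: "(\<Sum>b\<in>UNIV. gc i b * Et b) = (\<Sum>k\<in>UNIV. GQ i k * of_real (v $ k))" for i
    unfolding Et by (rule lower_frame)
  have \<alpha>: "\<alpha> = (\<Sum>k\<in>UNIV. of_real (v $ k) * W k)"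
  proof -
    have "\<alpha> = (\<Sum>s\<in>UNIV. (\<Sum>b\<in>UNIV. gc s b * Et b) * V s)"
      unfolding \<alpha>_def by (subst sum.swap) (simp add: sum_distrib_left sum_distrib_right gc_sym mult_ac)
    also have "\<dots> = (\<Sum>s\<in>UNIV. \<Sum>k\<in>UNIV. of_real (v $ k) * (V s * GQ s k))"
      unfolding low by (simp add: sum_distrib_left sum_distrib_right mult_ac)
    finally show ?thesis by (subst (asm) sum.swap) (simp add: W_def sum_distrib_left)
  qed
  have \<beta>: "\<beta> = (\<Sum>k\<in>UNIV. of_real (u $ k) * W k)"
  proof -
    have "\<beta> = (\<Sum>s\<in>UNIV. \<Sum>k\<in>UNIV. of_real (u $ k) * (V s * GQ s k))"
      unfolding \<beta>_def Xi by (simp add: sum_distrib_left sum_distrib_right mult_ac)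
    then show ?thesis by (subst (asm) sum.swap) (simp add: W_def sum_distrib_left)
  qed
  have eq1: "(\<Sum>k\<in>UNIV. GQ i k * of_real (v $ k)) * \<beta> + (\<Sum>s\<in>UNIV. gc i s * V s) * c = Xi i * \<alpha>" for i
  proof -
    have "(\<Sum>b\<in>UNIV. \<Sum>s\<in>UNIV. gc i b * (Et b * Xi s * V s)) = (\<Sum>b\<in>UNIV. gc i b * Et b) * \<beta>"
      by (simp add: \<beta>_def sum_distrib_left sum_distrib_right mult_ac)
    moreover have "(\<Sum>s\<in>UNIV. \<Sum>b\<in>UNIV. gc i s * (Et b * Xi b * V s)) = (\<Sum>s\<in>UNIV. gc i s * V s) * c"
      unfolding c[symmetric] by (simp add: sum_distrib_left sum_distrib_right mult_ac)
    moreover have "(\<Sum>b\<in>UNIV. \<Sum>s\<in>UNIV. gc b s * (Et b * Xi i * V s)) = Xi i * \<alpha>"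
      by (simp add: \<alpha>_def sum_distrib_left mult_ac)
    ultimately show ?thesis using eq[of i] by (simp add: low)
  qed
  have split: "(\<Sum>i\<in>UNIV. (x i * \<beta> + y i * c) * Q $ i $ l) =
      (\<Sum>i\<in>UNIV. x i * Q $ i $ l) * \<beta> + (\<Sum>i\<in>UNIV. y i * Q $ i $ l) * c" for x y l
    by (simp add: sum_distrib_left sum.distrib algebra_simps)
  have eq2: "of_real (v $ l) * \<beta> + W l * c = of_real (u $ l) * \<alpha>" for l
  proof -
    have "(\<Sum>i\<in>UNIV. ((\<Sum>k\<in>UNIV. GQ i k * of_real (v $ k)) * \<beta> + (\<Sum>s\<in>UNIV. gc i s * V s) * c) * Q $ i $ l) =
        (\<Sum>i\<in>UNIV. Xi i * \<alpha> * Q $ i $ l)"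
      by (simp only: eq1)
    then have "(\<Sum>i\<in>UNIV. (\<Sum>k\<in>UNIV. GQ i k * of_real (v $ k)) * Q $ i $ l) * \<beta> +
        (\<Sum>i\<in>UNIV. (\<Sum>s\<in>UNIV. gc i s * V s) * Q $ i $ l) * c = (\<Sum>i\<in>UNIV. Xi i * Q $ i $ l) * \<alpha>"
      by (simp only: split) (simp add: sum_distrib_left mult_ac)
    then show ?thesis
      unfolding Xi frame_contract_Q contract_lowered W_def by simp
  qed
  have pair: "(\<Sum>l\<in>UNIV. x l * of_real (v $ l)) * \<beta> + (\<Sum>l\<in>UNIV. x l * W l) * c = (\<Sum>l\<in>UNIV. x l * of_real (u $ l)) * \<alpha>" for x
  proof -
    have "(\<Sum>l\<in>UNIV. x l * (of_real (v $ l) * \<beta> + W l * c)) = (\<Sum>l\<in>UNIV. x l * (of_real (u $ l) * \<alpha>))"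
      by (simp only: eq2)
    then show ?thesis by (simp add: distrib_left sum.distrib sum_distrib_right mult.assoc)
  qed
  have "of_real (v \<bullet> v) * \<beta> + \<alpha> * c = c * \<alpha>"
    using pair[of "\<lambda>l. of_real (v $ l)"] unfolding \<alpha>[symmetric] of_real_inner[symmetric]
    by (simp add: c_def inner_commute)
  then have "\<beta> = 0" using uv by auto
  have "c * \<beta> + \<beta> * c = of_real (u \<bullet> u) * \<alpha>"
    using pair[of "\<lambda>l. of_real (u $ l)"] unfolding \<beta>[symmetric] of_real_inner[symmetric]
    by (simp add: c_def)
  with \<open>\<beta> = 0\<close> have "\<alpha> = 0" using uv by auto
  have "W l = 0" for l
    using eq2[of l] \<open>\<alpha> = 0\<close> \<open>\<beta> = 0\<close> uv by (simp add: c_def)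
  then show ?thesis using frame_complete[of s V] by (simp add: W_def mult.commute)
qed

lemma frame_point_cong:
  assumes "\<And>j. dx (Inl j) f = 0" and "p = p' \<or> (\<forall>j. dxi (Inl j) f = 0)"
  shows "poly_eval (frame_point x p u v) f = poly_eval (frame_point x' p' u v) f"
proof (rule poly_eval_cong)
  fix m c assume m: "m \<in> Poly_Mapping.keys f" "Poly_Mapping.lookup m c \<noteq> 0"
  show "frame_point x p u v c = frame_point x' p' u v c"
  proof (cases c)
    case (Inl d)
    with m pd_eq_0_keys[OF assms(1) m(1)] show ?thesis by (cases d) auto
  next
    case (Inr d)
    have "Poly_Mapping.lookup m (Inr (Inl j)) = 0" if "p \<noteq> p'" for j
      using that assms(2) pd_eq_0_keys[OF _ m(1)] by blast
    with Inr m show ?thesis by (cases "p = p'"; cases d) auto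
  qed
qed

text \<open>The leading equation couples the derivatives in all the p_s, so \<open>N\<close> is the
  largest \<eta>-degree occurring in any of them. Their parts of degree \<open>N\<close> vanish,
  against the choice of \<open>N\<close>. The equation is known at x = 0 only, which suffices
  because the symbol is free of x.\<close>

lemma symbol_p_free:
  fixes A :: "'n operator"
  assumes a: "has_symbol a A"
    and comm: "\<And>i f. A (Lie_op \<delta> (inv_field g i) f) = Lie_op \<delta> (inv_field g i) (A f)"
    and x_free: "\<And>j. dx (Inl j) a = 0"
  shows "dxi (Inl s) a = 0"
proof (rule ccontr)
  assume nz: "dxi (Inl s) a \<noteq> 0"
  define M where "M = {k. \<exists>s. hcomp eta_wt k (dxi (Inl s) a) \<noteq> 0}"
  have "M \<subseteq> (\<Union>s. wt eta_wt ` Poly_Mapping.keys (dxi (Inl s) a))"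
  proof
    fix k assume "k \<in> M"
    then obtain s where "hcomp eta_wt k (dxi (Inl s) a) \<noteq> 0" unfolding M_def by blast
    then have "\<exists>m\<in>Poly_Mapping.keys (dxi (Inl s) a). wt eta_wt m = k"
      by (metis hcomp_eq_0)
    then show "k \<in> (\<Union>s. wt eta_wt ` Poly_Mapping.keys (dxi (Inl s) a))" by auto
  qed
  moreover have "finite (\<Union>s::'n. wt eta_wt ` Poly_Mapping.keys (dxi (Inl s) a))" by simp
  ultimately have "finite M" by (rule finite_subset)
  have "M \<noteq> {}"
  proof -
    obtain m where "m \<in> Poly_Mapping.keys (dxi (Inl s) a)" using nz by fastforce
    then have "m \<in> Poly_Mapping.keys (hcomp eta_wt (wt eta_wt m) (dxi (Inl s) a))" by (simp add: keys_hcomp)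
    then have "hcomp eta_wt (wt eta_wt m) (dxi (Inl s) a) \<noteq> 0" by auto
    then show ?thesis unfolding M_def by blast
  qed
  define N where "N = Max M"
  have top: "hcomp eta_wt k (dxi (Inl s) a) = 0" if "k > N" for s k
    using that Max_ge[OF \<open>finite M\<close>, of k] unfolding N_def M_def by fastforce
  have "hcomp eta_wt N (dxi (Inl s) a) = 0" for s
  proof (rule eq_0_on_frame_points)
    fix x p and u v :: "real^'n" assume uv: "u \<bullet> v \<noteq> 0"
    let ?z = "frame_point (\<lambda>_. 0) p u v"
    let ?q = "\<lambda>s. hcomp eta_wt N (dxi (Inl s) a)"
    have "dx (Inl j) (?q s) = 0" for j
    proof -
      have "dx (Inl j) (?q s) = hcomp eta_wt N (dxi (Inl s) (dx (Inl j) a))"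
        by (simp add: pd_commute[of "Inr (Inl s)"] flip: hcomp_pd_0)
      then show ?thesis by (simp add: x_free)
    qed
    then have "poly_eval (frame_point x p u v) (?q s) = poly_eval ?z (?q s)"
      by (intro frame_point_cong) simp_all
    also have "\<dots> = 0"
    proof (rule leading_equation_trivial[OF uv, of "\<lambda>i. ?z (Inl (Inr i))" "\<lambda>i. ?z (Inr (Inr i))"])
      fix i
      show "(\<Sum>b\<in>UNIV. \<Sum>s\<in>UNIV. gc i b * (?z (Inr (Inr b)) * ?z (Inl (Inr s)) * poly_eval ?z (?q s))) +
          (\<Sum>s\<in>UNIV. \<Sum>b\<in>UNIV. gc i s * (?z (Inr (Inr b)) * ?z (Inl (Inr b)) * poly_eval ?z (?q s))) =
          (\<Sum>b\<in>UNIV. \<Sum>s\<in>UNIV. gc b s * (?z (Inr (Inr b)) * ?z (Inl (Inr i)) * poly_eval ?z (?q s)))"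
        by (rule inv_field_leading_equation[OF a comm top]) simp_all
    qed simp_all
    finally show "poly_eval (frame_point x p u v) (?q s) = 0" .
  qed
  then have "N \<notin> M" unfolding M_def by blast
  with Max_in[OF \<open>finite M\<close> \<open>M \<noteq> {}\<close>] show False unfolding N_def by blast
qed

text \<open>Since \<open>a\<close> involves neither x nor p, the comparison of symbols says that the
  Euler operators in \<eta> and in \<xi> agree on \<open>a\<close>. Both are diagonal on monomials,
  so the two degrees agree for each monomial.\<close>

lemma symbol_euler:
  fixes A :: "'n operator"
  assumes a: "has_symbol a A"
    and comm: "\<And>f. A (Lie_op \<delta> euler_field f) = Lie_op \<delta> euler_field (A f)"
    and x_free: "\<And>j. dx (Inl j) a = 0" and p_free: "\<And>j. dxi (Inl j) a = 0"
    and m: "m \<in> Poly_Mapping.keys a"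
  shows "wt xi_wt m = wt eta_wt m"
proof -
  note lin = has_symbol_op_add[OF a] has_symbol_op_diff[OF a] has_symbol_op_sum[OF a] has_symbol_op_const[OF a]
  have "has_symbol ((\<Sum>k\<in>UNIV. xi (Inl k) * (xup (Inl k) * a + dxi (Inl k) a))
      - (\<Sum>k\<in>UNIV. xi (Inr k) * (xup (Inr k) * a + dxi (Inr k) a))
      + const (of_nat CARD('n) * of_real \<delta>) * a) (\<lambda>f. A (Lie_op \<delta> euler_field f))"
    unfolding Lie_op_euler_field lin
    by (intro has_symbol_add has_symbol_diff has_symbol_sum has_symbol_const has_symbol_pd
        has_symbol_comp_var a)
  moreover have "has_symbol ((\<Sum>k\<in>UNIV. xup (Inl k) * (xi (Inl k) * a + dx (Inl k) a))
      - (\<Sum>k\<in>UNIV. xup (Inr k) * (xi (Inr k) * a + dx (Inr k) a))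
      + const (of_nat CARD('n) * of_real \<delta>) * a) (\<lambda>f. Lie_op \<delta> euler_field (A f))"
    unfolding Lie_op_euler_field
    by (intro has_symbol_add has_symbol_diff has_symbol_sum has_symbol_const has_symbol_var
        has_symbol_pd_comp a)
  ultimately have "(\<Sum>k\<in>UNIV. xi (Inl k) * (xup (Inl k) * a))
      - (\<Sum>k\<in>UNIV. xi (Inr k) * (xup (Inr k) * a + dxi (Inr k) a)) + const (of_nat CARD('n) * of_real \<delta>) * a
    = (\<Sum>k\<in>UNIV. xup (Inl k) * (xi (Inl k) * a))
      - (\<Sum>k\<in>UNIV. xup (Inr k) * (xi (Inr k) * a + dx (Inr k) a)) + const (of_nat CARD('n) * of_real \<delta>) * a"
    unfolding comm x_free p_free add_0_right by (rule has_symbol_unique)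
  then have "(\<Sum>k\<in>UNIV. xi (Inr k) * dxi (Inr k) a) = (\<Sum>k\<in>UNIV. xup (Inr k) * dx (Inr k) a)"
    by (simp add: distrib_left sum.distrib mult.left_commute[of "xup _"])
  from arg_cong[where f = "\<lambda>b. Poly_Mapping.lookup b m", OF this]
  have "of_nat (\<Sum>k\<in>UNIV. Poly_Mapping.lookup m (Inr (Inr k))) * Poly_Mapping.lookup a m =
      of_nat (\<Sum>k\<in>UNIV. Poly_Mapping.lookup m (Inl (Inr k))) * Poly_Mapping.lookup a m"
    by (simp add: lookup_sum lookup_var_pd sum_distrib_right)
  then have eq: "(\<Sum>k\<in>UNIV. Poly_Mapping.lookup m (Inr (Inr k))) = (\<Sum>k\<in>UNIV. Poly_Mapping.lookup m (Inl (Inr k)))"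
    using m by (simp add: in_keys_iff del: of_nat_sum)
  have "wt xi_wt m = (\<Sum>k\<in>UNIV. Poly_Mapping.lookup m (Inl (Inr k)))"
    "wt eta_wt m = (\<Sum>k\<in>UNIV. Poly_Mapping.lookup m (Inr (Inr k)))"
    by (simp_all add: wt_def xi_wt_def eta_wt_def sum.Plus UNIV_Plus_UNIV[symmetric] del: UNIV_Plus_UNIV)
  with eq show ?thesis by simp
qed

text \<open>Infinitesimal invariance: up to sign, the difference of the two sides is the action on
  \<open>a\<close> of the rotation generator with indices \<open>i\<close> and \<open>j\<close>, on
  \<xi> and \<eta> together.\<close>

definition rot_invariant :: "('n + 'n) phase_poly \<Rightarrow> bool" where
  "rot_invariant a \<longleftrightarrow> (\<forall>i j.
    (\<Sum>b\<in>UNIV. const (gc i b) * (xi (Inr b) * dxi (Inr j) a - xup (Inr j) * dx (Inr b) a)) =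
    (\<Sum>b\<in>UNIV. const (gc j b) * (xi (Inr b) * dxi (Inr i) a - xup (Inr i) * dx (Inr b) a)))"

lemma symbol_rot_invariant:
  fixes A :: "'n operator"
  assumes a: "has_symbol a A"
    and comm: "\<And>i j f. A (Lie_op \<delta> (rot_field g i j) f) = Lie_op \<delta> (rot_field g i j) (A f)"
    and x_free: "\<And>j. dx (Inl j) a = 0" and p_free: "\<And>j. dxi (Inl j) a = 0"
  shows "rot_invariant a"
  unfolding rot_invariant_def
proof (intro allI)
  fix i j
  note lin = has_symbol_op_add[OF a] has_symbol_op_diff[OF a] has_symbol_op_sum[OF a] has_symbol_op_const[OF a]
  have "has_symbol ((\<Sum>s\<in>UNIV. const (gc i s) * (xi (Inl j) * (xup (Inl s) * a + dxi (Inl s) a)))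
      - (\<Sum>s\<in>UNIV. const (gc j s) * (xi (Inl i) * (xup (Inl s) * a + dxi (Inl s) a)))
      - (\<Sum>b\<in>UNIV. const (gc i b) * (xi (Inr b) * (xup (Inr j) * a + dxi (Inr j) a)))
      + (\<Sum>b\<in>UNIV. const (gc j b) * (xi (Inr b) * (xup (Inr i) * a + dxi (Inr i) a))))
    (\<lambda>f. A (Lie_op \<delta> (rot_field g i j) f))"
    unfolding Lie_op_rot_field lin
    by (intro has_symbol_add has_symbol_diff has_symbol_sum has_symbol_const has_symbol_pd
        has_symbol_comp_var a)
  moreover have "has_symbol ((\<Sum>s\<in>UNIV. const (gc i s) * (xup (Inl s) * (xi (Inl j) * a + dx (Inl j) a)))
      - (\<Sum>s\<in>UNIV. const (gc j s) * (xup (Inl s) * (xi (Inl i) * a + dx (Inl i) a)))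
      - (\<Sum>b\<in>UNIV. const (gc i b) * (xup (Inr j) * (xi (Inr b) * a + dx (Inr b) a)))
      + (\<Sum>b\<in>UNIV. const (gc j b) * (xup (Inr i) * (xi (Inr b) * a + dx (Inr b) a))))
    (\<lambda>f. Lie_op \<delta> (rot_field g i j) (A f))"
    unfolding Lie_op_rot_field
    by (intro has_symbol_add has_symbol_diff has_symbol_sum has_symbol_const has_symbol_var
        has_symbol_pd_comp a)
  ultimately have eq: "(\<Sum>s\<in>UNIV. const (gc i s) * (xi (Inl j) * (xup (Inl s) * a)))
      - (\<Sum>s\<in>UNIV. const (gc j s) * (xi (Inl i) * (xup (Inl s) * a)))
      - (\<Sum>b\<in>UNIV. const (gc i b) * (xi (Inr b) * (xup (Inr j) * a + dxi (Inr j) a)))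
      + (\<Sum>b\<in>UNIV. const (gc j b) * (xi (Inr b) * (xup (Inr i) * a + dxi (Inr i) a)))
    = (\<Sum>s\<in>UNIV. const (gc i s) * (xup (Inl s) * (xi (Inl j) * a)))
      - (\<Sum>s\<in>UNIV. const (gc j s) * (xup (Inl s) * (xi (Inl i) * a)))
      - (\<Sum>b\<in>UNIV. const (gc i b) * (xup (Inr j) * (xi (Inr b) * a + dx (Inr b) a)))
      + (\<Sum>b\<in>UNIV. const (gc j b) * (xup (Inr i) * (xi (Inr b) * a + dx (Inr b) a)))"
    unfolding comm x_free p_free add_0_right by (rule has_symbol_unique)
  then show "(\<Sum>b\<in>UNIV. const (gc i b) * (xi (Inr b) * dxi (Inr j) a - xup (Inr j) * dx (Inr b) a)) =
    (\<Sum>b\<in>UNIV. const (gc j b) * (xi (Inr b) * dxi (Inr i) a - xup (Inr i) * dx (Inr b) a))"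
    by (simp add: distrib_left right_diff_distrib sum.distrib sum_subtractf mult.left_commute[of "xup _"])
      (simp add: algebra_simps)
qed

lemma rot_invariant_hcomp:
  assumes "rot_invariant a"
  shows "rot_invariant (hcomp eta_wt d a)"
  unfolding rot_invariant_def
proof (intro allI)
  fix i j
  have "hcomp eta_wt d (\<Sum>b\<in>UNIV. const (gc i b) * (xi (Inr b) * dxi (Inr j) a - xup (Inr j) * dx (Inr b) a)) =
    (\<Sum>b\<in>UNIV. const (gc i b) * (xi (Inr b) * dxi (Inr j) (hcomp eta_wt d a) - xup (Inr j) * dx (Inr b) (hcomp eta_wt d a)))" for i j
    by (simp add: hcomp_sum hcomp_const_mult hcomp_diff hcomp_euler)
  from this[of i j] this[of j i] assms[unfolded rot_invariant_def, rule_format, of i j]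
  show "(\<Sum>b\<in>UNIV. const (gc i b) * (xi (Inr b) * dxi (Inr j) (hcomp eta_wt d a) - xup (Inr j) * dx (Inr b) (hcomp eta_wt d a))) =
    (\<Sum>b\<in>UNIV. const (gc j b) * (xi (Inr b) * dxi (Inr i) (hcomp eta_wt d a) - xup (Inr i) * dx (Inr b) (hcomp eta_wt d a)))"
    by simp
qed

text \<open>By the chain rule \<open>M l\<close> and \<open>N l\<close> are the derivatives in the
  coordinates u_l and v_l. The conclusion is thus invariance under the compact algebra so(n),
  although the given rotations are those of \<open>g\<close>.\<close>

lemma rot_invariant_frame:
  assumes inv: "rot_invariant f"
    and z: "z = frame_point x p u v"
  defines "M \<equiv> (\<lambda>l. \<Sum>i\<in>UNIV. poly_eval z (dx (Inr i) f) * GQ i l)"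
    and "N \<equiv> (\<lambda>l. \<Sum>i\<in>UNIV. poly_eval z (dxi (Inr i) f) * Q $ i $ l)"
  shows "of_real (v $ k) * N l + of_real (u $ k) * M l = of_real (v $ l) * N k + of_real (u $ l) * M k"
proof -
  define m where "m i = poly_eval z (dx (Inr i) f)" for i
  define n where "n i = poly_eval z (dxi (Inr i) f)" for i
  define X where "X i = (\<Sum>k\<in>UNIV. GQ i k * of_real (u $ k))" for i
  define P where "P i = (\<Sum>k\<in>UNIV. GQ i k * of_real (v $ k))" for i
  define G where "G i = (\<Sum>b\<in>UNIV. gc i b * m b)" for i
  define Y where "Y b = (\<Sum>k\<in>UNIV. Q $ b $ k * of_real (v $ k))" for b
  have zX: "z (Inl (Inr j)) = X j" and zY: "z (Inr (Inr j)) = Y j" for j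
    by (simp_all add: z X_def Y_def)
  have eq: "P i * n j - X j * G i = P j * n i - X i * G j" for i j
  proof -
    have *: "poly_eval z (\<Sum>b\<in>UNIV. const (gc i b) * (xi (Inr b) * dxi (Inr j) f - xup (Inr j) * dx (Inr b) f)) =
        P i * n j - X j * G i" for i j
    proof -
      have "poly_eval z (\<Sum>b\<in>UNIV. const (gc i b) * (xi (Inr b) * dxi (Inr j) f - xup (Inr j) * dx (Inr b) f)) =
          (\<Sum>b\<in>UNIV. gc i b * Y b) * n j - X j * G i"
        by (simp add: zX zY G_def right_diff_distrib sum_subtractf sum_distrib_left sum_distrib_right mult_ac
            flip: m_def n_def)
      then show ?thesis unfolding Y_def lower_frame P_def .
    qed
    show ?thesis
      using arg_cong[where f = "poly_eval z", OF inv[unfolded rot_invariant_def, rule_format, of i j]]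
      unfolding * .
  qed
  have cP: "(\<Sum>i\<in>UNIV. P i * Q $ i $ l) = of_real (v $ l)" for l
    unfolding P_def by (rule frame_contract_Q)
  have cX: "(\<Sum>i\<in>UNIV. X i * Q $ i $ l) = of_real (u $ l)" for l
    unfolding X_def by (rule frame_contract_Q)
  have cG: "(\<Sum>i\<in>UNIV. G i * Q $ i $ l) = M l" for l
    unfolding G_def contract_lowered M_def m_def ..
  have cN: "(\<Sum>i\<in>UNIV. n i * Q $ i $ l) = N l" for l
    unfolding N_def n_def ..
  have prod: "(\<Sum>i\<in>UNIV. \<Sum>j\<in>UNIV. y i * w j * (Q $ i $ k * Q $ j $ l)) =
      (\<Sum>i\<in>UNIV. y i * Q $ i $ k) * (\<Sum>j\<in>UNIV. w j * Q $ j $ l)" for y w k l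
    unfolding sum_product by (simp add: mult_ac)
  have prod': "(\<Sum>i\<in>UNIV. \<Sum>j\<in>UNIV. w j * y i * (Q $ i $ k * Q $ j $ l)) =
      (\<Sum>i\<in>UNIV. y i * Q $ i $ k) * (\<Sum>j\<in>UNIV. w j * Q $ j $ l)" for y w k l
    unfolding sum_product by (simp add: mult_ac)
  have "(\<Sum>i\<in>UNIV. \<Sum>j\<in>UNIV. (P i * n j - X j * G i) * (Q $ i $ k * Q $ j $ l)) =
      (\<Sum>i\<in>UNIV. \<Sum>j\<in>UNIV. (P j * n i - X i * G j) * (Q $ i $ k * Q $ j $ l))"
    by (simp only: eq)
  then have "of_real (v $ k) * N l - M k * of_real (u $ l) = N k * of_real (v $ l) - of_real (u $ k) * M l"
    unfolding left_diff_distrib sum_subtractf prod prod' cP cX cG cN .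
  then show ?thesis by (simp add: algebra_simps)
qed

text \<open>The derivative in \<theta> is the contraction of the symmetric \<open>S\<close> with the
  antisymmetric e_k w_l - w_k e_l, hence zero. This integrates the infinitesimal invariance to
  finite rotations.\<close>

lemma rot_invariant_plane_rot:
  fixes e w u v :: "real^'n"
  assumes inv: "rot_invariant f"
    and orth: "e \<bullet> e = 1" "w \<bullet> w = 1" "e \<bullet> w = 0"
  shows "poly_eval (frame_point x p (plane_rot e w \<theta> u) (plane_rot e w \<theta> v)) f = poly_eval (frame_point x p u v) f"
proof -
  let ?R = "plane_rot e w"
  define D where "D \<theta> y = (e \<bullet> ?R \<theta> y) *\<^sub>R w - (w \<bullet> ?R \<theta> y) *\<^sub>R e" for \<theta> y
  let ?z = "\<lambda>\<theta>. frame_point x p (?R \<theta> u) (?R \<theta> v)"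
  let ?z' = "\<lambda>\<theta>. frame_point (\<lambda>_. 0) (\<lambda>_. 0) (D \<theta> u) (D \<theta> v)"
  have lin: "((\<lambda>\<theta>. \<Sum>k\<in>UNIV. c k * of_real (?R \<theta> y $ k)) has_vector_derivative
      (\<Sum>k\<in>UNIV. c k * of_real (D \<theta> y $ k))) (at \<theta>)" for c :: "'n \<Rightarrow> complex" and y \<theta>
  proof -
    have "bounded_linear (\<lambda>y::real^'n. \<Sum>k\<in>UNIV. c k * of_real (y $ k))"
      unfolding linear_conv_bounded_linear[symmetric]
      by (rule linearI) (simp_all add: distrib_left sum.distrib scaleR_conv_of_real[where 'a = complex] sum_distrib_left mult_ac)
    from bounded_linear.has_vector_derivative[OF this plane_rot_has_vector_derivative[OF orth]]
    show ?thesis unfolding D_def .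
  qed
  have "((\<lambda>\<theta>. poly_eval (?z \<theta>) f) has_vector_derivative 0) (at \<theta> within UNIV)" for \<theta>
  proof -
    have "((\<lambda>\<theta>. ?z \<theta> c) has_vector_derivative ?z' \<theta> c) (at \<theta>)" for c
      by (cases c; rename_tac c', case_tac c') (auto simp: lin)
    from poly_eval_has_vector_derivative[of ?z, OF this, of f]
    have "((\<lambda>\<theta>. poly_eval (?z \<theta>) f) has_vector_derivative
        (\<Sum>c\<in>UNIV. poly_eval (?z \<theta>) (pd c f) * ?z' \<theta> c)) (at \<theta>)" .
    moreover have "(\<Sum>c\<in>UNIV. poly_eval (?z \<theta>) (pd c f) * ?z' \<theta> c) = 0"
    proof -
      define U where "U = ?R \<theta> u"
      define V where "V = ?R \<theta> v"
      define M where "M l = (\<Sum>i\<in>UNIV. poly_eval (?z \<theta>) (dx (Inr i) f) * GQ i l)" for l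
      define N where "N l = (\<Sum>i\<in>UNIV. poly_eval (?z \<theta>) (dxi (Inr i) f) * Q $ i $ l)" for l
      define S where "S k l = of_real (V $ k) * N l + of_real (U $ k) * M l" for k l
      have sym: "S k l = S l k" for k l
        unfolding S_def U_def V_def M_def N_def by (rule rot_invariant_frame[OF inv refl])
      have D: "of_real (D \<theta> y $ l) = (\<Sum>k\<in>UNIV. complex_of_real (?R \<theta> y $ k) * of_real (e $ k * w $ l - w $ k * e $ l))" for y l
        unfolding D_def by (simp add: inner_vec_def sum_distrib_right sum_distrib_left sum_subtractf algebra_simps)
      have "(\<Sum>c\<in>UNIV. poly_eval (?z \<theta>) (pd c f) * ?z' \<theta> c) =
          (\<Sum>i\<in>UNIV. poly_eval (?z \<theta>) (dx (Inr i) f) * (\<Sum>l\<in>UNIV. GQ i l * of_real (D \<theta> u $ l)))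
        + (\<Sum>i\<in>UNIV. poly_eval (?z \<theta>) (dxi (Inr i) f) * (\<Sum>l\<in>UNIV. Q $ i $ l * of_real (D \<theta> v $ l)))"
        by (simp add: sum.Plus UNIV_Plus_UNIV[symmetric] del: UNIV_Plus_UNIV)
      also have "(\<Sum>i\<in>UNIV. poly_eval (?z \<theta>) (dx (Inr i) f) * (\<Sum>l\<in>UNIV. GQ i l * of_real (D \<theta> u $ l))) =
          (\<Sum>l\<in>UNIV. M l * of_real (D \<theta> u $ l))"
        unfolding M_def sum_distrib_left sum_distrib_right by (subst sum.swap) (simp add: mult_ac)
      also have "(\<Sum>i\<in>UNIV. poly_eval (?z \<theta>) (dxi (Inr i) f) * (\<Sum>l\<in>UNIV. Q $ i $ l * of_real (D \<theta> v $ l))) =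
          (\<Sum>l\<in>UNIV. N l * of_real (D \<theta> v $ l))"
        unfolding N_def sum_distrib_left sum_distrib_right by (subst sum.swap) (simp add: mult_ac)
      also have "(\<Sum>l\<in>UNIV. M l * of_real (D \<theta> u $ l)) + (\<Sum>l\<in>UNIV. N l * of_real (D \<theta> v $ l)) =
          (\<Sum>l\<in>UNIV. \<Sum>k\<in>UNIV. S k l * of_real (e $ k * w $ l - w $ k * e $ l))"
        unfolding D S_def U_def V_def sum_distrib_left sum.distrib[symmetric]
        by (intro sum.cong refl) (simp add: algebra_simps)
      also have "\<dots> = (\<Sum>l\<in>UNIV. \<Sum>k\<in>UNIV. S k l * of_real (e $ k * w $ l)) - (\<Sum>l\<in>UNIV. \<Sum>k\<in>UNIV. S k l * of_real (w $ k * e $ l))"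
        by (simp add: right_diff_distrib sum_subtractf)
      also have "(\<Sum>l\<in>UNIV. \<Sum>k\<in>UNIV. S k l * of_real (w $ k * e $ l)) = (\<Sum>l\<in>UNIV. \<Sum>k\<in>UNIV. S k l * of_real (e $ k * w $ l))"
        by (subst sum.swap) (simp add: sym mult.commute)
      finally show ?thesis by simp
    qed
    ultimately show ?thesis by simp
  qed
  then obtain c where "poly_eval (?z \<theta>) f = c" for \<theta>
    using has_vector_derivative_zero_constant[of UNIV "\<lambda>\<theta>. poly_eval (?z \<theta>) f"] by auto
  then have "poly_eval (?z \<theta>) f = poly_eval (?z 0) f" by simp
  then show ?thesis by (simp add: plane_rot_def)
qed

end

section \<open>The first fundamental theorem in bidegree \<open>(d, d)\<close>\<close>

text \<open>Only variables of positive weight move along the line, so the weight of a monomial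
  bounds its degree in the parameter.\<close>

lemma poly_eval_line:
  fixes f :: "'n::finite phase_poly" and \<alpha> \<beta> :: "'n + 'n \<Rightarrow> complex"
  assumes "\<And>m. m \<in> Poly_Mapping.keys f \<Longrightarrow> wt w m \<le> d" and "\<And>v. w v = 0 \<Longrightarrow> \<beta> v = 0"
  obtains H where "degree H \<le> d" and "\<And>r. poly_eval (\<lambda>v. \<alpha> v + r * \<beta> v) f = poly H r"
proof
  let ?mon = "\<lambda>m. \<Prod>v\<in>UNIV. [:\<alpha> v, \<beta> v:] ^ Poly_Mapping.lookup m v"
  let ?H = "\<Sum>m\<in>Poly_Mapping.keys f. Polynomial.smult (Poly_Mapping.lookup f m) (?mon m)"
  show "poly_eval (\<lambda>v. \<alpha> v + r * \<beta> v) f = poly ?H r" for r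
    by (simp add: poly_eval_def poly_sum poly_prod)
  show "degree ?H \<le> d"
  proof (rule degree_sum_le)
    fix m assume m: "m \<in> Poly_Mapping.keys f"
    have "degree (?mon m) \<le> (\<Sum>v\<in>UNIV. degree ([:\<alpha> v, \<beta> v:] ^ Poly_Mapping.lookup m v))"
      using degree_prod_sum_le[of UNIV "\<lambda>v. [:\<alpha> v, \<beta> v:] ^ Poly_Mapping.lookup m v"] by (simp add: o_def)
    also have "\<dots> \<le> (\<Sum>v\<in>UNIV. w v * Poly_Mapping.lookup m v)"
    proof (rule sum_mono)
      fix v
      have "degree [:\<alpha> v, \<beta> v:] \<le> w v" using assms(2)[of v] by (cases "w v = 0") auto
      then show "degree ([:\<alpha> v, \<beta> v:] ^ Poly_Mapping.lookup m v) \<le> w v * Poly_Mapping.lookup m v"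
        using degree_power_le[of "[:\<alpha> v, \<beta> v:]" "Poly_Mapping.lookup m v"] by (meson le_trans mult_le_mono1)
    qed
    also have "\<dots> \<le> d" using assms(1)[OF m] by (simp add: wt_def)
    finally show "degree (Polynomial.smult (Poly_Mapping.lookup f m) (?mon m)) \<le> d"
      using degree_smult_le le_trans by blast
  qed simp
qed

lemma poly_eval_scale:
  assumes "\<And>m. m \<in> Poly_Mapping.keys f \<Longrightarrow> (\<Prod>v\<in>UNIV. c v ^ Poly_Mapping.lookup m v) = K"
  shows "poly_eval (\<lambda>v. c v * z v) f = K * poly_eval z f"
  unfolding poly_eval_def sum_distrib_left
  by (intro sum.cong refl) (simp add: power_mult_distrib prod.distrib assms mult_ac)

context conf_frame
begin

text \<open>By the canonical form and bihomogeneity, F u v = (s t)^d H(r / t) for a single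
  polynomial H(r) = F e1 (e1 + r e2) of degree at most d. This is the sum of h_i (s t)^(d-i) (s
  r)^i, where r may have either sign, so the odd powers drop out and \<gamma> c is the coefficient
  of H in degree 2 c. The condition on \<open>u \<bullet> v\<close> makes t nonzero.\<close>

lemma frame_value:
  assumes inv: "rot_invariant f"
    and x_free: "\<And>j. dx (Inl j) f = 0" and p_free: "\<And>j. dxi (Inl j) f = 0"
    and deg: "\<And>m. m \<in> Poly_Mapping.keys f \<Longrightarrow> wt xi_wt m = d \<and> wt eta_wt m = d"
  obtains \<gamma> where "\<And>x p u v. u \<bullet> v \<noteq> 0 \<Longrightarrow> poly_eval (frame_point x p u v) f =
    (\<Sum>c\<in>{..d div 2}. \<gamma> c * of_real (u \<bullet> v) ^ (d - 2 * c) * of_real ((u \<bullet> u) * (v \<bullet> v) - (u \<bullet> v)\<^sup>2) ^ c)"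
proof -
  have dim': "3 \<le> DIM(real^'n)" using dim by simp
  obtain e1 :: "real^'n" where e1: "e1 \<bullet> e1 = 1" using ex_unit_orthogonal[OF dim'] by metis
  obtain e2 :: "real^'n" where e2: "e2 \<bullet> e2 = 1" and e12: "e1 \<bullet> e2 = 0"
    using ex_unit_orthogonal[OF dim', of e1 e1] by (metis inner_commute)
  define F where "F u v = poly_eval (frame_point (\<lambda>_. 0) (\<lambda>_. 0) u v) f" for u v
  have canon: "F u v = F (norm u *\<^sub>R e1) (((u \<bullet> v) / norm u) *\<^sub>R e1 + r *\<^sub>R e2)"
    if "u \<noteq> 0" "r\<^sup>2 = v \<bullet> v - (u \<bullet> v)\<^sup>2 / (u \<bullet> u)" for u v r
    by (rule rotation_invariant_canonical[OF dim' _ e1 e2 e12 that])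
      (simp add: F_def rot_invariant_plane_rot[OF inv])
  have scale: "F (s *\<^sub>R u) (t *\<^sub>R v) = of_real s ^ d * of_real t ^ d * F u v" for s t u v
  proof -
    let ?c = "case_sum (case_sum (\<lambda>_. 1) (\<lambda>_. of_real s)) (case_sum (\<lambda>_. 1) (\<lambda>_. complex_of_real t)) :: ('n + 'n) + ('n + 'n) \<Rightarrow> complex"
    have "(\<lambda>c. ?c c * frame_point (\<lambda>_. 0) (\<lambda>_. 0) u v c) = frame_point (\<lambda>_. 0) (\<lambda>_. 0) (s *\<^sub>R u) (t *\<^sub>R v)"
      by (auto simp: fun_eq_iff frame_point_def sum_distrib_left mult_ac split: sum.splits)
    moreover have "poly_eval (\<lambda>c. ?c c * frame_point (\<lambda>_. 0) (\<lambda>_. 0) u v c) f =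
        of_real s ^ d * of_real t ^ d * poly_eval (frame_point (\<lambda>_. 0) (\<lambda>_. 0) u v) f"
    proof (rule poly_eval_scale)
      fix m assume m: "m \<in> Poly_Mapping.keys f"
      have "(\<Prod>v\<in>UNIV. ?c v ^ Poly_Mapping.lookup m v) = (\<Prod>i\<in>UNIV. complex_of_real s ^ Poly_Mapping.lookup m (Inl (Inr i)))
          * (\<Prod>i\<in>UNIV. complex_of_real t ^ Poly_Mapping.lookup m (Inr (Inr i)))"
        by (simp add: prod.Plus UNIV_Plus_UNIV[symmetric] del: UNIV_Plus_UNIV)
      also have "\<dots> = of_real s ^ wt xi_wt m * of_real t ^ wt eta_wt m"
        by (simp add: wt_def xi_wt_def eta_wt_def power_sum sum.Plus UNIV_Plus_UNIV[symmetric] del: UNIV_Plus_UNIV)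
      finally show "(\<Prod>v\<in>UNIV. ?c v ^ Poly_Mapping.lookup m v) = of_real s ^ d * of_real t ^ d"
        using deg[OF m] by simp
    qed
    ultimately show ?thesis unfolding F_def by simp
  qed
  obtain H where degH: "degree H \<le> d" and H: "\<And>r. F e1 (e1 + r *\<^sub>R e2) = poly H (of_real r)"
  proof -
    let ?\<alpha> = "frame_point (\<lambda>_. 0) (\<lambda>_. 0) e1 e1"
    let ?\<beta> = "frame_point (\<lambda>_. 0) (\<lambda>_. 0) 0 e2"
    obtain H where "degree H \<le> d" and H: "\<And>r. poly_eval (\<lambda>v. ?\<alpha> v + r * ?\<beta> v) f = poly H r"
      by (rule poly_eval_line[of f eta_wt d ?\<beta> ?\<alpha>])
        (use deg in \<open>auto simp: frame_point_def eta_wt_def split: sum.splits\<close>)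
    moreover have eq: "(\<lambda>v. ?\<alpha> v + of_real r * ?\<beta> v) = frame_point (\<lambda>_. 0) (\<lambda>_. 0) e1 (e1 + r *\<^sub>R e2)" for r
      by (auto simp: fun_eq_iff frame_point_def sum.distrib sum_distrib_left algebra_simps split: sum.splits)
    ultimately show thesis
      using that[of H] H[of "of_real _"] unfolding F_def eq by blast
  qed
  have "poly_eval (frame_point x p u v) f =
    (\<Sum>c\<in>{..d div 2}. coeff H (2 * c) * of_real (u \<bullet> v) ^ (d - 2 * c) * of_real ((u \<bullet> u) * (v \<bullet> v) - (u \<bullet> v)\<^sup>2) ^ c)"
    if uv: "u \<bullet> v \<noteq> 0" for x p u v
  proof -
    have "u \<noteq> 0" using uv by auto
    define s where "s = norm u"
    define t where "t = (u \<bullet> v) / norm u"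
    define r where "r = sqrt (v \<bullet> v - (u \<bullet> v)\<^sup>2 / (u \<bullet> u))"
    have "s \<noteq> 0" "t \<noteq> 0" using \<open>u \<noteq> 0\<close> uv by (simp_all add: s_def t_def)
    have st: "s * t = u \<bullet> v" using \<open>u \<noteq> 0\<close> by (simp add: s_def t_def)
    have ss: "s\<^sup>2 = u \<bullet> u" by (simp add: s_def power2_norm_eq_inner)
    have "(u \<bullet> v)\<^sup>2 / (u \<bullet> u) \<le> v \<bullet> v"
      using Cauchy_Schwarz_ineq[of u v] \<open>u \<noteq> 0\<close> by (simp add: divide_le_eq mult.commute)
    then have rr: "r\<^sup>2 = v \<bullet> v - (u \<bullet> v)\<^sup>2 / (u \<bullet> u)" by (simp add: r_def)
    have sr: "(s * r)\<^sup>2 = (u \<bullet> u) * (v \<bullet> v) - (u \<bullet> v)\<^sup>2"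
      using \<open>u \<noteq> 0\<close> by (simp add: power_mult_distrib ss rr field_simps)
    have val: "F u v = (\<Sum>i\<le>d. coeff H i * of_real (s * t) ^ (d - i) * of_real (s * r') ^ i)"
      if "r'\<^sup>2 = v \<bullet> v - (u \<bullet> v)\<^sup>2 / (u \<bullet> u)" for r'
    proof -
      have "F u v = F (s *\<^sub>R e1) (t *\<^sub>R (e1 + (r' / t) *\<^sub>R e2))"
        using canon[OF \<open>u \<noteq> 0\<close> that] \<open>t \<noteq> 0\<close> by (simp add: s_def t_def scaleR_add_right)
      also have "\<dots> = of_real s ^ d * of_real t ^ d * (\<Sum>i\<le>d. coeff H i * of_real (r' / t) ^ i)"
        unfolding scale H poly_altdef
        by (intro arg_cong2[where f = "(*)"] refl sum.mono_neutral_left) (use degH in \<open>auto simp: coeff_eq_0\<close>)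
      also have "\<dots> = (\<Sum>i\<le>d. coeff H i * of_real (s * t) ^ (d - i) * of_real (s * r') ^ i)"
        unfolding sum_distrib_left
      proof (rule sum.cong[OF refl])
        fix i assume "i \<in> {..d}"
        then have "of_real s ^ d = of_real s ^ (d - i) * (of_real s ^ i :: complex)"
          "of_real t ^ d = of_real t ^ (d - i) * (of_real t ^ i :: complex)"
          by (simp_all flip: power_add)
        then show "of_real s ^ d * of_real t ^ d * (coeff H i * of_real (r' / t) ^ i) =
            coeff H i * of_real (s * t) ^ (d - i) * of_real (s * r') ^ i"
          using \<open>t \<noteq> 0\<close> by (simp add: power_mult_distrib power_divide)
      qed
      finally show ?thesis .
    qed
    \<comment> \<open>Averaging over the sign of \<open>r\<close> removes the odd powers.\<close>
    have val': "F u v = (\<Sum>i\<le>d. coeff H i * of_real (s * t) ^ (d - i) * of_real (s * (- r)) ^ i)"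
      by (rule val) (simp add: rr)
    have "F u v = (F u v + F u v) / 2" by simp
    also have "\<dots> = ((\<Sum>i\<le>d. coeff H i * of_real (s * t) ^ (d - i) * of_real (s * r) ^ i) +
        (\<Sum>i\<le>d. coeff H i * of_real (s * t) ^ (d - i) * of_real (s * (- r)) ^ i)) / 2"
      by (simp only: val[OF rr, symmetric] val'[symmetric])
    also have "\<dots> = (\<Sum>i\<le>d. coeff H i * of_real (s * t) ^ (d - i) * ((of_real (s * r) ^ i + of_real (s * (- r)) ^ i) / 2))"
      unfolding sum.distrib[symmetric] sum_divide_distrib by (intro sum.cong refl) (simp add: distrib_left)
    also have "\<dots> = (\<Sum>i\<le>d. if even i then coeff H i * of_real (s * t) ^ (d - i) * of_real (s * r) ^ i else 0)"
      by (intro sum.cong refl) (auto simp: power_mult_distrib)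
    also have "\<dots> = (\<Sum>i\<in>{i. i \<le> d \<and> even i}. coeff H i * of_real (s * t) ^ (d - i) * of_real (s * r) ^ i)"
      by (simp add: sum.If_cases) (intro sum.cong, auto)
    also have "\<dots> = (\<Sum>c\<in>{..d div 2}. coeff H (2 * c) * of_real (s * t) ^ (d - 2 * c) * of_real (s * r) ^ (2 * c))"
      by (rule sum.reindex_bij_witness[of _ "\<lambda>c. 2 * c" "\<lambda>i. i div 2"]) auto
    also have "\<dots> = (\<Sum>c\<in>{..d div 2}. coeff H (2 * c) * of_real (u \<bullet> v) ^ (d - 2 * c) * of_real ((u \<bullet> u) * (v \<bullet> v) - (u \<bullet> v)\<^sup>2) ^ c)"
      unfolding st sr[symmetric] of_real_power power_mult ..
    finally have "F u v = \<dots>" .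
    moreover have "poly_eval (frame_point x p u v) f = F u v"
      unfolding F_def by (rule frame_point_cong) (use x_free p_free in auto)
    ultimately show ?thesis by simp
  qed
  then show thesis by (rule that)
qed

text \<open>The symbol of \<open>E_op\<close> without its constant term. The next two are the
  symbols of multiplication by \<open>RR\<close> and of \<open>T_op g\<close>.\<close>

definition sym_cc :: "('n + 'n) phase_poly" where
  "sym_cc = (\<Sum>i\<in>UNIV. xup (Inr i) * xi (Inr i))"

definition sym_R :: "('n + 'n) phase_poly" where
  "sym_R = (\<Sum>i\<in>UNIV. \<Sum>j\<in>UNIV. const (hc i j) * (xup (Inr j) * xup (Inr i)))"

definition sym_T :: "('n + 'n) phase_poly" where
  "sym_T = (\<Sum>i\<in>UNIV. \<Sum>j\<in>UNIV. const (gc i j) * (xi (Inr j) * xi (Inr i)))"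

lemma eval_sym_cc: "poly_eval (frame_point x p u v) sym_cc = of_real (u \<bullet> v)"
  by (simp add: sym_cc_def frame_pairing of_real_inner)

lemma eval_sym_T: "poly_eval (frame_point x p u v) sym_T = of_real (v \<bullet> v)"
proof -
  let ?y = "\<lambda>i. \<Sum>k\<in>UNIV. Q $ i $ k * complex_of_real (v $ k)"
  have "poly_eval (frame_point x p u v) sym_T = (\<Sum>i\<in>UNIV. (\<Sum>j\<in>UNIV. gc i j * ?y j) * ?y i)"
    by (simp add: sym_T_def sum_distrib_right mult.assoc)
  then show ?thesis by (simp add: lower_frame frame_pairing of_real_inner)
qed

lemma eval_sym_R: "poly_eval (frame_point x p u v) sym_R = of_real (u \<bullet> u)"
proof -
  let ?y = "\<lambda>i. \<Sum>k\<in>UNIV. GQ i k * complex_of_real (u $ k)"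
  have "(\<Sum>j\<in>UNIV. hc i j * y j) = (\<Sum>k\<in>UNIV. Q $ i $ k * (\<Sum>j\<in>UNIV. y j * Q $ j $ k))" for i y
  proof -
    have "(\<Sum>j\<in>UNIV. hc i j * y j) = (\<Sum>j\<in>UNIV. \<Sum>k\<in>UNIV. Q $ i $ k * (y j * Q $ j $ k))"
      by (simp add: matrix_inv_frame sum_distrib_left sum_distrib_right mult_ac)
    then show ?thesis
      by (subst (asm) sum.swap) (simp add: sum_distrib_left)
  qed
  then have "(\<Sum>j\<in>UNIV. hc i j * ?y j) = (\<Sum>k\<in>UNIV. Q $ i $ k * of_real (u $ k))" for i
    by (simp only: frame_contract_Q)
  moreover have "poly_eval (frame_point x p u v) sym_R = (\<Sum>i\<in>UNIV. ?y i * (\<Sum>j\<in>UNIV. hc i j * ?y j))"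
    by (simp add: sym_R_def sum_distrib_left mult_ac)
  ultimately show ?thesis by (simp add: frame_pairing of_real_inner)
qed

lemma rot_invariant_eq:
  assumes "rot_invariant f"
    and x_free: "\<And>j. dx (Inl j) f = 0" and p_free: "\<And>j. dxi (Inl j) f = 0"
    and "\<And>m. m \<in> Poly_Mapping.keys f \<Longrightarrow> wt xi_wt m = d \<and> wt eta_wt m = d"
  obtains \<gamma> where "f = (\<Sum>c\<in>{..d div 2}. const (\<gamma> c) * (sym_cc ^ (d - 2 * c) * (sym_R * sym_T - sym_cc\<^sup>2) ^ c))"
proof -
  obtain \<gamma> where \<gamma>: "\<And>x p u v. u \<bullet> v \<noteq> 0 \<Longrightarrow> poly_eval (frame_point x p u v) f =
    (\<Sum>c\<in>{..d div 2}. \<gamma> c * of_real (u \<bullet> v) ^ (d - 2 * c) * of_real ((u \<bullet> u) * (v \<bullet> v) - (u \<bullet> v)\<^sup>2) ^ c)"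
    using frame_value[OF assms] by blast
  have "f - (\<Sum>c\<in>{..d div 2}. const (\<gamma> c) * (sym_cc ^ (d - 2 * c) * (sym_R * sym_T - sym_cc\<^sup>2) ^ c)) = 0"
    by (rule eq_0_on_frame_points) (simp add: \<gamma> eval_sym_cc eval_sym_R eval_sym_T mult.assoc)
  then show thesis using that by simp
qed

section \<open>Normal ordering in the algebra generated by E and R0\<close>

abbreviation "Alg \<equiv> op_subalgebra hull {E_op, R0_op g}"

lemma E_op_in_Alg: "E_op \<in> Alg" and R0_op_in_Alg: "R0_op g \<in> Alg"
  by (simp_all add: hull_inc)

text \<open>Moving R to the right costs 4 E for each T that it passes, and E passes T^i with a shift
  by 2 i. Altogether R T^(j+1) = T^j (R0 + \<alpha> E + \<beta>), where the recursion gives \<alpha>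
  = - 4 j and \<beta> = 4 j (j + 1). Multiplied by R^j, this writes R^(j+1) T^(j+1) as R^j T^j after
  an element of \<open>Alg\<close>.\<close>

lemma R_T_power_in_Alg: "(\<lambda>f. RR ^ j * (T_op g ^^ j) f) \<in> Alg"
proof (induction j)
  case 0
  then show ?case using op_subalgebra_id[OF op_subalgebra_hull] by simp
next
  case (Suc j)
  have RT: "RR * T_op g (T_op g f) = T_op g (RR * T_op g f) - const 4 * E_op (T_op g f)" for f
    by (simp add: T_op_RR_mult)
  have ET: "E_op ((T_op g ^^ j) f) = (T_op g ^^ j) (E_op f - const (2 * of_nat j) * f)" for f j
  proof (induction j arbitrary: f)
    case 0
    then show ?case by (simp add: const_simps)
  next
    case (Suc j)
    have "E_op ((T_op g ^^ Suc j) f) = T_op g (E_op ((T_op g ^^ j) f) - const 2 * (T_op g ^^ j) f)"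
      by (simp add: E_op_T_op)
    also have "\<dots> = T_op g ((T_op g ^^ j) (E_op f - const (2 * of_nat j) * f - const 2 * f))"
    proof -
      have diff: "(T_op g ^^ j) (f - h) = (T_op g ^^ j) f - (T_op g ^^ j) h" for f h
        by (induction j) (simp_all add: T_op_diff)
      have mult: "(T_op g ^^ j) (const c * h) = const c * (T_op g ^^ j) h" for c h
        by (induction j) (simp_all add: T_op_xi_free)
      show ?thesis unfolding Suc.IH by (simp only: diff mult)
    qed
    also have "E_op f - const (2 * of_nat j) * f - const 2 * f = E_op f - const (2 * of_nat (Suc j)) * f"
      by (simp add: const_simps algebra_simps)
    finally show ?case by simp
  qed
  have "\<exists>\<alpha> \<beta>. \<forall>f. RR * T_op g ((T_op g ^^ j) f) = (T_op g ^^ j) (R0_op g f + const \<alpha> * E_op f + const \<beta> * f)" for j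
  proof (induction j)
    case 0
    show ?case by (intro exI[of _ 0]) (simp add: const_simps R0_op_def R_op_RR)
  next
    case (Suc j)
    then obtain \<alpha> \<beta> where IH: "\<And>f. RR * T_op g ((T_op g ^^ j) f) = (T_op g ^^ j) (R0_op g f + const \<alpha> * E_op f + const \<beta> * f)"
      by blast
    have add: "(T_op g ^^ j) (f + h) = (T_op g ^^ j) f + (T_op g ^^ j) h" for f h j
      by (induction j) (simp_all add: T_op_add)
    have mult: "(T_op g ^^ j) (const c * h) = const c * (T_op g ^^ j) h" for c h j
      by (induction j) (simp_all add: T_op_xi_free)
    have "RR * T_op g ((T_op g ^^ Suc j) f) =
        (T_op g ^^ Suc j) (R0_op g f + const (\<alpha> - 4) * E_op f + const (\<beta> + 4 * (2 * of_nat (Suc j))) * f)" for f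
    proof -
      have "RR * T_op g ((T_op g ^^ Suc j) f) = T_op g (RR * T_op g ((T_op g ^^ j) f)) + const (- 4) * E_op ((T_op g ^^ Suc j) f)"
        using RT[of "(T_op g ^^ j) f"] by (simp add: const_simps)
      also have "\<dots> = (T_op g ^^ Suc j) (R0_op g f + const \<alpha> * E_op f + const \<beta> * f)
          + const (- 4) * (T_op g ^^ Suc j) (E_op f - const (2 * of_nat (Suc j)) * f)"
        unfolding ET IH by simp
      also have "\<dots> = (T_op g ^^ Suc j) (R0_op g f + const \<alpha> * E_op f + const \<beta> * f + const (- 4) * (E_op f - const (2 * of_nat (Suc j)) * f))"
        by (simp only: add mult)
      also have "R0_op g f + const \<alpha> * E_op f + const \<beta> * f + const (- 4) * (E_op f - const (2 * of_nat (Suc j)) * f) =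
          R0_op g f + const (\<alpha> - 4) * E_op f + const (\<beta> + 4 * (2 * of_nat (Suc j))) * f"
        by (simp add: const_simps const_numeral algebra_simps del: of_nat_Suc)
      finally show ?thesis .
    qed
    then show ?case by blast
  qed
  then obtain \<alpha> \<beta> where "\<And>f. RR * T_op g ((T_op g ^^ j) f) = (T_op g ^^ j) (R0_op g f + const \<alpha> * E_op f + const \<beta> * f)"
    by blast
  then have "(\<lambda>f. RR ^ Suc j * (T_op g ^^ Suc j) f) =
      (\<lambda>f. RR ^ j * (T_op g ^^ j) (R0_op g f + const \<alpha> * E_op f + const \<beta> * f))"
    by (simp add: mult.assoc mult.left_commute[of RR])
  moreover have "(\<lambda>f. R0_op g f + const \<alpha> * E_op f + const \<beta> * f) \<in> Alg"
    by (intro op_subalgebra_add[OF op_subalgebra_hull] op_subalgebra_const[OF op_subalgebra_hull]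
        op_subalgebra_id[OF op_subalgebra_hull] E_op_in_Alg R0_op_in_Alg)
  ultimately show ?case
    using op_subalgebra_comp[OF op_subalgebra_hull Suc.IH] by simp
qed

text \<open>All multiplications stand to the left of all derivatives, so the symbols multiply
  without correction: the new T is composed on the right of the previous operator and the new R on
  its left.\<close>

lemma has_symbol_R_T_power: "has_symbol (sym_R ^ j * sym_T ^ j) (\<lambda>f. RR ^ j * (T_op g ^^ j) f)"
proof (induction j)
  case 0
  then show ?case using has_symbol_id by simp
next
  case (Suc j)
  let ?A = "\<lambda>f. RR ^ j * (T_op g ^^ j) f"
  note lin = has_symbol_op_sum[OF Suc] has_symbol_op_const[OF Suc]
  have "has_symbol (\<Sum>i\<in>UNIV. \<Sum>k\<in>UNIV. const (gc i k) * (xi (Inr i) * (xi (Inr k) * (sym_R ^ j * sym_T ^ j))))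
      (\<lambda>f. ?A (\<Sum>i\<in>UNIV. \<Sum>k\<in>UNIV. const (gc i k) * dxi k (dxi i f)))"
    unfolding lin by (intro has_symbol_sum has_symbol_const has_symbol_pd Suc)
  then have T: "has_symbol (\<Sum>i\<in>UNIV. \<Sum>k\<in>UNIV. const (gc i k) * (xi (Inr i) * (xi (Inr k) * (sym_R ^ j * sym_T ^ j))))
      (\<lambda>f. ?A (T_op g f))"
    by (simp only: T_op_expand[symmetric])
  have "has_symbol (\<Sum>i\<in>UNIV. \<Sum>k\<in>UNIV. const (hc i k) * (xup (Inr k) * (xup (Inr i) *
      (\<Sum>i\<in>UNIV. \<Sum>k\<in>UNIV. const (gc i k) * (xi (Inr i) * (xi (Inr k) * (sym_R ^ j * sym_T ^ j)))))))
    (\<lambda>f. \<Sum>i\<in>UNIV. \<Sum>k\<in>UNIV. const (hc i k) * (xi k * (xi i * ?A (T_op g f))))"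
    by (intro has_symbol_sum has_symbol_const has_symbol_var T)
  then show ?case
  proof (rule has_symbol_eq)
    have T': "(\<Sum>i\<in>UNIV. \<Sum>k\<in>UNIV. const (gc i k) * (xi (Inr i) * (xi (Inr k) * b))) = sym_T * b" for b
      by (simp add: sym_T_def sum_distrib_left sum_distrib_right mult_ac)
    have R': "(\<Sum>i\<in>UNIV. \<Sum>k\<in>UNIV. const (hc i k) * (xup (Inr k) * (xup (Inr i) * b))) = sym_R * b" for b
      by (simp add: sym_R_def sum_distrib_left sum_distrib_right mult_ac)
    show "(\<Sum>i\<in>UNIV. \<Sum>k\<in>UNIV. const (hc i k) * (xup (Inr k) * (xup (Inr i) *
      (\<Sum>i\<in>UNIV. \<Sum>k\<in>UNIV. const (gc i k) * (xi (Inr i) * (xi (Inr k) * (sym_R ^ j * sym_T ^ j))))))) = sym_R ^ Suc j * sym_T ^ Suc j"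
      unfolding T' R' by (simp add: mult_ac)
    fix f
    have RR: "(\<Sum>i\<in>UNIV. \<Sum>k\<in>UNIV. const (hc i k) * (xi k * (xi i * h))) = RR * h" for h
      by (simp add: RR_def xi_up_def sum_distrib_left sum_distrib_right mult_ac)
    show "(\<Sum>i\<in>UNIV. \<Sum>k\<in>UNIV. const (hc i k) * (xi k * (xi i * ?A (T_op g f)))) = RR ^ Suc j * (T_op g ^^ Suc j) f"
      unfolding RR by (simp add: funpow_swap1 mult_ac)
  qed
qed

definition alg_symbols :: "('n + 'n) phase_poly set" where
  "alg_symbols = {a. \<exists>A\<in>Alg. has_symbol a A}"

lemma alg_symbols_add: "a \<in> alg_symbols \<Longrightarrow> b \<in> alg_symbols \<Longrightarrow> a + b \<in> alg_symbols"
  unfolding alg_symbols_def using op_subalgebra_add[OF op_subalgebra_hull] has_symbol_add by blast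

lemma alg_symbols_diff: "a \<in> alg_symbols \<Longrightarrow> b \<in> alg_symbols \<Longrightarrow> a - b \<in> alg_symbols"
  unfolding alg_symbols_def using op_subalgebra_diff[OF op_subalgebra_hull] has_symbol_diff by blast

lemma alg_symbols_const: "a \<in> alg_symbols \<Longrightarrow> const c * a \<in> alg_symbols"
  unfolding alg_symbols_def using op_subalgebra_const[OF op_subalgebra_hull] has_symbol_const by blast

lemma alg_symbols_sum: "(\<And>i. i \<in> I \<Longrightarrow> a i \<in> alg_symbols) \<Longrightarrow> sum a I \<in> alg_symbols"
proof (induction I rule: infinite_finite_induct)
  case (insert i I)
  then show ?case by (simp add: alg_symbols_add)
qed (use op_subalgebra_0[OF op_subalgebra_hull] has_symbol_0 in \<open>auto simp: alg_symbols_def\<close>)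

text \<open>Composition with \<open>E_op\<close> on the left multiplies a symbol by
  \<open>sym_cc\<close>, up to n / 2 times the symbol and its image under the Euler operator
  \<open>D\<close> in \<xi>. The symbol has degree i + 2 j in \<xi>, so both corrections are
  multiples of it and can be subtracted.\<close>

lemma sym_cc_power_in_alg_symbols: "sym_cc ^ i * (sym_R * sym_T) ^ j \<in> alg_symbols"
proof (induction i)
  case 0
  then show ?case
    using R_T_power_in_Alg has_symbol_R_T_power unfolding alg_symbols_def
    by (auto simp: power_mult_distrib)
next
  case (Suc i)
  let ?b = "sym_cc ^ i * (sym_R * sym_T) ^ j"
  define D where "D b = (\<Sum>k\<in>UNIV. xup (Inr k) * dx (Inr k) b)" for b :: "('n + 'n) phase_poly"
  have D_mult: "D (b * c) = D b * c + b * D c" for b c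
    by (simp add: D_def pd_mult distrib_left sum.distrib sum_distrib_left sum_distrib_right mult_ac)
  have D_power: "D b = const c * b \<Longrightarrow> D (b ^ k) = const (of_nat k * c) * b ^ k" for b c k
  proof (induction k)
    case 0
    then show ?case by (simp add: D_def const_simps)
  next
    case (Suc k)
    then show ?case by (simp add: D_mult const_simps algebra_simps)
  qed
  have D_xi: "D (xi v) = 0" and D_xup: "D (xup (Inr k)) = xup (Inr k)" and D_const: "D (const c) = 0" for v k c
    by (simp_all add: D_def pd_var if_distrib[of "\<lambda>x. _ * x"] cong: if_cong)
  have D_sum: "D (sum h I) = (\<Sum>i\<in>I. D (h i))" for h :: "'n \<Rightarrow> _" and I
    by (simp add: D_def pd_sum sum_distrib_left) (rule sum.swap)
  have "D sym_cc = const 1 * sym_cc"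
    by (simp add: sym_cc_def D_sum D_mult D_xi D_xup const_simps)
  moreover have "D (sym_R * sym_T) = const 2 * (sym_R * sym_T)"
  proof -
    have "D sym_T = 0" by (simp add: sym_T_def D_sum D_mult D_xi D_const)
    moreover have "D sym_R = const 2 * sym_R"
      by (simp add: sym_R_def D_sum D_mult D_xup D_const const_numeral sum_distrib_left mult_ac)
    ultimately show ?thesis by (simp add: D_mult mult.assoc)
  qed
  ultimately have D: "D ?b = const (of_nat i + 2 * of_nat j) * ?b"
    using D_power[of sym_cc 1 i] D_power[of "sym_R * sym_T" 2 j]
    by (simp add: D_mult const_simps algebra_simps)
  obtain A where A: "A \<in> Alg" "has_symbol ?b A" using Suc unfolding alg_symbols_def by blast
  have "has_symbol ((\<Sum>k\<in>UNIV. xup (Inr k) * (xi (Inr k) * ?b + dx (Inr k) ?b)) + const (of_nat CARD('n) / 2) * ?b)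
     (\<lambda>f. E_op (A f))"
    unfolding E_op_def
    by (intro has_symbol_add has_symbol_sum has_symbol_const has_symbol_var has_symbol_pd_comp A)
  moreover have "(\<lambda>f. E_op (A f)) \<in> Alg" by (rule op_subalgebra_comp[OF op_subalgebra_hull E_op_in_Alg A(1)])
  moreover have "(\<Sum>k\<in>UNIV. xup (Inr k) * (xi (Inr k) * ?b + dx (Inr k) ?b)) = sym_cc * ?b + D ?b"
    by (simp add: D_def sym_cc_def distrib_left sum.distrib sum_distrib_left sum_distrib_right mult_ac)
  ultimately have "sym_cc * ?b + D ?b + const (of_nat CARD('n) / 2) * ?b \<in> alg_symbols"
    unfolding alg_symbols_def by auto
  then have "(sym_cc * ?b + D ?b + const (of_nat CARD('n) / 2) * ?b) - D ?b - const (of_nat CARD('n) / 2) * ?b \<in> alg_symbols"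
    unfolding D by (intro alg_symbols_diff alg_symbols_const Suc)
  then show ?case by (simp add: mult.assoc)
qed

text \<open>The difference is the Gram determinant of \<xi> and \<eta>. Its factors are expanded one
  at a time, which raises \<open>i\<close> or \<open>j\<close>; hence both are arbitrary in the
  induction.\<close>

lemma sym_gram_in_alg_symbols:
  "sym_cc ^ i * ((sym_R * sym_T) ^ j * (sym_R * sym_T - sym_cc\<^sup>2) ^ c) \<in> alg_symbols"
proof (induction c arbitrary: i j)
  case 0
  then show ?case by (simp add: sym_cc_power_in_alg_symbols)
next
  case (Suc c)
  have "sym_cc ^ i * ((sym_R * sym_T) ^ j * (sym_R * sym_T - sym_cc\<^sup>2) ^ Suc c) =
      sym_cc ^ i * ((sym_R * sym_T) ^ Suc j * (sym_R * sym_T - sym_cc\<^sup>2) ^ c)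
      - sym_cc ^ (i + 2) * ((sym_R * sym_T) ^ j * (sym_R * sym_T - sym_cc\<^sup>2) ^ c)"
    by (simp add: algebra_simps power2_eq_square)
  then show ?case by (simp only: alg_symbols_diff[OF Suc Suc])
qed

text \<open>Each \<eta>-homogeneous part of the symbol inherits the invariances and is homogeneous
  in \<xi> of the same degree, so it is a polynomial in the basic invariants. Finitely many parts
  add up to the symbol of an element of \<open>Alg\<close>, and an operator is determined by its
  symbol.\<close>

lemma commutant_subset_hull: "commutant \<delta> (so_conf g) \<subseteq> Alg"
proof
  fix A assume A: "A \<in> commutant \<delta> (so_conf g)"
  then have "A \<in> End_diff" by (simp add: commutant_def)
  then obtain a where a: "has_symbol a A" by (rule End_diff_has_symbol)
  have comm: "A (Lie_op \<delta> X f) = Lie_op \<delta> X (A f)" if "X \<in> so_conf g" for X f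
    using A that unfolding commutant_def by (auto simp: fun_eq_iff)
  have gens: "coord_field i \<in> so_conf g" "rot_field g i j \<in> so_conf g" "euler_field \<in> so_conf g"
    "inv_field g i \<in> so_conf g" for i j
    unfolding so_conf_def by (auto intro: vf.span_base)
  have coord: "Lie_op \<delta> (coord_field i) f = dx i f" for i and f :: "'n phase_poly"
    by (subst Lie_op_xi_free[OF so_conf_xi_free(1)])
      (simp add: coord_field_nth if_distrib[of "pd _"] if_distrib[of "\<lambda>x. x * _"] cong: if_cong)
  have x_free: "dx (Inl j) a = 0" for j
    by (rule symbol_dx_eq_0[OF a]) (use comm[OF gens(1)] in \<open>simp add: coord\<close>)
  have p_free: "dxi (Inl j) a = 0" for j
    by (rule symbol_p_free[OF a comm[OF gens(4)] x_free])
  have deg: "wt xi_wt m = wt eta_wt m" if "m \<in> Poly_Mapping.keys a" for m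
    by (rule symbol_euler[OF a comm[OF gens(3)] x_free p_free that])
  have rot: "rot_invariant a"
    by (rule symbol_rot_invariant[OF a comm[OF gens(2)] x_free p_free])
  have "hcomp eta_wt d a \<in> alg_symbols" for d
  proof -
    obtain \<gamma> where "hcomp eta_wt d a =
        (\<Sum>c\<in>{..d div 2}. const (\<gamma> c) * (sym_cc ^ (d - 2 * c) * (sym_R * sym_T - sym_cc\<^sup>2) ^ c))"
    proof (rule rot_invariant_eq[OF rot_invariant_hcomp[OF rot]])
      show "dx (Inl j) (hcomp eta_wt d a) = 0" "dxi (Inl j) (hcomp eta_wt d a) = 0" for j
        by (simp_all add: x_free p_free flip: hcomp_pd_0)
    qed (use deg in \<open>auto simp: keys_hcomp\<close>)
    then show ?thesis
      using sym_gram_in_alg_symbols[of _ 0] by (simp add: alg_symbols_sum alg_symbols_const)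
  qed
  moreover obtain K where "\<And>m. m \<in> Poly_Mapping.keys a \<Longrightarrow> wt eta_wt m \<le> K" using wt_bounded by blast
  ultimately have "a \<in> alg_symbols" using alg_symbols_sum[of "{..K}" "\<lambda>d. hcomp eta_wt d a"] sum_hcomp[of a eta_wt K] by simp
  then show "A \<in> Alg" using has_symbol_op_unique[OF a] unfolding alg_symbols_def by blast
qed

text \<open>The centralizer of a subset of \<open>Alg\<close> is a subalgebra, since elements of
  \<open>Alg\<close> are linear. As the two generators commute, \<open>Alg\<close> lies in the
  centralizer of the generators; these therefore lie in the centralizer of \<open>Alg\<close>, and
  then so does \<open>Alg\<close> itself.\<close>

lemma Alg_commute:
  assumes "A \<in> Alg" and "B \<in> Alg"
  shows "A \<circ> B = B \<circ> A"
proof -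
  have linear: "B (f + h) = B f + B h" "B (const c * f) = const c * B f" if "B \<in> Alg" for B f h c
  proof -
    \<comment> \<open>Any value of \<delta> would do: the commutant only supplies membership in
      \<open>End_diff\<close>, and with it linearity.\<close>
    have "B \<in> End_diff" using that hull_subset_commutant[of 0] unfolding commutant_def by blast
    then obtain b where "has_symbol b B" by (rule End_diff_has_symbol)
    then show "B (f + h) = B f + B h" "B (const c * f) = const c * B f"
      by (rule has_symbol_op_add, rule has_symbol_op_const)
  qed
  have centralizer: "op_subalgebra {A. \<forall>B\<in>S. \<forall>f. A (B f) = B (A f)}" if "S \<subseteq> Alg" for S
    unfolding op_subalgebra_def
  proof (intro conjI ballI allI)
    fix A B c
    assume A: "A \<in> {A. \<forall>B\<in>S. \<forall>f. A (B f) = B (A f)}"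
    then show "(\<lambda>f. const c * A f) \<in> {A. \<forall>B\<in>S. \<forall>f. A (B f) = B (A f)}"
      using that by (simp add: linear subset_iff)
    assume B: "B \<in> {A. \<forall>B\<in>S. \<forall>f. A (B f) = B (A f)}"
    show "(\<lambda>f. A f + B f) \<in> {A. \<forall>B\<in>S. \<forall>f. A (B f) = B (A f)}"
      "A \<circ> B \<in> {A. \<forall>B\<in>S. \<forall>f. A (B f) = B (A f)}"
      using that A B by (simp_all add: linear subset_iff)
  qed simp
  have gens: "\<forall>C\<in>{E_op, R0_op g}. \<forall>f. A (C f) = C (A f)" if "A \<in> Alg" for A
  proof -
    have "Alg \<subseteq> {A. \<forall>B\<in>{E_op, R0_op g}. \<forall>f. A (B f) = B (A f)}"
    proof (rule hull_minimal)
      show "op_subalgebra {A. \<forall>B\<in>{E_op, R0_op g}. \<forall>f. A (B f) = B (A f)}"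
        by (rule centralizer) (simp add: E_op_in_Alg R0_op_in_Alg)
    qed (auto simp: E_op_R0_op)
    with that show ?thesis by blast
  qed
  have "Alg \<subseteq> {A. \<forall>B\<in>Alg. \<forall>f. A (B f) = B (A f)}"
  proof (rule hull_minimal)
    show "op_subalgebra {A. \<forall>B\<in>Alg. \<forall>f. A (B f) = B (A f)}" by (rule centralizer) simp
  qed (use gens in auto)
  with assms show ?thesis by (auto simp: fun_eq_iff)
qed

end

section \<open>Existence of the frame and conclusion\<close>

lemma has_signature_conf_frame:
  fixes g :: "real^'n::finite^'n"
  assumes sig: "has_signature g p q" and card: "3 \<le> CARD('n)"
  obtains Q where "conf_frame g Q"
proof -
  from sig obtain P :: "real^'n^'n" and \<epsilon> where sym: "transpose g = g"
    and \<epsilon>: "\<And>i. \<epsilon> i = 1 \<or> \<epsilon> i = -1"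
    and PgP: "transpose P ** g ** P = (\<chi> i j. if i = j then \<epsilon> i else 0)"
    unfolding has_signature_def by blast
  define D :: "real^'n^'n" where "D = (\<chi> i j. if i = j then \<epsilon> i else 0)"
  \<comment> \<open>\<open>c k\<close> is a complex square root of the sign \<epsilon> k. Rescaling
    the columns of \<open>P\<close> by it turns the Sylvester basis into an orthonormal one.\<close>
  define c where "c k = (if \<epsilon> k = 1 then 1 else \<i>)" for k
  define Q :: "complex^'n^'n" where "Q = (\<chi> i k. of_real (P $ i $ k) * c k)"
  have cc: "c k * c k = of_real (\<epsilon> k)" for k using \<epsilon>[of k] by (auto simp: c_def)
  have \<epsilon>\<epsilon>: "\<epsilon> k * \<epsilon> k = 1" for k using \<epsilon>[of k] by auto
  have DD: "D ** D = mat 1"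
    by (simp add: D_def matrix_matrix_mult_def mat_def vec_eq_iff \<epsilon>\<epsilon> if_distrib[of "\<lambda>x. _ * x"] if_distrib[of "\<lambda>x. x * _"] cong: if_cong)
  have "(D ** transpose P ** g) ** P = mat 1"
    using PgP DD by (simp add: D_def[symmetric] flip: matrix_mul_assoc)
  then have "P ** (D ** transpose P ** g) = mat 1" by (simp only: matrix_left_right_inverse)
  then have inv1: "(P ** D ** transpose P) ** g = mat 1" by (simp add: matrix_mul_assoc)
  then have inv2: "g ** (P ** D ** transpose P) = mat 1" by (simp only: matrix_left_right_inverse)
  \<comment> \<open>\<open>matrix_inv\<close> is defined by choice, so it is identified through the
    uniqueness of two-sided inverses.\<close>
  have "matrix_inv g = P ** D ** transpose P"
  proof -
    have "g ** matrix_inv g = mat 1"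
      unfolding matrix_inv_def by (rule someI2_ex) (use inv1 inv2 in blast)+
    then show ?thesis using inv1 by (metis matrix_mul_assoc matrix_mul_lid matrix_mul_rid)
  qed
  then have ginv: "matrix_inv g $ i $ j = (\<Sum>k\<in>UNIV. P $ i $ k * \<epsilon> k * P $ j $ k)" for i j
    by (simp add: D_def matrix_matrix_mult_def transpose_def if_distrib[of "\<lambda>x. _ * x"] cong: if_cong)
  have g_inv: "(\<Sum>k\<in>UNIV. g $ i $ k * matrix_inv g $ k $ j) = (if i = j then 1 else 0)" for i j
    using inv2 \<open>matrix_inv g = P ** D ** transpose P\<close>
    by (simp add: matrix_matrix_mult_def[of g] mat_def vec_eq_iff)
  have PgP': "(\<Sum>i\<in>UNIV. (\<Sum>j\<in>UNIV. g $ i $ j * P $ j $ k) * P $ i $ l) = (if k = l then \<epsilon> k else 0)" for k l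
  proof -
    have "(transpose P ** (g ** P)) $ l $ k = (if l = k then \<epsilon> l else 0)"
      using PgP by (simp add: matrix_mul_assoc)
    then show ?thesis
      by (simp add: matrix_matrix_mult_def transpose_def mult.commute eq_commute[of k] cong: if_cong)
  qed
  have Q_inv: "of_real (matrix_inv g $ i $ j) = (\<Sum>k\<in>UNIV. Q $ i $ k * Q $ j $ k)" for i j
    by (simp add: ginv Q_def flip: cc) (simp add: mult_ac)
  have "conf_frame g Q"
  proof
    show "3 \<le> CARD('n)" by (rule card)
    show "g $ i $ j = g $ j $ i" for i j
      using sym by (metis transpose_def vec_lambda_beta)
    show "(\<Sum>i\<in>UNIV. (\<Sum>j\<in>UNIV. of_real (g $ i $ j) * Q $ j $ k) * Q $ i $ l) = (if k = l then 1 else 0)" for k l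
    proof -
      have "(\<Sum>i\<in>UNIV. (\<Sum>j\<in>UNIV. of_real (g $ i $ j) * Q $ j $ k) * Q $ i $ l) =
          c k * c l * of_real (\<Sum>i\<in>UNIV. (\<Sum>j\<in>UNIV. g $ i $ j * P $ j $ k) * P $ i $ l)"
        by (simp add: Q_def sum_distrib_left sum_distrib_right mult_ac)
      also have "\<dots> = (if k = l then 1 else 0)"
        unfolding PgP' using \<epsilon>\<epsilon>[of k] by (auto simp: cc simp flip: of_real_mult)
      finally show ?thesis .
    qed
    show "(\<Sum>k\<in>UNIV. (\<Sum>j\<in>UNIV. of_real (g $ i $ j) * Q $ j $ k) * Q $ l $ k) = (if i = l then 1 else 0)" for i l
    proof -
      have "(\<Sum>k\<in>UNIV. (\<Sum>j\<in>UNIV. of_real (g $ i $ j) * Q $ j $ k) * Q $ l $ k) =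
          (\<Sum>k\<in>UNIV. \<Sum>j\<in>UNIV. of_real (g $ i $ j) * (Q $ j $ k * Q $ l $ k))"
        by (simp add: sum_distrib_right mult.assoc)
      also have "\<dots> = (\<Sum>j\<in>UNIV. of_real (g $ i $ j * matrix_inv g $ j $ l))"
        by (subst sum.swap) (simp add: Q_inv sum_distrib_left)
      also have "\<dots> = of_real (\<Sum>j\<in>UNIV. g $ i $ j * matrix_inv g $ j $ l)" by simp
      finally show ?thesis unfolding g_inv by simp
    qed
  qed (rule Q_inv)
  then show thesis by (rule that)
qed

theorem corollary4p5:
  fixes g :: "real^'n^'n" and p q :: nat and \<delta> :: real
  assumes "p + q = CARD('n)" and "p + q \<ge> 3"
    and "has_signature g p q"
  shows "commutant \<delta> (so_conf g) = op_subalgebra hull {E_op, R0_op g} \<and>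
    (\<forall>A\<in>commutant \<delta> (so_conf g). \<forall>B\<in>commutant \<delta> (so_conf g). A \<circ> B = B \<circ> A)"
proof -
  obtain Q where "conf_frame g Q"
    using has_signature_conf_frame[OF assms(3)] assms(1,2) by auto
  then interpret conf_frame g Q .
  have "commutant \<delta> (so_conf g) = op_subalgebra hull {E_op, R0_op g}"
    using commutant_subset_hull hull_subset_commutant by (rule antisym)
  with Alg_commute show ?thesis by simp
qed

end
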